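(* Let $(\beta,\gamma)$ be a switchback pair on a module $V$ over a commutative unital ring $\mathcal{K}$, and let $\beta_1\in\mathrm{Hom}(V^{\otimes 2},\mathcal{K})$ and $\gamma_1\in\mathrm{Hom}(\mathcal{K},V^{\otimes 2})$. (i) The primary obstruction $(\xi_1,\xi_2)$ to deformation of $(\beta,\gamma)$ by $(\beta_1,\gamma_1)$ is given by $\xi_1=d^{2,1}(\beta_1,\gamma_1)$ and $\xi_2=d^{2,2}(\beta_1,\gamma_1)$. Hence $(\beta_1,\gamma_1)$ defines a deformation (that is, $(\beta+t\beta_1,\gamma+t\gamma_1)$ satisfies the switchback conditions modulo $t^2$) if and only if $(\beta_1,\gamma_1)$ is a $2$-cocycle. (ii) If the primary obstruction vanishes, $(\xi_1,\xi_2)=0$ (i.e. $(\beta_1,\gamma_1)$ is a $2$-cocycle), then $(\tilde\beta,\tilde\gamma)=(\beta+t\beta_1,\gamma+t\gamma_1)$ is a switchback pair on $V_t/(t^2V_t)$, regarded as a module over $\mathcal{K}[t]/(t^2)$.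
   Context: All tensor products and Homs are over the base ring; $1$ denotes identity maps. A switchback pair on a module $V$ over a ring $\mathcal{K}$ is a pair $(\beta,\gamma)$ with $\beta\in\mathrm{Hom}(V^{\otimes 2},\mathcal{K})$, $\gamma\in\mathrm{Hom}(\mathcal{K},V^{\otimes 2})$ satisfying the switchback conditions $$(\beta\otimes 1)(1\otimes\gamma)=1,\qquad (1\otimes\beta)(\gamma\otimes 1)=1 \quad\text{on } V.$$ $V_t=V\otimes\mathcal{K}[[t]]$, so $V_t/(t^2V_t)\cong V\otimes \mathcal{K}[t]/(t^2)$; maps $\beta,\beta_1,\gamma,\gamma_1$ are extended linearly in $t$. The $2$-differentials of $(\phi_1,\phi_2)\in\mathrm{Hom}(V^{\otimes 2},\mathcal{K})\oplus\mathrm{Hom}(\mathcal{K},V^{\otimes 2})$ are the elements of $\mathrm{Hom}(V,V)$ $$d^{2,1}(\phi_1,\phi_2)=(\beta\otimes 1)(1\otimes\phi_2)+(\phi_1\otimes 1)(1\otimes\gamma),$$ $$d^{2,2}(\phi_1,\phi_2)=(1\otimes\beta)(\phi_2\otimes 1)+(1\otimes\phi_1)(\gamma\otimes 1).$$ $(\phi_1,\phi_2)$ is a $2$-cocycle if $d^{2,1}(\phi_1,\phi_2)=0$ and $d^{2,2}(\phi_1,\phi_2)=0$. The primary obstruction to deformation of $(\beta,\gamma)$ by $(\beta_1,\gamma_1)$ is the pair $(\xi_1,\xi_2)$ of maps $V\to V$ determined by $$((\beta+t\beta_1)\otimes 1)(1\otimes(\gamma+t\gamma_1))-1\equiv t\,\xi_1,\qquad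 (1\otimes(\beta+t\beta_1))((\gamma+t\gamma_1)\otimes 1)-1\equiv t\,\xi_2 \pmod{t^2}.$$ *)

theory Defs
  imports "HOL-Algebra.QuotRing" "HOL-Algebra.UnivPoly"
begin

section \<open>Modules and module homomorphisms\<close>

text \<open>
  The record type of modules extends that of rings, but the locale \<^locale>\<open>module\<close> does not look
  at the fields \<^const>\<open>mult\<close> and \<^const>\<open>one\<close> of the module, so they carry arbitrary values below.
\<close>

definition with_smult :: "('b, 'm) ring_scheme \<Rightarrow> ('a \<Rightarrow> 'b \<Rightarrow> 'b) \<Rightarrow> ('a, 'b) module" where
  "with_smult M s =
     \<lparr>carrier = carrier M, mult = mult M, one = one M, zero = zero M, add = add M, smult = s\<rparr>"

definition regular_module :: "('a, 'm) ring_scheme \<Rightarrow> ('a, 'a) module" where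
  "regular_module R = with_smult R (mult R)"

definition restrict_scalars :: "('k \<Rightarrow> 'a) \<Rightarrow> ('a, 'b, 'm) module_scheme \<Rightarrow> ('k, 'b) module" where
  "restrict_scalars j M = with_smult M (\<lambda>a. smult M (j a))"

text \<open>
  Homomorphisms are taken to be extensional functions, so that equality of homomorphisms is
  equality in HOL.
\<close>

definition Hom ::
  "('a, 'r) ring_scheme \<Rightarrow> ('a, 'b, 'm) module_scheme \<Rightarrow> ('a, 'c, 'n) module_scheme \<Rightarrow> ('b \<Rightarrow> 'c) set"
  where
  "Hom R M N = {f \<in> carrier M \<rightarrow>\<^sub>E carrier N.
     (\<forall>x\<in>carrier M. \<forall>y\<in>carrier M. f (x \<oplus>\<^bsub>M\<^esub> y) = f x \<oplus>\<^bsub>N\<^esub> f y) \<and>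
     (\<forall>a\<in>carrier R. \<forall>x\<in>carrier M. f (a \<odot>\<^bsub>M\<^esub> x) = a \<odot>\<^bsub>N\<^esub> f x)}"

definition id_map :: "('b, 'm) ring_scheme \<Rightarrow> 'b \<Rightarrow> 'b" where
  "id_map M = (\<lambda>x\<in>carrier M. x)"

definition zero_map :: "('b, 'm) ring_scheme \<Rightarrow> ('c, 'n) ring_scheme \<Rightarrow> 'b \<Rightarrow> 'c" where
  "zero_map M N = (\<lambda>x\<in>carrier M. \<zero>\<^bsub>N\<^esub>)"

definition add_map ::
  "('b, 'm) ring_scheme \<Rightarrow> ('c, 'n) ring_scheme \<Rightarrow> ('b \<Rightarrow> 'c) \<Rightarrow> ('b \<Rightarrow> 'c) \<Rightarrow> 'b \<Rightarrow> 'c" where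
  "add_map M N f g = (\<lambda>x\<in>carrier M. f x \<oplus>\<^bsub>N\<^esub> g x)"

definition quotient_module :: "('a, 'b, 'm) module_scheme \<Rightarrow> 'b set \<Rightarrow> ('a, 'b set) module" where
  "quotient_module M H =
     \<lparr>carrier = a_rcosets\<^bsub>M\<^esub> H, mult = undefined, one = undefined, zero = H, add = set_add M,
      smult = (\<lambda>a X. \<Union>x\<in>X. H +>\<^bsub>M\<^esub> (a \<odot>\<^bsub>M\<^esub> x))\<rparr>"


section \<open>Tensor products\<close>

definition free_module :: "('a, 'r) ring_scheme \<Rightarrow> 'b set \<Rightarrow> ('a, 'b \<Rightarrow> 'a) module" where
  "free_module R B =
     \<lparr>carrier = {f. (\<forall>z. f z \<in> carrier R) \<and> finite {z. f z \<noteq> \<zero>\<^bsub>R\<^esub>} \<and> {z. f z \<noteq> \<zero>\<^bsub>R\<^esub>} \<subseteq> B},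
      mult = undefined, one = undefined, zero = (\<lambda>z. \<zero>\<^bsub>R\<^esub>), add = (\<lambda>f g z. f z \<oplus>\<^bsub>R\<^esub> g z),
      smult = (\<lambda>a f z. a \<otimes>\<^bsub>R\<^esub> f z)\<rparr>"

definition free_gen :: "('a, 'r) ring_scheme \<Rightarrow> 'b \<Rightarrow> 'b \<Rightarrow> 'a" where
  "free_gen R b = (\<lambda>z. if z = b then \<one>\<^bsub>R\<^esub> else \<zero>\<^bsub>R\<^esub>)"

definition free_on_pairs ::
  "('a, 'r) ring_scheme \<Rightarrow> ('a, 'b, 'm) module_scheme \<Rightarrow> ('a, 'c, 'n) module_scheme
     \<Rightarrow> ('a, 'b \<times> 'c \<Rightarrow> 'a) module" where
  "free_on_pairs R M N = free_module R (carrier M \<times> carrier N)"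

inductive_set bilinear_relations ::
  "('a, 'r) ring_scheme \<Rightarrow> ('a, 'b, 'm) module_scheme \<Rightarrow> ('a, 'c, 'n) module_scheme
     \<Rightarrow> ('b \<times> 'c \<Rightarrow> 'a) set"
  for R M N where
    add_left: "\<lbrakk>x \<in> carrier M; x' \<in> carrier M; y \<in> carrier N\<rbrakk> \<Longrightarrow>
      free_gen R (x \<oplus>\<^bsub>M\<^esub> x', y)
        \<ominus>\<^bsub>free_on_pairs R M N\<^esub> (free_gen R (x, y) \<oplus>\<^bsub>free_on_pairs R M N\<^esub> free_gen R (x', y))
        \<in> bilinear_relations R M N"
  | add_right: "\<lbrakk>x \<in> carrier M; y \<in> carrier N; y' \<in> carrier N\<rbrakk> \<Longrightarrow>
      free_gen R (x, y \<oplus>\<^bsub>N\<^esub> y')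
        \<ominus>\<^bsub>free_on_pairs R M N\<^esub> (free_gen R (x, y) \<oplus>\<^bsub>free_on_pairs R M N\<^esub> free_gen R (x, y'))
        \<in> bilinear_relations R M N"
  | smult_left: "\<lbrakk>a \<in> carrier R; x \<in> carrier M; y \<in> carrier N\<rbrakk> \<Longrightarrow>
      free_gen R (a \<odot>\<^bsub>M\<^esub> x, y)
        \<ominus>\<^bsub>free_on_pairs R M N\<^esub> (a \<odot>\<^bsub>free_on_pairs R M N\<^esub> free_gen R (x, y))
        \<in> bilinear_relations R M N"
  | smult_right: "\<lbrakk>a \<in> carrier R; x \<in> carrier M; y \<in> carrier N\<rbrakk> \<Longrightarrow>
      free_gen R (x, a \<odot>\<^bsub>N\<^esub> y)
        \<ominus>\<^bsub>free_on_pairs R M N\<^esub> (a \<odot>\<^bsub>free_on_pairs R M N\<^esub> free_gen R (x, y))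
        \<in> bilinear_relations R M N"

definition relation_submodule ::
  "('a, 'r) ring_scheme \<Rightarrow> ('a, 'b, 'm) module_scheme \<Rightarrow> ('a, 'c, 'n) module_scheme \<Rightarrow> ('b \<times> 'c \<Rightarrow> 'a) set"
  where
  "relation_submodule R M N =
     \<Inter>{H. submodule H R (free_on_pairs R M N) \<and> bilinear_relations R M N \<subseteq> H}"

definition tensor ::
  "('a, 'r) ring_scheme \<Rightarrow> ('a, 'b, 'm) module_scheme \<Rightarrow> ('a, 'c, 'n) module_scheme
     \<Rightarrow> ('a, ('b \<times> 'c \<Rightarrow> 'a) set) module" where
  "tensor R M N =
     quotient_module (free_on_pairs R M N) (relation_submodule R M N)"

definition tens ::
  "('a, 'r) ring_scheme \<Rightarrow> ('a, 'b, 'm) module_scheme \<Rightarrow> ('a, 'c, 'n) module_scheme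
     \<Rightarrow> 'b \<Rightarrow> 'c \<Rightarrow> ('b \<times> 'c \<Rightarrow> 'a) set" where
  "tens R M N x y =
     relation_submodule R M N +>\<^bsub>free_on_pairs R M N\<^esub> free_gen R (x, y)"

text \<open>The linear map on the tensor product that corresponds to the bilinear map \<open>b\<close>.\<close>

definition tensor_lift ::
  "('a, 'r) ring_scheme \<Rightarrow> ('a, 'b, 'm) module_scheme \<Rightarrow> ('a, 'c, 'n) module_scheme
     \<Rightarrow> ('a, 'd, 'p) module_scheme \<Rightarrow> ('b \<Rightarrow> 'c \<Rightarrow> 'd) \<Rightarrow> ('b \<times> 'c \<Rightarrow> 'a) set \<Rightarrow> 'd" where
  "tensor_lift R M N P b =
     (THE h. h \<in> Hom R (tensor R M N) P \<and>
        (\<forall>x\<in>carrier M. \<forall>y\<in>carrier N. h (tens R M N x y) = b x y))"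

text \<open>The map \<open>f \<otimes> g : M \<otimes> N \<rightarrow> M' \<otimes> N'\<close>.\<close>

definition tensor_map ::
  "('a, 'r) ring_scheme \<Rightarrow> ('a, 'b, 'm) module_scheme \<Rightarrow> ('a, 'c, 'n) module_scheme
     \<Rightarrow> ('a, 'd, 'p) module_scheme \<Rightarrow> ('a, 'e, 'q) module_scheme
     \<Rightarrow> ('b \<Rightarrow> 'd) \<Rightarrow> ('c \<Rightarrow> 'e) \<Rightarrow> ('b \<times> 'c \<Rightarrow> 'a) set \<Rightarrow> ('d \<times> 'e \<Rightarrow> 'a) set" where
  "tensor_map R M N M' N' f g =
     tensor_lift R M N (tensor R M' N') (\<lambda>x y. tens R M' N' (f x) (g y))"

text \<open>The canonical isomorphisms \<open>(V \<otimes> V) \<otimes> V \<leftrightarrow> V \<otimes> (V \<otimes> V)\<close>, \<open>R \<otimes> V \<rightarrow> V\<close> and \<open>V \<otimes> R \<rightarrow> V\<close>.\<close>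

definition assoc_right ::
  "('a, 'r) ring_scheme \<Rightarrow> ('a, 'v, 'm) module_scheme
     \<Rightarrow> (('v \<times> 'v \<Rightarrow> 'a) set \<times> 'v \<Rightarrow> 'a) set \<Rightarrow> ('v \<times> ('v \<times> 'v \<Rightarrow> 'a) set \<Rightarrow> 'a) set" where
  "assoc_right R V =
     tensor_lift R (tensor R V V) V (tensor R V (tensor R V V))
       (\<lambda>z w. tensor_lift R V V (tensor R V (tensor R V V))
                (\<lambda>u v. tens R V (tensor R V V) u (tens R V V v w)) z)"

definition assoc_left ::
  "('a, 'r) ring_scheme \<Rightarrow> ('a, 'v, 'm) module_scheme
     \<Rightarrow> ('v \<times> ('v \<times> 'v \<Rightarrow> 'a) set \<Rightarrow> 'a) set \<Rightarrow> (('v \<times> 'v \<Rightarrow> 'a) set \<times> 'v \<Rightarrow> 'a) set" where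
  "assoc_left R V =
     tensor_lift R V (tensor R V V) (tensor R (tensor R V V) V)
       (\<lambda>u z. tensor_lift R V V (tensor R (tensor R V V) V)
                (\<lambda>v w. tens R (tensor R V V) V (tens R V V u v) w) z)"

definition left_unitor ::
  "('a, 'r) ring_scheme \<Rightarrow> ('a, 'v, 'm) module_scheme \<Rightarrow> ('a \<times> 'v \<Rightarrow> 'a) set \<Rightarrow> 'v" where
  "left_unitor R V = tensor_lift R (regular_module R) V V (\<lambda>a v. a \<odot>\<^bsub>V\<^esub> v)"

definition right_unitor ::
  "('a, 'r) ring_scheme \<Rightarrow> ('a, 'v, 'm) module_scheme \<Rightarrow> ('v \<times> 'a \<Rightarrow> 'a) set \<Rightarrow> 'v" where
  "right_unitor R V = tensor_lift R V (regular_module R) V (\<lambda>v a. a \<odot>\<^bsub>V\<^esub> v)"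


section \<open>Switchback pairs and their differentials\<close>

text \<open>
  The composite \<open>(\<phi> \<otimes> 1)(1 \<otimes> \<psi>) : V \<cong> V \<otimes> R \<rightarrow> V \<otimes> (V \<otimes> V) \<cong> (V \<otimes> V) \<otimes> V \<rightarrow> R \<otimes> V \<cong> V\<close>.
\<close>

definition snake_left ::
  "('a, 'r) ring_scheme \<Rightarrow> ('a, 'v, 'm) module_scheme
     \<Rightarrow> (('v \<times> 'v \<Rightarrow> 'a) set \<Rightarrow> 'a) \<Rightarrow> ('a \<Rightarrow> ('v \<times> 'v \<Rightarrow> 'a) set) \<Rightarrow> 'v \<Rightarrow> 'v" where
  "snake_left R V \<phi> \<psi> = (\<lambda>v\<in>carrier V.
     left_unitor R V
       (tensor_map R (tensor R V V) V (regular_module R) V \<phi> (id_map V)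
         (assoc_left R V
           (tensor_map R V (regular_module R) V (tensor R V V) (id_map V) \<psi>
             (tens R V (regular_module R) v \<one>\<^bsub>R\<^esub>)))))"

text \<open>
  The composite \<open>(1 \<otimes> \<phi>)(\<psi> \<otimes> 1) : V \<cong> R \<otimes> V \<rightarrow> (V \<otimes> V) \<otimes> V \<cong> V \<otimes> (V \<otimes> V) \<rightarrow> V \<otimes> R \<cong> V\<close>.
\<close>

definition snake_right ::
  "('a, 'r) ring_scheme \<Rightarrow> ('a, 'v, 'm) module_scheme
     \<Rightarrow> (('v \<times> 'v \<Rightarrow> 'a) set \<Rightarrow> 'a) \<Rightarrow> ('a \<Rightarrow> ('v \<times> 'v \<Rightarrow> 'a) set) \<Rightarrow> 'v \<Rightarrow> 'v" where
  "snake_right R V \<phi> \<psi> = (\<lambda>v\<in>carrier V.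
     right_unitor R V
       (tensor_map R V (tensor R V V) V (regular_module R) (id_map V) \<phi>
         (assoc_right R V
           (tensor_map R (regular_module R) V (tensor R V V) V \<psi> (id_map V)
             (tens R (regular_module R) V \<one>\<^bsub>R\<^esub> v)))))"

definition switchback_pair ::
  "('a, 'r) ring_scheme \<Rightarrow> ('a, 'v, 'm) module_scheme
     \<Rightarrow> (('v \<times> 'v \<Rightarrow> 'a) set \<Rightarrow> 'a) \<Rightarrow> ('a \<Rightarrow> ('v \<times> 'v \<Rightarrow> 'a) set) \<Rightarrow> bool" where
  "switchback_pair R V \<beta> \<gamma> \<longleftrightarrow>
     module R V \<and>
     \<beta> \<in> Hom R (tensor R V V) (regular_module R) \<and>
     \<gamma> \<in> Hom R (regular_module R) (tensor R V V) \<and>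
     snake_left R V \<beta> \<gamma> = id_map V \<and>
     snake_right R V \<beta> \<gamma> = id_map V"

definition d21 ::
  "('a, 'r) ring_scheme \<Rightarrow> ('a, 'v, 'm) module_scheme
     \<Rightarrow> (('v \<times> 'v \<Rightarrow> 'a) set \<Rightarrow> 'a) \<Rightarrow> ('a \<Rightarrow> ('v \<times> 'v \<Rightarrow> 'a) set)
     \<Rightarrow> (('v \<times> 'v \<Rightarrow> 'a) set \<Rightarrow> 'a) \<Rightarrow> ('a \<Rightarrow> ('v \<times> 'v \<Rightarrow> 'a) set) \<Rightarrow> 'v \<Rightarrow> 'v" where
  "d21 R V \<beta> \<gamma> \<phi>1 \<phi>2 = add_map V V (snake_left R V \<beta> \<phi>2) (snake_left R V \<phi>1 \<gamma>)"

definition d22 ::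
  "('a, 'r) ring_scheme \<Rightarrow> ('a, 'v, 'm) module_scheme
     \<Rightarrow> (('v \<times> 'v \<Rightarrow> 'a) set \<Rightarrow> 'a) \<Rightarrow> ('a \<Rightarrow> ('v \<times> 'v \<Rightarrow> 'a) set)
     \<Rightarrow> (('v \<times> 'v \<Rightarrow> 'a) set \<Rightarrow> 'a) \<Rightarrow> ('a \<Rightarrow> ('v \<times> 'v \<Rightarrow> 'a) set) \<Rightarrow> 'v \<Rightarrow> 'v" where
  "d22 R V \<beta> \<gamma> \<phi>1 \<phi>2 = add_map V V (snake_right R V \<beta> \<phi>2) (snake_right R V \<phi>1 \<gamma>)"

definition two_cocycle ::
  "('a, 'r) ring_scheme \<Rightarrow> ('a, 'v, 'm) module_scheme
     \<Rightarrow> (('v \<times> 'v \<Rightarrow> 'a) set \<Rightarrow> 'a) \<Rightarrow> ('a \<Rightarrow> ('v \<times> 'v \<Rightarrow> 'a) set)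
     \<Rightarrow> (('v \<times> 'v \<Rightarrow> 'a) set \<Rightarrow> 'a) \<Rightarrow> ('a \<Rightarrow> ('v \<times> 'v \<Rightarrow> 'a) set) \<Rightarrow> bool" where
  "two_cocycle R V \<beta> \<gamma> \<phi>1 \<phi>2 \<longleftrightarrow>
     d21 R V \<beta> \<gamma> \<phi>1 \<phi>2 = zero_map V V \<and> d22 R V \<beta> \<gamma> \<phi>1 \<phi>2 = zero_map V V"


section \<open>Power series, truncated polynomials and the modules over them\<close>

text \<open>
  Power series are coefficient functions, as are the polynomials in \<^const>\<open>UP\<close>; hence \<open>K[t]\<close> is
  literally contained in \<open>K[[t]]\<close>, and \<^term>\<open>monom (UP K) a n\<close> also denotes the series \<open>a t\<^sup>n\<close>.
  The record is at the same time the ring \<open>K[[t]]\<close> and the \<open>K\<close>-module \<open>K[[t]]\<close>.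
\<close>

definition power_series :: "('a, 'k) ring_scheme \<Rightarrow> ('a, nat \<Rightarrow> 'a) module" where
  "power_series K =
     \<lparr>carrier = {f. \<forall>n. f n \<in> carrier K},
      mult = (\<lambda>f g n. \<Oplus>\<^bsub>K\<^esub>i\<in>{..n}. f i \<otimes>\<^bsub>K\<^esub> g (n - i)),
      one = (\<lambda>n. if n = 0 then \<one>\<^bsub>K\<^esub> else \<zero>\<^bsub>K\<^esub>),
      zero = (\<lambda>n. \<zero>\<^bsub>K\<^esub>),
      add = (\<lambda>f g n. f n \<oplus>\<^bsub>K\<^esub> g n),
      smult = (\<lambda>a f n. a \<otimes>\<^bsub>K\<^esub> f n)\<rparr>"

definition t_pow :: "('a, 'k) ring_scheme \<Rightarrow> nat \<Rightarrow> nat \<Rightarrow> 'a" where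
  "t_pow K n = monom (UP K) \<one>\<^bsub>K\<^esub> n"

definition const_poly :: "('a, 'k) ring_scheme \<Rightarrow> 'a \<Rightarrow> nat \<Rightarrow> 'a" where
  "const_poly K a = monom (UP K) a 0"

text \<open>\<open>V\<^sub>t = V \<otimes> K[[t]]\<close>, as a module over \<open>K[[t]]\<close>.\<close>

definition Vt ::
  "('a, 'k) ring_scheme \<Rightarrow> ('a, 'v, 'm) module_scheme
     \<Rightarrow> (nat \<Rightarrow> 'a, ('v \<times> (nat \<Rightarrow> 'a) \<Rightarrow> 'a) set) module" where
  "Vt K V = with_smult (tensor K V (power_series K))
     (\<lambda>p. tensor_map K V (power_series K) V (power_series K) (id_map V)
            (\<lambda>q\<in>carrier (power_series K). p \<otimes>\<^bsub>power_series K\<^esub> q))"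

definition Vt_incl ::
  "('a, 'k) ring_scheme \<Rightarrow> ('a, 'v, 'm) module_scheme \<Rightarrow> 'v \<Rightarrow> ('v \<times> (nat \<Rightarrow> 'a) \<Rightarrow> 'a) set" where
  "Vt_incl K V v = tens K V (power_series K) v \<one>\<^bsub>power_series K\<^esub>"

definition t2Vt ::
  "('a, 'k) ring_scheme \<Rightarrow> ('a, 'v, 'm) module_scheme \<Rightarrow> ('v \<times> (nat \<Rightarrow> 'a) \<Rightarrow> 'a) set set" where
  "t2Vt K V = (\<lambda>x. t_pow K 2 \<odot>\<^bsub>Vt K V\<^esub> x) ` carrier (Vt K V)"

definition t2_ideal :: "('a, 'k) ring_scheme \<Rightarrow> (nat \<Rightarrow> 'a) set" where
  "t2_ideal K = PIdl\<^bsub>UP K\<^esub> (t_pow K 2)"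

definition trunc_poly :: "('a, 'k) ring_scheme \<Rightarrow> (nat \<Rightarrow> 'a) set ring" where
  "trunc_poly K = UP K Quot t2_ideal K"

definition trunc_class :: "('a, 'k) ring_scheme \<Rightarrow> (nat \<Rightarrow> 'a) \<Rightarrow> (nat \<Rightarrow> 'a) set" where
  "trunc_class K p = t2_ideal K +>\<^bsub>UP K\<^esub> p"

text \<open>
  \<open>V\<^sub>t/(t\<^sup>2V\<^sub>t)\<close> as a module over \<open>K[t]/(t\<^sup>2)\<close>: the class of a polynomial \<open>p\<close> sends the class of \<open>x\<close>
  to the class of \<open>p x\<close>.
\<close>

definition trunc_Vt ::
  "('a, 'k) ring_scheme \<Rightarrow> ('a, 'v, 'm) module_scheme
     \<Rightarrow> ((nat \<Rightarrow> 'a) set, ('v \<times> (nat \<Rightarrow> 'a) \<Rightarrow> 'a) set set) module" where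
  "trunc_Vt K V = with_smult (quotient_module (Vt K V) (t2Vt K V))
     (\<lambda>P X. \<Union>p\<in>P. \<Union>x\<in>X. t2Vt K V +>\<^bsub>Vt K V\<^esub> (p \<odot>\<^bsub>Vt K V\<^esub> x))"

definition trunc_incl ::
  "('a, 'k) ring_scheme \<Rightarrow> ('a, 'v, 'm) module_scheme \<Rightarrow> 'v \<Rightarrow> ('v \<times> (nat \<Rightarrow> 'a) \<Rightarrow> 'a) set set" where
  "trunc_incl K V v = t2Vt K V +>\<^bsub>Vt K V\<^esub> Vt_incl K V v"


section \<open>Extending maps linearly in \<open>t\<close>\<close>

text \<open>
  Here \<open>A\<close> is a ring with a structure map \<open>j : K \<rightarrow> A\<close>, and \<open>M\<close> an \<open>A\<close>-module with a map
  \<open>\<iota> : V \<rightarrow> M\<close> that exhibits it as the extension of scalars of \<open>V\<close>.  It is used for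
  \<open>A = K[[t]]\<close>, \<open>M = V\<^sub>t\<close> and for \<open>A = K[t]/(t\<^sup>2)\<close>, \<open>M = V\<^sub>t/(t\<^sup>2V\<^sub>t)\<close>.

  The \<open>A\<close>-linear extension of \<open>f : X \<rightarrow> Y\<close> is the \<open>A\<close>-linear \<open>g : X' \<rightarrow> Y'\<close> that agrees with \<open>f\<close>
  along \<open>i : X \<rightarrow> X'\<close> and \<open>k : Y \<rightarrow> Y'\<close>.
\<close>

definition linear_extension ::
  "('a, 'r) ring_scheme \<Rightarrow> ('a, 'b, 'm) module_scheme \<Rightarrow> ('a, 'c, 'n) module_scheme
     \<Rightarrow> 'x set \<Rightarrow> ('x \<Rightarrow> 'b) \<Rightarrow> ('y \<Rightarrow> 'c) \<Rightarrow> ('x \<Rightarrow> 'y) \<Rightarrow> 'b \<Rightarrow> 'c" where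
  "linear_extension A X' Y' X i k f =
     (THE g. g \<in> Hom A X' Y' \<and> (\<forall>x\<in>X. g (i x) = k (f x)))"

text \<open>The \<open>K\<close>-linear map \<open>V \<otimes>\<^sub>K V \<rightarrow> M \<otimes>\<^sub>A M\<close> with \<open>v \<otimes> w \<mapsto> \<iota> v \<otimes> \<iota> w\<close>.\<close>

definition tensor_square_incl ::
  "('k, 'r) ring_scheme \<Rightarrow> ('k, 'v, 'm) module_scheme \<Rightarrow> ('a, 's) ring_scheme \<Rightarrow> ('k \<Rightarrow> 'a)
     \<Rightarrow> ('a, 'w, 'n) module_scheme \<Rightarrow> ('v \<Rightarrow> 'w) \<Rightarrow> ('v \<times> 'v \<Rightarrow> 'k) set \<Rightarrow> ('w \<times> 'w \<Rightarrow> 'a) set" where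
  "tensor_square_incl K V A j M \<iota> =
     tensor_lift K V V (restrict_scalars j (tensor A M M)) (\<lambda>v w. tens A M M (\<iota> v) (\<iota> w))"

definition extend_pairing ::
  "('k, 'r) ring_scheme \<Rightarrow> ('k, 'v, 'm) module_scheme \<Rightarrow> ('a, 's) ring_scheme \<Rightarrow> ('k \<Rightarrow> 'a)
     \<Rightarrow> ('a, 'w, 'n) module_scheme \<Rightarrow> ('v \<Rightarrow> 'w)
     \<Rightarrow> (('v \<times> 'v \<Rightarrow> 'k) set \<Rightarrow> 'k) \<Rightarrow> ('w \<times> 'w \<Rightarrow> 'a) set \<Rightarrow> 'a" where
  "extend_pairing K V A j M \<iota> \<phi> =
     linear_extension A (tensor A M M) (regular_module A)
       (carrier (tensor K V V)) (tensor_square_incl K V A j M \<iota>) j \<phi>"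

definition extend_copairing ::
  "('k, 'r) ring_scheme \<Rightarrow> ('k, 'v, 'm) module_scheme \<Rightarrow> ('a, 's) ring_scheme \<Rightarrow> ('k \<Rightarrow> 'a)
     \<Rightarrow> ('a, 'w, 'n) module_scheme \<Rightarrow> ('v \<Rightarrow> 'w)
     \<Rightarrow> ('k \<Rightarrow> ('v \<times> 'v \<Rightarrow> 'k) set) \<Rightarrow> 'a \<Rightarrow> ('w \<times> 'w \<Rightarrow> 'a) set" where
  "extend_copairing K V A j M \<iota> \<psi> =
     linear_extension A (regular_module A) (tensor A M M)
       (carrier K) j (tensor_square_incl K V A j M \<iota>) \<psi>"

text \<open>\<open>\<beta> + \<tau> \<beta>\<^sub>1\<close> and \<open>\<gamma> + \<tau> \<gamma>\<^sub>1\<close> over \<open>A\<close>, with \<open>\<tau> \<in> A\<close> in the role of \<open>t\<close>.\<close>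

definition deformed_pairing ::
  "('k, 'r) ring_scheme \<Rightarrow> ('k, 'v, 'm) module_scheme \<Rightarrow> ('a, 's) ring_scheme \<Rightarrow> ('k \<Rightarrow> 'a)
     \<Rightarrow> ('a, 'w, 'n) module_scheme \<Rightarrow> ('v \<Rightarrow> 'w) \<Rightarrow> 'a
     \<Rightarrow> (('v \<times> 'v \<Rightarrow> 'k) set \<Rightarrow> 'k) \<Rightarrow> (('v \<times> 'v \<Rightarrow> 'k) set \<Rightarrow> 'k) \<Rightarrow> ('w \<times> 'w \<Rightarrow> 'a) set \<Rightarrow> 'a" where
  "deformed_pairing K V A j M \<iota> \<tau> \<beta> \<beta>1 =
     (\<lambda>x\<in>carrier (tensor A M M).
        extend_pairing K V A j M \<iota> \<beta> x \<oplus>\<^bsub>A\<^esub> \<tau> \<otimes>\<^bsub>A\<^esub> extend_pairing K V A j M \<iota> \<beta>1 x)"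

definition deformed_copairing ::
  "('k, 'r) ring_scheme \<Rightarrow> ('k, 'v, 'm) module_scheme \<Rightarrow> ('a, 's) ring_scheme \<Rightarrow> ('k \<Rightarrow> 'a)
     \<Rightarrow> ('a, 'w, 'n) module_scheme \<Rightarrow> ('v \<Rightarrow> 'w) \<Rightarrow> 'a
     \<Rightarrow> ('k \<Rightarrow> ('v \<times> 'v \<Rightarrow> 'k) set) \<Rightarrow> ('k \<Rightarrow> ('v \<times> 'v \<Rightarrow> 'k) set) \<Rightarrow> 'a \<Rightarrow> ('w \<times> 'w \<Rightarrow> 'a) set" where
  "deformed_copairing K V A j M \<iota> \<tau> \<gamma> \<gamma>1 =
     (\<lambda>a\<in>carrier A.
        extend_copairing K V A j M \<iota> \<gamma> a
          \<oplus>\<^bsub>tensor A M M\<^esub> \<tau> \<odot>\<^bsub>tensor A M M\<^esub> extend_copairing K V A j M \<iota> \<gamma>1 a)"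


section \<open>The primary obstruction\<close>

definition beta_t ::
  "('a, 'k) ring_scheme \<Rightarrow> ('a, 'v, 'm) module_scheme
     \<Rightarrow> (('v \<times> 'v \<Rightarrow> 'a) set \<Rightarrow> 'a) \<Rightarrow> (('v \<times> 'v \<Rightarrow> 'a) set \<Rightarrow> 'a)
     \<Rightarrow> (('v \<times> (nat \<Rightarrow> 'a) \<Rightarrow> 'a) set \<times> ('v \<times> (nat \<Rightarrow> 'a) \<Rightarrow> 'a) set \<Rightarrow> nat \<Rightarrow> 'a) set \<Rightarrow> nat \<Rightarrow> 'a" where
  "beta_t K V =
     deformed_pairing K V (power_series K) (const_poly K) (Vt K V) (Vt_incl K V) (t_pow K 1)"

definition gamma_t ::
  "('a, 'k) ring_scheme \<Rightarrow> ('a, 'v, 'm) module_scheme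
     \<Rightarrow> ('a \<Rightarrow> ('v \<times> 'v \<Rightarrow> 'a) set) \<Rightarrow> ('a \<Rightarrow> ('v \<times> 'v \<Rightarrow> 'a) set)
     \<Rightarrow> (nat \<Rightarrow> 'a) \<Rightarrow> (('v \<times> (nat \<Rightarrow> 'a) \<Rightarrow> 'a) set \<times> ('v \<times> (nat \<Rightarrow> 'a) \<Rightarrow> 'a) set \<Rightarrow> nat \<Rightarrow> 'a) set" where
  "gamma_t K V =
     deformed_copairing K V (power_series K) (const_poly K) (Vt K V) (Vt_incl K V) (t_pow K 1)"

definition beta_tilde ::
  "('a, 'k) ring_scheme \<Rightarrow> ('a, 'v, 'm) module_scheme
     \<Rightarrow> (('v \<times> 'v \<Rightarrow> 'a) set \<Rightarrow> 'a) \<Rightarrow> (('v \<times> 'v \<Rightarrow> 'a) set \<Rightarrow> 'a)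
     \<Rightarrow> (('v \<times> (nat \<Rightarrow> 'a) \<Rightarrow> 'a) set set \<times> ('v \<times> (nat \<Rightarrow> 'a) \<Rightarrow> 'a) set set \<Rightarrow> (nat \<Rightarrow> 'a) set) set
     \<Rightarrow> (nat \<Rightarrow> 'a) set" where
  "beta_tilde K V =
     deformed_pairing K V (trunc_poly K) (\<lambda>a. trunc_class K (const_poly K a))
       (trunc_Vt K V) (trunc_incl K V) (trunc_class K (t_pow K 1))"

definition gamma_tilde ::
  "('a, 'k) ring_scheme \<Rightarrow> ('a, 'v, 'm) module_scheme
     \<Rightarrow> ('a \<Rightarrow> ('v \<times> 'v \<Rightarrow> 'a) set) \<Rightarrow> ('a \<Rightarrow> ('v \<times> 'v \<Rightarrow> 'a) set)
     \<Rightarrow> (nat \<Rightarrow> 'a) set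
     \<Rightarrow> (('v \<times> (nat \<Rightarrow> 'a) \<Rightarrow> 'a) set set \<times> ('v \<times> (nat \<Rightarrow> 'a) \<Rightarrow> 'a) set set \<Rightarrow> (nat \<Rightarrow> 'a) set) set" where
  "gamma_tilde K V =
     deformed_copairing K V (trunc_poly K) (\<lambda>a. trunc_class K (const_poly K a))
       (trunc_Vt K V) (trunc_incl K V) (trunc_class K (t_pow K 1))"

definition cong_mod_t2 ::
  "('a, 'k) ring_scheme \<Rightarrow> ('a, 'v, 'm) module_scheme
     \<Rightarrow> (('v \<times> (nat \<Rightarrow> 'a) \<Rightarrow> 'a) set \<Rightarrow> ('v \<times> (nat \<Rightarrow> 'a) \<Rightarrow> 'a) set)
     \<Rightarrow> (('v \<times> (nat \<Rightarrow> 'a) \<Rightarrow> 'a) set \<Rightarrow> ('v \<times> (nat \<Rightarrow> 'a) \<Rightarrow> 'a) set) \<Rightarrow> bool" where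
  "cong_mod_t2 K V f g \<longleftrightarrow> (\<forall>x\<in>carrier (Vt K V). f x \<ominus>\<^bsub>Vt K V\<^esub> g x \<in> t2Vt K V)"

definition extend_endo ::
  "('a, 'k) ring_scheme \<Rightarrow> ('a, 'v, 'm) module_scheme \<Rightarrow> ('v \<Rightarrow> 'v)
     \<Rightarrow> ('v \<times> (nat \<Rightarrow> 'a) \<Rightarrow> 'a) set \<Rightarrow> ('v \<times> (nat \<Rightarrow> 'a) \<Rightarrow> 'a) set" where
  "extend_endo K V \<xi> =
     linear_extension (power_series K) (Vt K V) (Vt K V) (carrier V) (Vt_incl K V) (Vt_incl K V) \<xi>"

definition primary_obstruction ::
  "('a, 'k) ring_scheme \<Rightarrow> ('a, 'v, 'm) module_scheme
     \<Rightarrow> (('v \<times> 'v \<Rightarrow> 'a) set \<Rightarrow> 'a) \<Rightarrow> ('a \<Rightarrow> ('v \<times> 'v \<Rightarrow> 'a) set)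
     \<Rightarrow> (('v \<times> 'v \<Rightarrow> 'a) set \<Rightarrow> 'a) \<Rightarrow> ('a \<Rightarrow> ('v \<times> 'v \<Rightarrow> 'a) set)
     \<Rightarrow> ('v \<Rightarrow> 'v) \<Rightarrow> ('v \<Rightarrow> 'v) \<Rightarrow> bool" where
  "primary_obstruction K V \<beta> \<gamma> \<beta>1 \<gamma>1 \<xi>1 \<xi>2 \<longleftrightarrow>
     \<xi>1 \<in> Hom K V V \<and> \<xi>2 \<in> Hom K V V \<and>
     cong_mod_t2 K V
       (\<lambda>x. snake_left (power_series K) (Vt K V) (beta_t K V \<beta> \<beta>1) (gamma_t K V \<gamma> \<gamma>1) x \<ominus>\<^bsub>Vt K V\<^esub> x)
       (\<lambda>x. t_pow K 1 \<odot>\<^bsub>Vt K V\<^esub> extend_endo K V \<xi>1 x) \<and>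
     cong_mod_t2 K V
       (\<lambda>x. snake_right (power_series K) (Vt K V) (beta_t K V \<beta> \<beta>1) (gamma_t K V \<gamma> \<gamma>1) x \<ominus>\<^bsub>Vt K V\<^esub> x)
       (\<lambda>x. t_pow K 1 \<odot>\<^bsub>Vt K V\<^esub> extend_endo K V \<xi>2 x)"

definition defines_deformation ::
  "('a, 'k) ring_scheme \<Rightarrow> ('a, 'v, 'm) module_scheme
     \<Rightarrow> (('v \<times> 'v \<Rightarrow> 'a) set \<Rightarrow> 'a) \<Rightarrow> ('a \<Rightarrow> ('v \<times> 'v \<Rightarrow> 'a) set)
     \<Rightarrow> (('v \<times> 'v \<Rightarrow> 'a) set \<Rightarrow> 'a) \<Rightarrow> ('a \<Rightarrow> ('v \<times> 'v \<Rightarrow> 'a) set) \<Rightarrow> bool" where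
  "defines_deformation K V \<beta> \<gamma> \<beta>1 \<gamma>1 \<longleftrightarrow>
     cong_mod_t2 K V
       (snake_left (power_series K) (Vt K V) (beta_t K V \<beta> \<beta>1) (gamma_t K V \<gamma> \<gamma>1)) (id_map (Vt K V)) \<and>
     cong_mod_t2 K V
       (snake_right (power_series K) (Vt K V) (beta_t K V \<beta> \<beta>1) (gamma_t K V \<gamma> \<gamma>1)) (id_map (Vt K V))"

end

theory Submission
  imports Defs
begin

text \<open>
  Contracting \<open>v \<otimes> z\<close> (respectively \<open>z \<otimes> v\<close>) with a pairing \<open>\<phi>\<close> turns both snake maps into
  expressions that are linear in \<open>\<phi>\<close> and in the element \<open>\<psi> 1\<close> of \<open>V \<otimes> V\<close>, and these contractions
  commute with extension of scalars.  Hence over any extension of scalars, with \<open>\<tau>\<close> in place of \<open>t\<close>,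
  the snake map of \<open>(\<beta> + \<tau> \<beta>\<^sub>1, \<gamma> + \<tau> \<gamma>\<^sub>1)\<close> sends \<open>v\<close> to \<open>v + \<tau> (d v) + \<tau>\<^sup>2 (s v)\<close>, where \<open>d\<close> is
  the 2-differential of \<open>(\<beta>\<^sub>1, \<gamma>\<^sub>1)\<close> and \<open>s\<close> its snake map.  Over \<open>K[[t]]\<close> the coefficient of \<open>t\<close>
  identifies the primary obstruction as \<open>d\<close>; over \<open>K[t]/(t\<^sup>2)\<close> the last term vanishes.
\<close>


section \<open>Modules\<close>

text \<open>The maps to be compared are given by definite descriptions (\<open>tensor_lift\<close>,
  \<open>linear_extension\<close>), so nothing about \<beta> + t \<beta>1 can be computed before
  existence and uniqueness of extensions are known. V is an arbitrary module, and the isomorphism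
  between M tensor M and the extension of V tensor V is never built: the locale
  \<open>base_change\<close> asks only that \<open>\<iota>\<close> V generates M and that K-linear
  maps V -> A extend to M. Uniqueness follows from generation; a pairing is extended one variable at
  a time, and a copairing is fixed by its value at 1. The truncated case is derived from power
  series: K[[t]] maps onto K[t]/(t^2), and t^2 acts as zero on V_t / t^2 V_t, so this quotient
  inherits its K[t]/(t^2)-structure and its extension property from V_t. That the obstruction is
  determined, not merely realised by the differential, requires v |-> t v to be injective modulo t^2
  V_t; without a basis of V this comes from a coefficient map defined on the tensor product
  itself.\<close>

lemma with_smult_sel [simp]:
  "carrier (with_smult M s) = carrier M" "zero (with_smult M s) = zero M"
  "add (with_smult M s) = add M" "smult (with_smult M s) = s"
  "mult (with_smult M s) = mult M" "one (with_smult M s) = one M"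
  by (simp_all add: with_smult_def)

lemma abelian_group_cong:
  assumes "abelian_group M" "carrier M' = carrier M" "add M' = add M" "zero M' = zero M"
  shows "abelian_group M'"
proof -
  interpret abelian_group M by fact
  show ?thesis
    by (rule abelian_groupI) (auto simp: assms a_ac intro: l_neg)
qed

lemma abelian_group_with_smult [simp]: "abelian_group (with_smult M s) \<longleftrightarrow> abelian_group M"
  by (metis abelian_group_cong with_smult_sel(1-3))

lemma a_inv_with_smult [simp]: "a_inv (with_smult M s) = a_inv M"
  by (intro ext) (simp add: a_inv_def m_inv_def)

lemma a_minus_with_smult [simp]: "a_minus (with_smult M s) = a_minus M"
  by (intro ext) (simp add: a_minus_def)

lemma (in abelian_group) a_minus_eq_zero_iff:
  assumes "x \<in> carrier G" "y \<in> carrier G"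
  shows "x \<ominus> y = \<zero> \<longleftrightarrow> x = y"
  using assms by (metis a_minus_def add.inv_closed minus_equality r_neg)

lemma regular_module_sel [simp]:
  "carrier (regular_module R) = carrier R" "zero (regular_module R) = zero R"
  "add (regular_module R) = add R" "smult (regular_module R) = mult R"
  by (simp_all add: regular_module_def)

lemma restrict_scalars_sel [simp]:
  "carrier (restrict_scalars j M) = carrier M" "zero (restrict_scalars j M) = zero M"
  "add (restrict_scalars j M) = add M" "smult (restrict_scalars j M) = (\<lambda>a. smult M (j a))"
  by (simp_all add: restrict_scalars_def)

lemma module_regular_module:
  assumes "cring R"
  shows "module R (regular_module R)"
proof -
  interpret cring R by fact
  show ?thesis
    by (rule moduleI)
      (auto simp: assms regular_module_def l_distr r_distr m_assoc intro: abelian_group_axioms)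
qed

lemma module_restrict_scalars:
  assumes "cring K" "j \<in> ring_hom K A" "module A M"
  shows "module K (restrict_scalars j M)"
proof -
  interpret K: cring K by fact
  interpret M: module A M by fact
  note j = ring_hom_closed[OF assms(2)] ring_hom_add[OF assms(2)] ring_hom_mult[OF assms(2)]
    ring_hom_one[OF assms(2)]
  show ?thesis
    by (rule moduleI)
      (auto simp: assms j restrict_scalars_def M.smult_l_distr M.smult_r_distr M.smult_assoc1
        intro: M.abelian_group_axioms)
qed


text \<open>Scalars congruent modulo an annihilator c act alike. It is applied with c = t^2 to the
  quotient of V_t by t^2 V_t.\<close>

lemma (in module) smult_eq_mod_annihilator:
  assumes "a \<in> carrier R" "b \<in> carrier R" "c \<in> carrier R" "r \<in> carrier R" "x \<in> carrier M"
    and "a \<ominus> b = c \<otimes> r" and "\<And>y. y \<in> carrier M \<Longrightarrow> c \<odot>\<^bsub>M\<^esub> y = \<zero>\<^bsub>M\<^esub>"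
  shows "a \<odot>\<^bsub>M\<^esub> x = b \<odot>\<^bsub>M\<^esub> x"
proof -
  have "a \<odot>\<^bsub>M\<^esub> x \<ominus>\<^bsub>M\<^esub> b \<odot>\<^bsub>M\<^esub> x = (a \<ominus> b) \<odot>\<^bsub>M\<^esub> x"
    using assms(1,2,5) by (simp add: a_minus_def smult_l_distr smult_l_minus)
  also have "\<dots> = \<zero>\<^bsub>M\<^esub>"
    using assms by (simp add: smult_assoc1)
  finally show ?thesis
    using assms by (simp add: M.a_minus_eq_zero_iff)
qed


section \<open>Homomorphisms\<close>

lemma HomI:
  assumes "\<And>x. x \<in> carrier M \<Longrightarrow> f x \<in> carrier N"
    and "\<And>x y. \<lbrakk>x \<in> carrier M; y \<in> carrier M\<rbrakk> \<Longrightarrow> f (x \<oplus>\<^bsub>M\<^esub> y) = f x \<oplus>\<^bsub>N\<^esub> f y"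
    and "\<And>a x. \<lbrakk>a \<in> carrier R; x \<in> carrier M\<rbrakk> \<Longrightarrow> f (a \<odot>\<^bsub>M\<^esub> x) = a \<odot>\<^bsub>N\<^esub> f x"
    and "f \<in> extensional (carrier M)"
  shows "f \<in> Hom R M N"
  using assms by (auto simp: Hom_def PiE_def)

text \<open>\<open>Hom\<close> contains only extensional functions, hence \<open>restrict\<close>.
  The module hypothesis gives closure of the carrier, so that the restricted map still equals f at
  sums and scalar multiples.\<close>

lemma Hom_restrictI:
  assumes "module R M"
    and "\<And>x. x \<in> carrier M \<Longrightarrow> f x \<in> carrier N"
    and "\<And>x y. \<lbrakk>x \<in> carrier M; y \<in> carrier M\<rbrakk> \<Longrightarrow> f (x \<oplus>\<^bsub>M\<^esub> y) = f x \<oplus>\<^bsub>N\<^esub> f y"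
    and "\<And>a x. \<lbrakk>a \<in> carrier R; x \<in> carrier M\<rbrakk> \<Longrightarrow> f (a \<odot>\<^bsub>M\<^esub> x) = a \<odot>\<^bsub>N\<^esub> f x"
  shows "restrict f (carrier M) \<in> Hom R M N"
proof -
  interpret module R M by fact
  show ?thesis by (rule HomI) (auto simp: assms)
qed

lemma Hom_closed: "\<lbrakk>f \<in> Hom R M N; x \<in> carrier M\<rbrakk> \<Longrightarrow> f x \<in> carrier N"
  by (auto simp: Hom_def)

lemma Hom_add:
  "\<lbrakk>f \<in> Hom R M N; x \<in> carrier M; y \<in> carrier M\<rbrakk> \<Longrightarrow> f (x \<oplus>\<^bsub>M\<^esub> y) = f x \<oplus>\<^bsub>N\<^esub> f y"
  by (auto simp: Hom_def)

lemma Hom_smult: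
  "\<lbrakk>f \<in> Hom R M N; a \<in> carrier R; x \<in> carrier M\<rbrakk> \<Longrightarrow> f (a \<odot>\<^bsub>M\<^esub> x) = a \<odot>\<^bsub>N\<^esub> f x"
  by (auto simp: Hom_def)

lemma Hom_extensional: "f \<in> Hom R M N \<Longrightarrow> f \<in> extensional (carrier M)"
  by (auto simp: Hom_def PiE_def)

lemma Hom_eqI:
  assumes "f \<in> Hom R M N" "g \<in> Hom R M N'" "\<And>x. x \<in> carrier M \<Longrightarrow> f x = g x"
  shows "f = g"
  using assms by (meson Hom_extensional extensionalityI)

lemma Hom_abelian_group_hom:
  assumes "f \<in> Hom R M N" "module R M" "module R N"
  shows "abelian_group_hom M N f"
proof -
  interpret M: module R M by fact
  interpret N: module R N by fact
  show ?thesis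
    by (intro abelian_group_homI group_hom.intro group_hom_axioms.intro M.abelian_group_axioms
        N.abelian_group_axioms M.a_group N.a_group)
      (auto simp: hom_def Hom_closed[OF assms(1)] Hom_add[OF assms(1)])
qed

lemma Hom_zero: "\<lbrakk>f \<in> Hom R M N; module R M; module R N\<rbrakk> \<Longrightarrow> f \<zero>\<^bsub>M\<^esub> = \<zero>\<^bsub>N\<^esub>"
  by (rule abelian_group_hom.hom_zero[OF Hom_abelian_group_hom])

lemma Hom_a_inv:
  "\<lbrakk>f \<in> Hom R M N; module R M; module R N; x \<in> carrier M\<rbrakk> \<Longrightarrow> f (\<ominus>\<^bsub>M\<^esub> x) = \<ominus>\<^bsub>N\<^esub> f x"
  by (rule abelian_group_hom.hom_a_inv[OF Hom_abelian_group_hom])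

lemma Hom_minus:
  assumes "f \<in> Hom R M N" "module R M" "module R N" "x \<in> carrier M" "y \<in> carrier M"
  shows "f (x \<ominus>\<^bsub>M\<^esub> y) = f x \<ominus>\<^bsub>N\<^esub> f y"
proof -
  interpret M: module R M by fact
  show ?thesis
    using assms by (simp add: a_minus_def Hom_add[OF assms(1)] Hom_a_inv)
qed

lemma Hom_sum:
  assumes "module R M" "module R N" "f \<in> Hom R M N" "g \<in> Hom R M N"
  shows "restrict (\<lambda>x. f x \<oplus>\<^bsub>N\<^esub> g x) (carrier M) \<in> Hom R M N"
proof -
  interpret N: module R N by fact
  note [simp] = Hom_closed[OF assms(3)] Hom_closed[OF assms(4)]
  show ?thesis
    by (rule Hom_restrictI[OF assms(1)])
      (auto simp: Hom_add[OF assms(3)] Hom_add[OF assms(4)] Hom_smult[OF assms(3)]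
        Hom_smult[OF assms(4)] N.smult_r_distr N.add.m_ac)
qed

lemma Hom_diff:
  assumes "module R M" "module R N" "f \<in> Hom R M N" "g \<in> Hom R M N"
  shows "restrict (\<lambda>x. f x \<ominus>\<^bsub>N\<^esub> g x) (carrier M) \<in> Hom R M N"
proof -
  interpret N: module R N by fact
  note [simp] = Hom_closed[OF assms(3)] Hom_closed[OF assms(4)]
  show ?thesis
    by (rule Hom_restrictI[OF assms(1)])
      (auto simp: Hom_add[OF assms(3)] Hom_add[OF assms(4)] Hom_smult[OF assms(3)]
        Hom_smult[OF assms(4)] a_minus_def N.smult_r_distr N.smult_r_minus N.M.minus_add N.M.add.m_ac)
qed

text \<open>Commutativity of R lets c pass the other scalar; this is what makes \<tau> times a
  linear map linear.\<close>

lemma Hom_scale: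
  assumes "module R M" "module R N" "f \<in> Hom R M N" "c \<in> carrier R"
  shows "restrict (\<lambda>x. c \<odot>\<^bsub>N\<^esub> f x) (carrier M) \<in> Hom R M N"
proof -
  interpret N: module R N by fact
  note [simp] = Hom_closed[OF assms(3)] assms(4)
  show ?thesis
    by (rule Hom_restrictI[OF assms(1)])
      (auto simp: Hom_add[OF assms(3)] Hom_smult[OF assms(3)] N.smult_r_distr
        N.smult_assoc1[symmetric] N.R.m_comm)
qed

lemma Hom_id_map: "module R M \<Longrightarrow> id_map M \<in> Hom R M M"
  unfolding id_map_def by (rule Hom_restrictI) auto

lemma Hom_zero_map:
  assumes "module R M" "module R N"
  shows "zero_map M N \<in> Hom R M N"
proof -
  interpret N: module R N by fact
  show ?thesis
    unfolding zero_map_def by (rule Hom_restrictI[OF assms(1)]) auto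
qed

lemma Hom_add_map:
  assumes "module R M" "module R N" "f \<in> Hom R M N" "g \<in> Hom R M N"
  shows "add_map M N f g \<in> Hom R M N"
  unfolding add_map_def using assms by (rule Hom_sum)

lemma Hom_regular_moduleI:
  assumes "module R M" "m \<in> carrier M"
  shows "restrict (\<lambda>a. a \<odot>\<^bsub>M\<^esub> m) (carrier R) \<in> Hom R (regular_module R) M"
proof -
  interpret M: module R M by fact
  show ?thesis
    using Hom_restrictI[OF module_regular_module[OF M.R.is_cring], of "\<lambda>a. a \<odot>\<^bsub>M\<^esub> m" M] assms(2)
    by (simp add: M.smult_l_distr M.smult_assoc1)
qed

lemma submodule_kernel:
  assumes "f \<in> Hom R M N" "module R M" "module R N"
  shows "submodule {x \<in> carrier M. f x = \<zero>\<^bsub>N\<^esub>} R M"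
proof -
  interpret M: module R M by fact
  interpret N: module R N by fact
  show ?thesis
    by (rule M.submoduleI)
      (auto simp: assms Hom_zero[OF assms] Hom_a_inv[OF assms] Hom_add[OF assms(1)] Hom_smult[OF assms(1)])
qed

text \<open>Reduces equality of two linear maps to a generating set, which is how extensions are
  shown to be unique.\<close>

lemma submodule_equalizer:
  assumes "f \<in> Hom R M N" "g \<in> Hom R M N" "module R M" "module R N"
  shows "submodule {x \<in> carrier M. f x = g x} R M"
proof -
  interpret M: module R M by fact
  interpret N: module R N by fact
  show ?thesis
    by (rule M.submoduleI)
      (auto simp: assms Hom_zero[OF assms(1)] Hom_zero[OF assms(2)] Hom_a_inv[OF assms(1)]
       Hom_a_inv[OF assms(2)] Hom_add[OF assms(1)] Hom_smult[OF assms(1)]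
       Hom_add[OF assms(2)] Hom_smult[OF assms(2)])
qed

text \<open>Reduces a membership f x in H for all x to a generating set; used for congruences, with
  H = t^2 V_t.\<close>

lemma submodule_vimage:
  assumes "f \<in> Hom R M N" "module R M" "module R N" "submodule H R N"
  shows "submodule {x \<in> carrier M. f x \<in> H} R M"
proof -
  interpret M: module R M by fact
  interpret N: module R N by fact
  interpret H: submodule H R N by fact
  have "\<zero>\<^bsub>N\<^esub> \<in> H" using H.one_closed by simp
  then show ?thesis
    using N.submoduleE[OF assms(4)]
    by (intro M.submoduleI)
      (auto simp: assms Hom_zero[OF assms(1-3)] Hom_a_inv[OF assms(1-3)] Hom_add[OF assms(1)] Hom_smult[OF assms(1)])
qed


section \<open>Quotient modules\<close>

lemma quotient_module_sel [simp]:
  "carrier (quotient_module M H) = a_rcosets\<^bsub>M\<^esub> H" "zero (quotient_module M H) = H"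
  "add (quotient_module M H) = set_add M"
  "smult (quotient_module M H) = (\<lambda>a X. \<Union>x\<in>X. H +>\<^bsub>M\<^esub> (a \<odot>\<^bsub>M\<^esub> x))"
  by (simp_all add: quotient_module_def)

context module
begin

lemma submodule_abelian_subgroup: "submodule H R M \<Longrightarrow> abelian_subgroup H M"
  by (intro abelian_subgroupI3 additive_subgroupI M.abelian_group_axioms) (rule submodule.axioms(1))

lemma coset_eq_iff:
  assumes "submodule H R M" "x \<in> carrier M" "y \<in> carrier M"
  shows "H +>\<^bsub>M\<^esub> x = H +>\<^bsub>M\<^esub> y \<longleftrightarrow> x \<ominus>\<^bsub>M\<^esub> y \<in> H"
proof -
  interpret H: abelian_subgroup H M by (rule submodule_abelian_subgroup[OF assms(1)])
  show ?thesis
    using H.a_rcos_module[OF assms(3,2)] H.a_repr_independence'[OF _ assms(3)]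
      H.a_rcos_self[OF assms(2)]
    by (auto simp: a_minus_def)
qed

lemma coset_mem_iff:
  assumes "submodule H R M" "x \<in> carrier M"
  shows "y \<in> H +>\<^bsub>M\<^esub> x \<longleftrightarrow> y \<in> carrier M \<and> H +>\<^bsub>M\<^esub> y = H +>\<^bsub>M\<^esub> x"
proof -
  interpret H: abelian_subgroup H M by (rule submodule_abelian_subgroup[OF assms(1)])
  show ?thesis
    using H.a_elemrcos_carrier[OF assms(2)] H.a_repr_independence'[OF _ assms(2)]
      H.a_rcos_self by metis
qed

lemma quotient_add:
  assumes "submodule H R M" "x \<in> carrier M" "y \<in> carrier M"
  shows "(H +>\<^bsub>M\<^esub> x) \<oplus>\<^bsub>quotient_module M H\<^esub> (H +>\<^bsub>M\<^esub> y) = H +>\<^bsub>M\<^esub> (x \<oplus>\<^bsub>M\<^esub> y)"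
proof -
  interpret H: abelian_subgroup H M by (rule submodule_abelian_subgroup[OF assms(1)])
  show ?thesis by (simp add: H.a_rcos_sum assms)
qed

text \<open>The action is defined as a union over all representatives. They all yield the same coset
  because H absorbs scalars, and a coset is nonempty, so the union collapses to one coset.\<close>

lemma quotient_smult:
  assumes "submodule H R M" "a \<in> carrier R" "x \<in> carrier M"
  shows "a \<odot>\<^bsub>quotient_module M H\<^esub> (H +>\<^bsub>M\<^esub> x) = H +>\<^bsub>M\<^esub> (a \<odot>\<^bsub>M\<^esub> x)"
proof -
  have "H +>\<^bsub>M\<^esub> (a \<odot>\<^bsub>M\<^esub> y) = H +>\<^bsub>M\<^esub> (a \<odot>\<^bsub>M\<^esub> x)" if y: "y \<in> H +>\<^bsub>M\<^esub> x" for y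
  proof -
    have yc: "y \<in> carrier M" and "H +>\<^bsub>M\<^esub> y = H +>\<^bsub>M\<^esub> x"
      using y coset_mem_iff[OF assms(1,3)] by simp_all
    then have "y \<ominus>\<^bsub>M\<^esub> x \<in> H"
      using coset_eq_iff[OF assms(1) _ assms(3)] by simp
    then have "a \<odot>\<^bsub>M\<^esub> (y \<ominus>\<^bsub>M\<^esub> x) \<in> H"
      using submodule.smult_closed[OF assms(1)] assms(2) by blast
    moreover have "a \<odot>\<^bsub>M\<^esub> (y \<ominus>\<^bsub>M\<^esub> x) = a \<odot>\<^bsub>M\<^esub> y \<ominus>\<^bsub>M\<^esub> a \<odot>\<^bsub>M\<^esub> x"
      using yc assms by (simp add: a_minus_def smult_r_distr smult_r_minus)
    ultimately show ?thesis
      using yc assms by (simp add: coset_eq_iff)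
  qed
  moreover have "H +>\<^bsub>M\<^esub> x \<noteq> {}"
    using coset_mem_iff[OF assms(1,3)] assms(3) by blast
  ultimately show ?thesis
    by (simp cong: SUP_cong_simp)
qed

lemma quotient_carrier: "carrier (quotient_module M H) = (\<lambda>x. H +>\<^bsub>M\<^esub> x) ` carrier M"
  by (auto simp: A_RCOSETS_def RCOSETS_def a_r_coset_def)

lemma quotient_zero: "submodule H R M \<Longrightarrow> \<zero>\<^bsub>quotient_module M H\<^esub> = H +>\<^bsub>M\<^esub> \<zero>\<^bsub>M\<^esub>"
  by (simp add: submoduleE(1))

lemma module_quotient_module:
  assumes H: "submodule H R M"
  shows "module R (quotient_module M H)"
proof -
  let ?Q = "quotient_module M H"
  have ag: "abelian_group ?Q"
  proof (rule abelian_groupI)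
    fix X assume "X \<in> carrier ?Q"
    then obtain x where x: "x \<in> carrier M" "X = H +>\<^bsub>M\<^esub> x" unfolding quotient_carrier by blast
    then show "\<exists>Y\<in>carrier ?Q. Y \<oplus>\<^bsub>?Q\<^esub> X = \<zero>\<^bsub>?Q\<^esub>"
      by (intro bexI[of _ "H +>\<^bsub>M\<^esub> (\<ominus>\<^bsub>M\<^esub> x)"])
        (auto simp: quotient_carrier quotient_add[OF H] quotient_zero[OF H] M.l_neg
         simp del: quotient_module_sel)
  qed (auto simp: quotient_carrier quotient_add[OF H] quotient_zero[OF H] M.a_ac
         simp del: quotient_module_sel)
  show ?thesis
  proof (rule moduleI[OF R.is_cring ag]; unfold quotient_carrier)
  qed (auto simp: quotient_add[OF H] quotient_smult[OF H] smult_l_distr smult_r_distr smult_assoc1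
      simp del: quotient_module_sel)
qed

lemma quotient_lift:
  assumes H: "submodule H R M" and f: "f \<in> Hom R M P" and P: "module R P"
    and f0: "\<And>h. h \<in> H \<Longrightarrow> f h = \<zero>\<^bsub>P\<^esub>"
  obtains g where "g \<in> Hom R (quotient_module M H) P"
    and "\<And>x. x \<in> carrier M \<Longrightarrow> g (H +>\<^bsub>M\<^esub> x) = f x"
proof -
  interpret P: module R P by fact
  let ?Q = "quotient_module M H"
  \<comment> \<open>A representative is chosen arbitrarily; two of them differ by an element of H,
    on which f vanishes.\<close>
  let ?g = "\<lambda>X. f (SOME x. x \<in> X)"
  have M: "module R M" by (rule module_axioms)
  have g: "?g (H +>\<^bsub>M\<^esub> x) = f x" if x: "x \<in> carrier M" for x
  proof -
    let ?y = "SOME y. y \<in> H +>\<^bsub>M\<^esub> x"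
    have "?y \<in> H +>\<^bsub>M\<^esub> x"
      using coset_mem_iff[OF H x] x by (metis someI)
    then have y: "?y \<in> carrier M" "?y \<ominus>\<^bsub>M\<^esub> x \<in> H"
      unfolding coset_mem_iff[OF H x] by (simp_all add: coset_eq_iff[OF H _ x, symmetric])
    then have "f ?y \<ominus>\<^bsub>P\<^esub> f x = \<zero>\<^bsub>P\<^esub>"
      using Hom_minus[OF f M P _ x] f0 by metis
    then show ?thesis
      using x y Hom_closed[OF f] P.a_minus_eq_zero_iff by simp
  qed
  have "restrict ?g (carrier ?Q) \<in> Hom R ?Q P"
    by (rule Hom_restrictI[OF module_quotient_module[OF H]])
      (auto simp: quotient_carrier quotient_add[OF H] quotient_smult[OF H] g
        Hom_closed[OF f] Hom_add[OF f] Hom_smult[OF f] simp del: quotient_module_sel)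
  moreover have "restrict ?g (carrier ?Q) (H +>\<^bsub>M\<^esub> x) = f x" if "x \<in> carrier M" for x
    using that by (auto simp: g quotient_carrier simp del: quotient_module_sel)
  ultimately show ?thesis by (rule that)
qed

end


section \<open>Free modules\<close>

lemma free_module_sel [simp]:
  "carrier (free_module R B) =
     {f. (\<forall>z. f z \<in> carrier R) \<and> finite {z. f z \<noteq> \<zero>\<^bsub>R\<^esub>} \<and> {z. f z \<noteq> \<zero>\<^bsub>R\<^esub>} \<subseteq> B}"
  "zero (free_module R B) = (\<lambda>z. \<zero>\<^bsub>R\<^esub>)"
  "add (free_module R B) = (\<lambda>f g z. f z \<oplus>\<^bsub>R\<^esub> g z)"
  "smult (free_module R B) = (\<lambda>a f z. a \<otimes>\<^bsub>R\<^esub> f z)"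
  by (simp_all add: free_module_def)

context cring
begin

lemma free_module_closed:
  assumes "f \<in> carrier (free_module R B)" "g \<in> carrier (free_module R B)"
  shows "f \<oplus>\<^bsub>free_module R B\<^esub> g \<in> carrier (free_module R B)"
proof -
  have sub: "{z. f z \<oplus> g z \<noteq> \<zero>} \<subseteq> {z. f z \<noteq> \<zero>} \<union> {z. g z \<noteq> \<zero>}"
    using assms by auto
  have "finite {z. f z \<oplus> g z \<noteq> \<zero>}"
    by (rule finite_subset[OF sub]) (use assms in auto)
  moreover have "{z. f z \<oplus> g z \<noteq> \<zero>} \<subseteq> B"
    using sub assms by auto
  ultimately show ?thesis using assms by simp
qed

lemma free_module_smult_closed:
  assumes "a \<in> carrier R" "g \<in> carrier (free_module R B)"
  shows "a \<odot>\<^bsub>free_module R B\<^esub> g \<in> carrier (free_module R B)"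
proof -
  have sub: "{z. a \<otimes> g z \<noteq> \<zero>} \<subseteq> {z. g z \<noteq> \<zero>}"
    using assms by auto
  have "finite {z. a \<otimes> g z \<noteq> \<zero>}"
    by (rule finite_subset[OF sub]) (use assms in auto)
  moreover have "{z. a \<otimes> g z \<noteq> \<zero>} \<subseteq> B"
    using sub assms by auto
  ultimately show ?thesis using assms by simp
qed

lemma module_free_module: "module R (free_module R B)"
proof -
  let ?F = "free_module R B"
  \<comment> \<open>Taking (-1) f as the additive inverse makes finiteness of its support an
    instance of closure under scalars.\<close>
  have "\<exists>g\<in>carrier ?F. g \<oplus>\<^bsub>?F\<^esub> f = \<zero>\<^bsub>?F\<^esub>" if f: "f \<in> carrier ?F" for f
    using free_module_smult_closed[OF _ f, of "\<ominus> \<one>"] f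
    by (intro bexI[of _ "(\<ominus> \<one>) \<odot>\<^bsub>?F\<^esub> f"]) (auto simp: l_minus l_neg)
  then have "abelian_group ?F"
    by (intro abelian_groupI free_module_closed) (auto simp: a_ac)
  then show ?thesis
    by (intro moduleI free_module_smult_closed is_cring)
      (auto simp: l_distr r_distr m_assoc)
qed

lemma free_gen_closed: "b \<in> B \<Longrightarrow> free_gen R b \<in> carrier (free_module R B)"
  by (auto simp: free_gen_def)

lemma free_module_induct [consumes 1, case_names zero add]:
  assumes "f \<in> carrier (free_module R B)"
    and zero: "P \<zero>\<^bsub>free_module R B\<^esub>"
    and add: "\<And>a b g. \<lbrakk>a \<in> carrier R; b \<in> B; g \<in> carrier (free_module R B); P g\<rbrakk> \<Longrightarrow>
      P (a \<odot>\<^bsub>free_module R B\<^esub> free_gen R b \<oplus>\<^bsub>free_module R B\<^esub> g)"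
  shows "P f"
proof -
  let ?F = "free_module R B"
  \<comment> \<open>The induction runs over a finite set containing the support rather than over the
    support. Setting f to zero at b removes b from the required set, and the subtracted part is f b
    times a generator.\<close>
  have "P f" if "finite S" "f \<in> carrier ?F" "{z. f z \<noteq> \<zero>} \<subseteq> S" for S f
    using that
  proof (induction S arbitrary: f rule: finite_induct)
    case empty
    then have "f = \<zero>\<^bsub>?F\<^esub>" by auto
    then show ?case using zero by simp
  next
    case (insert b S)
    show ?case
    proof (cases "f b = \<zero>")
      case True
      then show ?thesis using insert by (intro insert.IH) auto
    next
      case False
      let ?g = "f(b := \<zero>)"
      have "{z. ?g z \<noteq> \<zero>} \<subseteq> {z. f z \<noteq> \<zero>}" by auto
      then have g: "?g \<in> carrier ?F"
        using insert.prems by (auto intro: finite_subset)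
      have "P ?g" using g insert.prems by (intro insert.IH) auto
      moreover have "f = f b \<odot>\<^bsub>?F\<^esub> free_gen R b \<oplus>\<^bsub>?F\<^esub> ?g"
        using insert.prems by (auto simp: fun_eq_iff free_gen_def)
      moreover have "f b \<in> carrier R" "b \<in> B" using insert.prems False by auto
      ultimately show ?thesis using add[of "f b" b ?g] g by metis
    qed
  qed
  from this[of "{z. f z \<noteq> \<zero>}"] show ?thesis using assms(1) by auto
qed

text \<open>The extension sends f to the sum of f z times b z over the support of f. Since the
  support of a sum is not determined by the two supports, additivity needs a common index
  set.\<close>

lemma free_module_lift:
  assumes P: "module R P" and b: "\<And>z. z \<in> B \<Longrightarrow> b z \<in> carrier P"
  shows "\<exists>h\<in>Hom R (free_module R B) P. \<forall>z\<in>B. h (free_gen R z) = b z"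
proof -
  interpret P: module R P by fact
  let ?F = "free_module R B"
  let ?h = "\<lambda>f. \<Oplus>\<^bsub>P\<^esub>z\<in>{z. f z \<noteq> \<zero>}. f z \<odot>\<^bsub>P\<^esub> b z"
  \<comment> \<open>Padding the support only adds zero terms. S must stay inside B, as b z is known
    to lie in P only there.\<close>
  have superset: "?h f = (\<Oplus>\<^bsub>P\<^esub>z\<in>S. f z \<odot>\<^bsub>P\<^esub> b z)"
    if "f \<in> carrier ?F" "finite S" "{z. f z \<noteq> \<zero>} \<subseteq> S" "S \<subseteq> B" for f S
    using that b by (intro P.add.finprod_mono_neutral_cong_left) auto
  have add: "?h (f \<oplus>\<^bsub>?F\<^esub> g) = ?h f \<oplus>\<^bsub>P\<^esub> ?h g" if f: "f \<in> carrier ?F" and g: "g \<in> carrier ?F" for f g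
  proof -
    let ?S = "{z. f z \<noteq> \<zero>} \<union> {z. g z \<noteq> \<zero>}"
    have S: "finite ?S" "?S \<subseteq> B" using f g by auto
    have "?h (f \<oplus>\<^bsub>?F\<^esub> g) = (\<Oplus>\<^bsub>P\<^esub>z\<in>?S. (f \<oplus>\<^bsub>?F\<^esub> g) z \<odot>\<^bsub>P\<^esub> b z)"
      by (rule superset[OF free_module_closed[OF f g] S(1) _ S(2)]) auto
    also have "\<dots> = (\<Oplus>\<^bsub>P\<^esub>z\<in>?S. f z \<odot>\<^bsub>P\<^esub> b z \<oplus>\<^bsub>P\<^esub> g z \<odot>\<^bsub>P\<^esub> b z)"
      using S f g b by (intro P.finsum_cong') (auto simp: P.smult_l_distr)
    also have "\<dots> = (\<Oplus>\<^bsub>P\<^esub>z\<in>?S. f z \<odot>\<^bsub>P\<^esub> b z) \<oplus>\<^bsub>P\<^esub> (\<Oplus>\<^bsub>P\<^esub>z\<in>?S. g z \<odot>\<^bsub>P\<^esub> b z)"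
      using S f g b by (intro P.finsum_addf) auto
    also have "\<dots> = ?h f \<oplus>\<^bsub>P\<^esub> ?h g"
      using superset[OF f S(1) _ S(2)] superset[OF g S(1) _ S(2)] by simp
    finally show ?thesis .
  qed
  have smult: "?h (a \<odot>\<^bsub>?F\<^esub> f) = a \<odot>\<^bsub>P\<^esub> ?h f" if a: "a \<in> carrier R" and f: "f \<in> carrier ?F" for a f
  proof -
    let ?S = "{z. f z \<noteq> \<zero>}"
    have S: "finite ?S" "?S \<subseteq> B" using f by auto
    have "?h (a \<odot>\<^bsub>?F\<^esub> f) = (\<Oplus>\<^bsub>P\<^esub>z\<in>?S. (a \<odot>\<^bsub>?F\<^esub> f) z \<odot>\<^bsub>P\<^esub> b z)"
      by (rule superset[OF free_module_smult_closed[OF a f] S(1) _ S(2)]) (use a in auto)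
    also have "\<dots> = (\<Oplus>\<^bsub>P\<^esub>z\<in>?S. a \<odot>\<^bsub>P\<^esub> (f z \<odot>\<^bsub>P\<^esub> b z))"
      using S f b a by (intro P.finsum_cong') (auto simp: P.smult_assoc1)
    also have "\<dots> = a \<odot>\<^bsub>P\<^esub> ?h f"
      using S f b a by (intro P.finsum_smult_ldistr[symmetric]) auto
    finally show ?thesis .
  qed
  have closed: "?h f \<in> carrier P" if "f \<in> carrier ?F" for f
    using that b by (intro P.finsum_closed) auto
  have "restrict ?h (carrier ?F) \<in> Hom R ?F P"
    by (rule Hom_restrictI) (fact module_free_module closed add smult)+
  moreover have "restrict ?h (carrier ?F) (free_gen R z) = b z" if z: "z \<in> B" for z
  proof -
    have "?h (free_gen R z) = (\<Oplus>\<^bsub>P\<^esub>w\<in>{z}. free_gen R z w \<odot>\<^bsub>P\<^esub> b w)"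
      using z by (intro superset[OF free_gen_closed[OF z]]) (auto simp: free_gen_def)
    also have "\<dots> = b z"
      using b[OF z] by (simp add: free_gen_def)
    finally show ?thesis
      using free_gen_closed[OF z] by simp
  qed
  ultimately show ?thesis by blast
qed

end


section \<open>Tensor products\<close>

definition bilinear ::
  "('a, 'r) ring_scheme \<Rightarrow> ('a, 'b, 'm) module_scheme \<Rightarrow> ('a, 'c, 'n) module_scheme
     \<Rightarrow> ('a, 'd, 'p) module_scheme \<Rightarrow> ('b \<Rightarrow> 'c \<Rightarrow> 'd) \<Rightarrow> bool" where
  "bilinear R M N P b \<longleftrightarrow>
     (\<forall>x\<in>carrier M. \<forall>y\<in>carrier N. b x y \<in> carrier P) \<and>
     (\<forall>x\<in>carrier M. \<forall>x'\<in>carrier M. \<forall>y\<in>carrier N. b (x \<oplus>\<^bsub>M\<^esub> x') y = b x y \<oplus>\<^bsub>P\<^esub> b x' y) \<and>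
     (\<forall>x\<in>carrier M. \<forall>y\<in>carrier N. \<forall>y'\<in>carrier N. b x (y \<oplus>\<^bsub>N\<^esub> y') = b x y \<oplus>\<^bsub>P\<^esub> b x y') \<and>
     (\<forall>a\<in>carrier R. \<forall>x\<in>carrier M. \<forall>y\<in>carrier N. b (a \<odot>\<^bsub>M\<^esub> x) y = a \<odot>\<^bsub>P\<^esub> b x y) \<and>
     (\<forall>a\<in>carrier R. \<forall>x\<in>carrier M. \<forall>y\<in>carrier N. b x (a \<odot>\<^bsub>N\<^esub> y) = a \<odot>\<^bsub>P\<^esub> b x y)"

locale two_modules = M: module R M + N: module R N
  for R :: "('a, 'r) ring_scheme" and M :: "('a, 'b, 'm) module_scheme"
    and N :: "('a, 'c, 'n) module_scheme"
begin

abbreviation F where "F \<equiv> free_on_pairs R M N"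

lemma module_free_on_pairs: "module R F"
  unfolding free_on_pairs_def by (rule M.R.module_free_module)

lemmas free_on_pairs_induct [consumes 1, case_names zero add] =
  M.R.free_module_induct[of _ "carrier M \<times> carrier N", folded free_on_pairs_def]

lemma free_gen_pair_closed:
  "\<lbrakk>x \<in> carrier M; y \<in> carrier N\<rbrakk> \<Longrightarrow> free_gen R (x, y) \<in> carrier F"
  unfolding free_on_pairs_def by (rule M.R.free_gen_closed) simp

lemma bilinear_relations_carrier: "bilinear_relations R M N \<subseteq> carrier F"
proof -
  interpret F: module R F by (rule module_free_on_pairs)
  show ?thesis
    by (rule subsetI, erule bilinear_relations.cases) (simp_all add: free_gen_pair_closed)
qed

lemma relation_submodule: "submodule (relation_submodule R M N) R F"
proof -
  interpret F: module R F by (rule module_free_on_pairs)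
  let ?S = "{H. submodule H R F \<and> bilinear_relations R M N \<subseteq> H}"
  \<comment> \<open>The family is nonempty, so its intersection really lies in the carrier of
    F.\<close>
  have "carrier F \<in> ?S"
    using F.carrier_is_submodule bilinear_relations_carrier by blast
  moreover have "\<zero>\<^bsub>F\<^esub> \<in> H" if "submodule H R F" for H
    using subgroup.one_closed[OF submodule.axioms(1)[OF that]] by simp
  ultimately show ?thesis
    unfolding relation_submodule_def
    by (intro F.submoduleI) (use F.submoduleE in \<open>auto simp: subset_iff dest: F.submoduleE(1)\<close>)
qed

lemma bilinear_relations_subset: "bilinear_relations R M N \<subseteq> relation_submodule R M N"
  unfolding relation_submodule_def by blast

lemma relation_submodule_least:
  "\<lbrakk>submodule H R F; bilinear_relations R M N \<subseteq> H\<rbrakk> \<Longrightarrow> relation_submodule R M N \<subseteq> H"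
  unfolding relation_submodule_def by blast

lemma module_tensor: "module R (tensor R M N)"
  unfolding tensor_def
  by (rule module.module_quotient_module[OF module_free_on_pairs relation_submodule])

lemma tens_closed:
  "\<lbrakk>x \<in> carrier M; y \<in> carrier N\<rbrakk> \<Longrightarrow> tens R M N x y \<in> carrier (tensor R M N)"
  unfolding tensor_def tens_def module.quotient_carrier[OF module_free_on_pairs]
  by (blast intro: free_gen_pair_closed)

lemma tens_eq:
  assumes "f \<in> carrier F" "g \<in> carrier F" "f \<ominus>\<^bsub>F\<^esub> g \<in> bilinear_relations R M N"
  shows "relation_submodule R M N +>\<^bsub>F\<^esub> f = relation_submodule R M N +>\<^bsub>F\<^esub> g"
  using assms module.coset_eq_iff[OF module_free_on_pairs relation_submodule]
    bilinear_relations_subset by blast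

text \<open>Each of the four laws says that one kind of generating relation becomes zero in the
  quotient.\<close>

lemma tens_bilinear: "bilinear R M N (tensor R M N) (tens R M N)"
proof -
  interpret F: module R F by (rule module_free_on_pairs)
  note fg = free_gen_pair_closed
  note add = F.quotient_add[OF relation_submodule fg fg]
    and smult = F.quotient_smult[OF relation_submodule _ fg]
  show ?thesis
    unfolding bilinear_def
  proof (intro conjI ballI)
    fix x x' y assume "x \<in> carrier M" "x' \<in> carrier M" "y \<in> carrier N"
    then show "tens R M N (x \<oplus>\<^bsub>M\<^esub> x') y = tens R M N x y \<oplus>\<^bsub>tensor R M N\<^esub> tens R M N x' y"
      unfolding tens_def tensor_def
      by (subst add) (assumption+, rule tens_eq, simp_all add: fg bilinear_relations.add_left)
  next
    fix x y y' assume "x \<in> carrier M" "y \<in> carrier N" "y' \<in> carrier N"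
    then show "tens R M N x (y \<oplus>\<^bsub>N\<^esub> y') = tens R M N x y \<oplus>\<^bsub>tensor R M N\<^esub> tens R M N x y'"
      unfolding tens_def tensor_def
      by (subst add) (assumption+, rule tens_eq, simp_all add: fg bilinear_relations.add_right)
  next
    fix a x y assume "a \<in> carrier R" "x \<in> carrier M" "y \<in> carrier N"
    then show "tens R M N (a \<odot>\<^bsub>M\<^esub> x) y = a \<odot>\<^bsub>tensor R M N\<^esub> tens R M N x y"
      unfolding tens_def tensor_def
      by (subst smult) (assumption+, rule tens_eq, simp_all add: fg bilinear_relations.smult_left)
  next
    fix a x y assume "a \<in> carrier R" "x \<in> carrier M" "y \<in> carrier N"
    then show "tens R M N x (a \<odot>\<^bsub>N\<^esub> y) = a \<odot>\<^bsub>tensor R M N\<^esub> tens R M N x y"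
      unfolding tens_def tensor_def
      by (subst smult) (assumption+, rule tens_eq, simp_all add: fg bilinear_relations.smult_right)
  qed (simp add: tens_closed)
qed

lemma tens_add_left:
    "\<lbrakk>x \<in> carrier M; x' \<in> carrier M; y \<in> carrier N\<rbrakk> \<Longrightarrow>
      tens R M N (x \<oplus>\<^bsub>M\<^esub> x') y = tens R M N x y \<oplus>\<^bsub>tensor R M N\<^esub> tens R M N x' y"
  and tens_add_right:
    "\<lbrakk>x \<in> carrier M; y \<in> carrier N; y' \<in> carrier N\<rbrakk> \<Longrightarrow>
      tens R M N x (y \<oplus>\<^bsub>N\<^esub> y') = tens R M N x y \<oplus>\<^bsub>tensor R M N\<^esub> tens R M N x y'"
  and tens_smult_left:
    "\<lbrakk>a \<in> carrier R; x \<in> carrier M; y \<in> carrier N\<rbrakk> \<Longrightarrow>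
      tens R M N (a \<odot>\<^bsub>M\<^esub> x) y = a \<odot>\<^bsub>tensor R M N\<^esub> tens R M N x y"
  and tens_smult_right:
    "\<lbrakk>a \<in> carrier R; x \<in> carrier M; y \<in> carrier N\<rbrakk> \<Longrightarrow>
      tens R M N x (a \<odot>\<^bsub>N\<^esub> y) = a \<odot>\<^bsub>tensor R M N\<^esub> tens R M N x y"
  using tens_bilinear by (auto simp: bilinear_def)

text \<open>No case for zero or for scalars is needed: 0 is a pure tensor, and a scalar in front of
  a pure tensor is absorbed into its left factor. Every element is thus a sum of pure
  tensors.\<close>

lemma tensor_induct [consumes 1, case_names tens add]:
  assumes "z \<in> carrier (tensor R M N)"
    and tens: "\<And>x y. \<lbrakk>x \<in> carrier M; y \<in> carrier N\<rbrakk> \<Longrightarrow> Q (tens R M N x y)"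
    and add: "\<And>z w. \<lbrakk>z \<in> carrier (tensor R M N); w \<in> carrier (tensor R M N); Q z; Q w\<rbrakk> \<Longrightarrow>
      Q (z \<oplus>\<^bsub>tensor R M N\<^esub> w)"
  shows "Q z"
proof -
  interpret F: module R F by (rule module_free_on_pairs)
  interpret T: module R "tensor R M N" by (rule module_tensor)
  let ?c = "\<lambda>f. relation_submodule R M N +>\<^bsub>F\<^esub> f"
  have in_tensor: "?c f \<in> carrier (tensor R M N)" if "f \<in> carrier F" for f
    unfolding tensor_def F.quotient_carrier using that by blast
  have "Q (?c f)" if "f \<in> carrier F" for f
    using that
  proof (induction f rule: free_on_pairs_induct)
    case zero
    have "tens R M N (\<zero>\<^bsub>R\<^esub> \<odot>\<^bsub>M\<^esub> \<zero>\<^bsub>M\<^esub>) \<zero>\<^bsub>N\<^esub> = \<zero>\<^bsub>tensor R M N\<^esub>"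
      by (subst tens_smult_left) (simp_all add: tens_closed)
    moreover have "?c \<zero>\<^bsub>F\<^esub> = \<zero>\<^bsub>tensor R M N\<^esub>"
      using F.quotient_zero[OF relation_submodule] by (simp add: tensor_def)
    ultimately show ?case
      using tens[of "\<zero>\<^bsub>R\<^esub> \<odot>\<^bsub>M\<^esub> \<zero>\<^bsub>M\<^esub>" "\<zero>\<^bsub>N\<^esub>"]
      by simp
  next
    case (add a b g)
    obtain x y where b: "b = (x, y)" "x \<in> carrier M" "y \<in> carrier N" using add.hyps by auto
    note gen = free_gen_pair_closed[OF b(2,3)]
    have "?c (a \<odot>\<^bsub>F\<^esub> free_gen R b \<oplus>\<^bsub>F\<^esub> g) = a \<odot>\<^bsub>tensor R M N\<^esub> tens R M N x y \<oplus>\<^bsub>tensor R M N\<^esub> ?c g"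
      unfolding tensor_def tens_def b(1)
      using add.hyps gen
      by (simp only: F.quotient_smult[OF relation_submodule] F.quotient_add[OF relation_submodule]
          F.smult_closed)
    also have "\<dots> = tens R M N (a \<odot>\<^bsub>M\<^esub> x) y \<oplus>\<^bsub>tensor R M N\<^esub> ?c g"
      using tens_smult_left[OF add.hyps(1) b(2,3)] by simp
    finally show ?case
      using assms(3)[OF tens_closed in_tensor tens] add b by simp
  qed
  then show ?thesis
    using assms(1) unfolding tensor_def F.quotient_carrier by blast
qed

lemma tensor_hom_eqI:
  assumes "module R P" "f \<in> Hom R (tensor R M N) P" "g \<in> Hom R (tensor R M N) P"
    and "\<And>x y. \<lbrakk>x \<in> carrier M; y \<in> carrier N\<rbrakk> \<Longrightarrow> f (tens R M N x y) = g (tens R M N x y)"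
  shows "f = g"
proof (rule Hom_eqI[OF assms(2,3)])
  fix z assume "z \<in> carrier (tensor R M N)"
  then show "f z = g z"
    by (induction z rule: tensor_induct)
      (simp_all add: assms(4) Hom_add[OF assms(2)] Hom_add[OF assms(3)])
qed

text \<open>Existence in the universal property. The extension of b to the free module has a kernel
  containing all bilinear relations, hence the least submodule containing them, so it descends to
  the quotient.\<close>

lemma tensor_lift_ex:
  assumes P: "module R P" and b: "bilinear R M N P b"
  obtains h where "h \<in> Hom R (tensor R M N) P"
    and "\<And>x y. \<lbrakk>x \<in> carrier M; y \<in> carrier N\<rbrakk> \<Longrightarrow> h (tens R M N x y) = b x y"
proof -
  interpret P: module R P by fact
  interpret F: module R F by (rule module_free_on_pairs)
  have "b (fst z) (snd z) \<in> carrier P" if "z \<in> carrier M \<times> carrier N" for z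
    using b that by (auto simp: bilinear_def)
  then have "\<exists>f\<in>Hom R F P. \<forall>z\<in>carrier M \<times> carrier N. f (free_gen R z) = b (fst z) (snd z)"
    unfolding free_on_pairs_def by (rule M.R.free_module_lift[OF P])
  then
  obtain f where f: "f \<in> Hom R F P"
    and "\<forall>z\<in>carrier M \<times> carrier N. f (free_gen R z) = b (fst z) (snd z)"
    by (elim bexE)
  then have fb: "f (free_gen R (x, y)) = b x y" if "x \<in> carrier M" "y \<in> carrier N" for x y
    using that by simp
  note gen = free_gen_pair_closed
  note hom = Hom_minus[OF f module_free_on_pairs P] Hom_add[OF f] Hom_smult[OF f]
  have "bilinear_relations R M N \<subseteq> {x \<in> carrier F. f x = \<zero>\<^bsub>P\<^esub>}"
  proof
    fix r assume r: "r \<in> bilinear_relations R M N"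
    then have "f r = \<zero>\<^bsub>P\<^esub>"
      using b unfolding bilinear_def
      by (cases rule: bilinear_relations.cases)
        (simp_all add: gen hom fb P.a_minus_eq_zero_iff)
    then show "r \<in> {x \<in> carrier F. f x = \<zero>\<^bsub>P\<^esub>}"
      using r bilinear_relations_carrier by blast
  qed
  then have f0: "f h = \<zero>\<^bsub>P\<^esub>" if "h \<in> relation_submodule R M N" for h
    using relation_submodule_least[OF submodule_kernel[OF f module_free_on_pairs P]] that by blast
  obtain g where "g \<in> Hom R (quotient_module F (relation_submodule R M N)) P"
    and "\<And>x. x \<in> carrier F \<Longrightarrow> g (relation_submodule R M N +>\<^bsub>F\<^esub> x) = f x"
    using F.quotient_lift[OF relation_submodule f P f0] by blast
  then show ?thesis
    using gen fb by (intro that[of g]) (simp_all add: tensor_def tens_def)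
qed

text \<open>Existence from \<open>tensor_lift_ex\<close> and uniqueness from
  \<open>tensor_hom_eqI\<close> make the definite description in \<open>tensor_lift\<close>
  meaningful.\<close>

lemma tensor_lift:
  assumes P: "module R P" and b: "bilinear R M N P b"
  shows tensor_lift_Hom: "tensor_lift R M N P b \<in> Hom R (tensor R M N) P"
    and tensor_lift_tens:
      "\<lbrakk>x \<in> carrier M; y \<in> carrier N\<rbrakk> \<Longrightarrow> tensor_lift R M N P b (tens R M N x y) = b x y"
proof -
  let ?Q = "\<lambda>h. h \<in> Hom R (tensor R M N) P \<and>
    (\<forall>x\<in>carrier M. \<forall>y\<in>carrier N. h (tens R M N x y) = b x y)"
  obtain h where h: "?Q h" using tensor_lift_ex[OF P b] by metis
  have "?Q (THE h. ?Q h)"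
    by (rule theI[of ?Q, OF h]) (rule tensor_hom_eqI[OF P]; use h in simp)
  then show "tensor_lift R M N P b \<in> Hom R (tensor R M N) P"
    and "\<lbrakk>x \<in> carrier M; y \<in> carrier N\<rbrakk> \<Longrightarrow> tensor_lift R M N P b (tens R M N x y) = b x y"
    unfolding tensor_lift_def by simp_all
qed

end

lemma bilinear_tens_comp:
  assumes "f \<in> Hom R M M'" "g \<in> Hom R N N'" "two_modules R M' N'"
  shows "bilinear R M N (tensor R M' N') (\<lambda>x y. tens R M' N' (f x) (g y))"
proof -
  interpret T': two_modules R M' N' by fact
  note [simp] = Hom_closed[OF assms(1)] Hom_closed[OF assms(2)] Hom_add[OF assms(1)] Hom_add[OF assms(2)]
    Hom_smult[OF assms(1)] Hom_smult[OF assms(2)]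
  show ?thesis
    by (simp add: bilinear_def T'.tens_closed T'.tens_add_left T'.tens_add_right
        T'.tens_smult_left T'.tens_smult_right)
qed

lemma tensor_map:
  assumes "two_modules R M N" "two_modules R M' N'" "f \<in> Hom R M M'" "g \<in> Hom R N N'"
  shows tensor_map_Hom: "tensor_map R M N M' N' f g \<in> Hom R (tensor R M N) (tensor R M' N')"
    and tensor_map_tens: "\<lbrakk>x \<in> carrier M; y \<in> carrier N\<rbrakk> \<Longrightarrow>
      tensor_map R M N M' N' f g (tens R M N x y) = tens R M' N' (f x) (g y)"
proof -
  interpret T: two_modules R M N by fact
  interpret T': two_modules R M' N' by fact
  note * = T'.module_tensor bilinear_tens_comp[OF assms(3,4,2)]
  show "tensor_map R M N M' N' f g \<in> Hom R (tensor R M N) (tensor R M' N')"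
    unfolding tensor_map_def by (rule T.tensor_lift_Hom[OF *])
  show "tensor_map R M N M' N' f g (tens R M N x y) = tens R M' N' (f x) (g y)"
    if "x \<in> carrier M" "y \<in> carrier N"
    unfolding tensor_map_def using that by (rule T.tensor_lift_tens[OF *])
qed


lemma id_map_apply: "x \<in> carrier M \<Longrightarrow> id_map M x = x"
  by (simp add: id_map_def)

lemma bilinearI:
  assumes "\<And>x y. \<lbrakk>x \<in> carrier M; y \<in> carrier N\<rbrakk> \<Longrightarrow> b x y \<in> carrier P"
    and "\<And>x x' y. \<lbrakk>x \<in> carrier M; x' \<in> carrier M; y \<in> carrier N\<rbrakk> \<Longrightarrow>
      b (x \<oplus>\<^bsub>M\<^esub> x') y = b x y \<oplus>\<^bsub>P\<^esub> b x' y"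
    and "\<And>x y y'. \<lbrakk>x \<in> carrier M; y \<in> carrier N; y' \<in> carrier N\<rbrakk> \<Longrightarrow>
      b x (y \<oplus>\<^bsub>N\<^esub> y') = b x y \<oplus>\<^bsub>P\<^esub> b x y'"
    and "\<And>a x y. \<lbrakk>a \<in> carrier R; x \<in> carrier M; y \<in> carrier N\<rbrakk> \<Longrightarrow>
      b (a \<odot>\<^bsub>M\<^esub> x) y = a \<odot>\<^bsub>P\<^esub> b x y"
    and "\<And>a x y. \<lbrakk>a \<in> carrier R; x \<in> carrier M; y \<in> carrier N\<rbrakk> \<Longrightarrow>
      b x (a \<odot>\<^bsub>N\<^esub> y) = a \<odot>\<^bsub>P\<^esub> b x y"
  shows "bilinear R M N P b"
  using assms by (simp add: bilinear_def)

lemma bilinearD: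
  assumes "bilinear R M N P b"
  shows "\<lbrakk>x \<in> carrier M; y \<in> carrier N\<rbrakk> \<Longrightarrow> b x y \<in> carrier P"
    and "\<lbrakk>x \<in> carrier M; x' \<in> carrier M; y \<in> carrier N\<rbrakk> \<Longrightarrow>
      b (x \<oplus>\<^bsub>M\<^esub> x') y = b x y \<oplus>\<^bsub>P\<^esub> b x' y"
    and "\<lbrakk>x \<in> carrier M; y \<in> carrier N; y' \<in> carrier N\<rbrakk> \<Longrightarrow>
      b x (y \<oplus>\<^bsub>N\<^esub> y') = b x y \<oplus>\<^bsub>P\<^esub> b x y'"
    and "\<lbrakk>a \<in> carrier R; x \<in> carrier M; y \<in> carrier N\<rbrakk> \<Longrightarrow>
      b (a \<odot>\<^bsub>M\<^esub> x) y = a \<odot>\<^bsub>P\<^esub> b x y"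
    and "\<lbrakk>a \<in> carrier R; x \<in> carrier M; y \<in> carrier N\<rbrakk> \<Longrightarrow>
      b x (a \<odot>\<^bsub>N\<^esub> y) = a \<odot>\<^bsub>P\<^esub> b x y"
  using assms by (simp_all add: bilinear_def)

lemma bilinear_swap: "bilinear R M N P b \<Longrightarrow> bilinear R N M P (\<lambda>y x. b x y)"
  by (simp add: bilinear_def)

text \<open>A trilinear map on U, M, N becomes bilinear on U and M tensor N. Linearity in u has to
  be proved, since a separate lift is taken for each u; it is checked on sums of pure tensors. Both
  the associators and the contractions arise this way.\<close>

lemma (in two_modules) bilinear_tensor_lift:
  assumes U: "module R U" and P: "module R P"
    and b: "\<And>u. u \<in> carrier U \<Longrightarrow> bilinear R M N P (b u)"
    and add: "\<And>u u' x y. \<lbrakk>u \<in> carrier U; u' \<in> carrier U; x \<in> carrier M; y \<in> carrier N\<rbrakk> \<Longrightarrow>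
      b (u \<oplus>\<^bsub>U\<^esub> u') x y = b u x y \<oplus>\<^bsub>P\<^esub> b u' x y"
    and smult: "\<And>a u x y. \<lbrakk>a \<in> carrier R; u \<in> carrier U; x \<in> carrier M; y \<in> carrier N\<rbrakk> \<Longrightarrow>
      b (a \<odot>\<^bsub>U\<^esub> u) x y = a \<odot>\<^bsub>P\<^esub> b u x y"
  shows "bilinear R U (tensor R M N) P (\<lambda>u. tensor_lift R M N P (b u))"
proof -
  interpret U: module R U by fact
  interpret P: module R P by fact
  note hom = tensor_lift_Hom[OF P b]
  note [simp] = Hom_closed[OF hom] Hom_add[OF hom] tensor_lift_tens[OF P b]
  note bc = bilinearD(1)[OF b]
  show ?thesis
  proof (rule bilinearI)
    fix u u' z assume u: "u \<in> carrier U" "u' \<in> carrier U" and z: "z \<in> carrier (tensor R M N)"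
    show "tensor_lift R M N P (b (u \<oplus>\<^bsub>U\<^esub> u')) z
        = tensor_lift R M N P (b u) z \<oplus>\<^bsub>P\<^esub> tensor_lift R M N P (b u') z"
      using z by (induction z rule: tensor_induct) (simp_all add: u add bc P.M.add.m_ac)
  next
    fix a u z assume u: "a \<in> carrier R" "u \<in> carrier U" and z: "z \<in> carrier (tensor R M N)"
    show "tensor_lift R M N P (b (a \<odot>\<^bsub>U\<^esub> u)) z = a \<odot>\<^bsub>P\<^esub> tensor_lift R M N P (b u) z"
      using z by (induction z rule: tensor_induct) (simp_all add: u smult bc P.smult_r_distr)
  qed (simp_all add: Hom_smult[OF hom])
qed


section \<open>Snake maps as contractions\<close>

definition contract_left ::
  "('a, 'r) ring_scheme \<Rightarrow> ('a, 'v, 'm) module_scheme \<Rightarrow> (('v \<times> 'v \<Rightarrow> 'a) set \<Rightarrow> 'a)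
     \<Rightarrow> 'v \<Rightarrow> ('v \<times> 'v \<Rightarrow> 'a) set \<Rightarrow> 'v" where
  "contract_left R V \<phi> v = tensor_lift R V V V (\<lambda>x y. \<phi> (tens R V V v x) \<odot>\<^bsub>V\<^esub> y)"

text \<open>Here v stands to the right of the tensor: (x tensor y) tensor v goes to \<phi>(y tensor
  v) x. It is nevertheless the first argument, so that both contractions are bilinear of the same
  type.\<close>

definition contract_right ::
  "('a, 'r) ring_scheme \<Rightarrow> ('a, 'v, 'm) module_scheme \<Rightarrow> (('v \<times> 'v \<Rightarrow> 'a) set \<Rightarrow> 'a)
     \<Rightarrow> 'v \<Rightarrow> ('v \<times> 'v \<Rightarrow> 'a) set \<Rightarrow> 'v" where
  "contract_right R V \<phi> v = tensor_lift R V V V (\<lambda>x y. \<phi> (tens R V V y v) \<odot>\<^bsub>V\<^esub> x)"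

context module
begin

lemma two_modules_self: "two_modules R M M"
  by (intro two_modules.intro module_axioms)

lemma module_tensor_square: "module R (tensor R M M)"
  by (rule two_modules.module_tensor[OF two_modules_self])

lemma two_modules_square_left: "two_modules R (tensor R M M) M"
  by (intro two_modules.intro module_axioms module_tensor_square)

lemma two_modules_square_right: "two_modules R M (tensor R M M)"
  by (intro two_modules.intro module_axioms module_tensor_square)

lemma two_modules_regular_left: "two_modules R (regular_module R) M"
  by (intro two_modules.intro module_axioms module_regular_module R.is_cring)

lemma two_modules_regular_right: "two_modules R M (regular_module R)"
  by (intro two_modules.intro module_axioms module_regular_module R.is_cring)

context
  fixes \<phi>
  assumes phi: "\<phi> \<in> Hom R (tensor R M M) (regular_module R)"
begin

interpretation T: two_modules R M M by (rule two_modules_self)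

lemma pairing_closed: "\<lbrakk>x \<in> carrier M; y \<in> carrier M\<rbrakk> \<Longrightarrow> \<phi> (tens R M M x y) \<in> carrier R"
  using Hom_closed[OF phi T.tens_closed] by simp

lemmas pairing_rules = pairing_closed T.tens_closed T.tens_add_left T.tens_add_right T.tens_smult_left
  T.tens_smult_right Hom_add[OF phi T.tens_closed T.tens_closed, simplified]
  Hom_smult[OF phi _ T.tens_closed, simplified]

lemma bilinear_contract_left:
  assumes "v \<in> carrier M"
  shows "bilinear R M M M (\<lambda>x y. \<phi> (tens R M M v x) \<odot>\<^bsub>M\<^esub> y)"
  using assms
  by (intro bilinearI)
    (simp_all add: pairing_rules smult_l_distr smult_r_distr smult_assoc1[symmetric] R.m_comm)

lemma bilinear_contract_right:
  assumes "v \<in> carrier M"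
  shows "bilinear R M M M (\<lambda>x y. \<phi> (tens R M M y v) \<odot>\<^bsub>M\<^esub> x)"
  using assms
  by (intro bilinearI)
    (simp_all add: pairing_rules smult_l_distr smult_r_distr smult_assoc1[symmetric] R.m_comm)

lemma contract_left:
  shows contract_left_bilinear: "bilinear R M (tensor R M M) M (contract_left R M \<phi>)"
    and contract_left_tens: "\<lbrakk>v \<in> carrier M; x \<in> carrier M; y \<in> carrier M\<rbrakk> \<Longrightarrow>
      contract_left R M \<phi> v (tens R M M x y) = \<phi> (tens R M M v x) \<odot>\<^bsub>M\<^esub> y"
proof -
  show "bilinear R M (tensor R M M) M (contract_left R M \<phi>)"
    unfolding contract_left_def[abs_def]
    by (rule T.bilinear_tensor_lift[OF module_axioms module_axioms bilinear_contract_left])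
      (simp_all add: pairing_rules smult_l_distr smult_r_distr smult_assoc1)
  show "contract_left R M \<phi> v (tens R M M x y) = \<phi> (tens R M M v x) \<odot>\<^bsub>M\<^esub> y"
    if "v \<in> carrier M" "x \<in> carrier M" "y \<in> carrier M"
    unfolding contract_left_def
    using that by (intro T.tensor_lift_tens[OF module_axioms bilinear_contract_left])
qed

lemma contract_right:
  shows contract_right_bilinear: "bilinear R M (tensor R M M) M (contract_right R M \<phi>)"
    and contract_right_tens: "\<lbrakk>v \<in> carrier M; x \<in> carrier M; y \<in> carrier M\<rbrakk> \<Longrightarrow>
      contract_right R M \<phi> v (tens R M M x y) = \<phi> (tens R M M y v) \<odot>\<^bsub>M\<^esub> x"
proof -
  show "bilinear R M (tensor R M M) M (contract_right R M \<phi>)"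
    unfolding contract_right_def[abs_def]
    by (rule T.bilinear_tensor_lift[OF module_axioms module_axioms bilinear_contract_right])
      (simp_all add: pairing_rules smult_l_distr smult_r_distr smult_assoc1)
  show "contract_right R M \<phi> v (tens R M M x y) = \<phi> (tens R M M y v) \<odot>\<^bsub>M\<^esub> x"
    if "v \<in> carrier M" "x \<in> carrier M" "y \<in> carrier M"
    unfolding contract_right_def
    using that by (intro T.tensor_lift_tens[OF module_axioms bilinear_contract_right])
qed

section \<open>Associators and unitors on pure tensors\<close>

lemma assoc_left:
  shows assoc_left_Hom:
      "assoc_left R M \<in> Hom R (tensor R M (tensor R M M)) (tensor R (tensor R M M) M)"
    and assoc_left_tens: "\<lbrakk>u \<in> carrier M; v \<in> carrier M; w \<in> carrier M\<rbrakk> \<Longrightarrow>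
      assoc_left R M (tens R M (tensor R M M) u (tens R M M v w))
      = tens R (tensor R M M) M (tens R M M u v) w"
proof -
  interpret S: two_modules R "tensor R M M" M by (rule two_modules_square_left)
  interpret S': two_modules R M "tensor R M M" by (rule two_modules_square_right)
  note rules = T.tens_closed T.tens_add_left T.tens_add_right T.tens_smult_left T.tens_smult_right
    S.tens_closed S.tens_add_left S.tens_add_right S.tens_smult_left S.tens_smult_right
  have inner: "bilinear R M M (tensor R (tensor R M M) M)
      (\<lambda>v w. tens R (tensor R M M) M (tens R M M u v) w)" if "u \<in> carrier M" for u
    using that by (intro bilinearI) (simp_all add: rules)
  have outer: "bilinear R M (tensor R M M) (tensor R (tensor R M M) M)
      (\<lambda>u. tensor_lift R M M (tensor R (tensor R M M) M)
        (\<lambda>v w. tens R (tensor R M M) M (tens R M M u v) w))"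
    by (rule T.bilinear_tensor_lift[OF module_axioms S.module_tensor inner]) (simp_all add: rules)
  show "assoc_left R M \<in> Hom R (tensor R M (tensor R M M)) (tensor R (tensor R M M) M)"
    unfolding assoc_left_def by (rule S'.tensor_lift_Hom[OF S.module_tensor outer])
  show "assoc_left R M (tens R M (tensor R M M) u (tens R M M v w))
      = tens R (tensor R M M) M (tens R M M u v) w"
    if "u \<in> carrier M" "v \<in> carrier M" "w \<in> carrier M"
    unfolding assoc_left_def
    using that
    by (simp add: S'.tensor_lift_tens[OF S.module_tensor outer] T.tens_closed
        T.tensor_lift_tens[OF S.module_tensor inner])
qed

lemma assoc_right:
  shows assoc_right_Hom:
      "assoc_right R M \<in> Hom R (tensor R (tensor R M M) M) (tensor R M (tensor R M M))"
    and assoc_right_tens: "\<lbrakk>u \<in> carrier M; v \<in> carrier M; w \<in> carrier M\<rbrakk> \<Longrightarrow>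
      assoc_right R M (tens R (tensor R M M) M (tens R M M u v) w)
      = tens R M (tensor R M M) u (tens R M M v w)"
proof -
  interpret S: two_modules R "tensor R M M" M by (rule two_modules_square_left)
  interpret S': two_modules R M "tensor R M M" by (rule two_modules_square_right)
  note rules = T.tens_closed T.tens_add_left T.tens_add_right T.tens_smult_left T.tens_smult_right
    S'.tens_closed S'.tens_add_left S'.tens_add_right S'.tens_smult_left S'.tens_smult_right
  have inner: "bilinear R M M (tensor R M (tensor R M M))
      (\<lambda>u v. tens R M (tensor R M M) u (tens R M M v w))" if "w \<in> carrier M" for w
    using that by (intro bilinearI) (simp_all add: rules)
  have outer: "bilinear R M (tensor R M M) (tensor R M (tensor R M M))
      (\<lambda>w. tensor_lift R M M (tensor R M (tensor R M M))
        (\<lambda>u v. tens R M (tensor R M M) u (tens R M M v w)))"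
    by (rule T.bilinear_tensor_lift[OF module_axioms S'.module_tensor inner]) (simp_all add: rules)
  note outer = bilinear_swap[OF outer]
  show "assoc_right R M \<in> Hom R (tensor R (tensor R M M) M) (tensor R M (tensor R M M))"
    unfolding assoc_right_def by (rule S.tensor_lift_Hom[OF S'.module_tensor outer])
  show "assoc_right R M (tens R (tensor R M M) M (tens R M M u v) w)
      = tens R M (tensor R M M) u (tens R M M v w)"
    if "u \<in> carrier M" "v \<in> carrier M" "w \<in> carrier M"
    unfolding assoc_right_def
    using that
    by (simp add: S.tensor_lift_tens[OF S'.module_tensor outer] T.tens_closed
        T.tensor_lift_tens[OF S'.module_tensor inner])
qed

lemma left_unitor:
  shows left_unitor_Hom: "left_unitor R M \<in> Hom R (tensor R (regular_module R) M) M"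
    and left_unitor_tens: "\<lbrakk>a \<in> carrier R; v \<in> carrier M\<rbrakk> \<Longrightarrow>
      left_unitor R M (tens R (regular_module R) M a v) = a \<odot>\<^bsub>M\<^esub> v"
proof -
  interpret S: two_modules R "regular_module R" M by (rule two_modules_regular_left)
  have b: "bilinear R (regular_module R) M M (\<lambda>a v. a \<odot>\<^bsub>M\<^esub> v)"
    by (intro bilinearI)
      (simp_all add: smult_l_distr smult_r_distr smult_assoc1[symmetric] R.m_comm)
  show "left_unitor R M \<in> Hom R (tensor R (regular_module R) M) M"
    unfolding left_unitor_def by (rule S.tensor_lift_Hom[OF module_axioms b])
  show "left_unitor R M (tens R (regular_module R) M a v) = a \<odot>\<^bsub>M\<^esub> v"
    if "a \<in> carrier R" "v \<in> carrier M"
    unfolding left_unitor_def using that by (simp add: S.tensor_lift_tens[OF module_axioms b])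
qed

lemma right_unitor:
  shows right_unitor_Hom: "right_unitor R M \<in> Hom R (tensor R M (regular_module R)) M"
    and right_unitor_tens: "\<lbrakk>v \<in> carrier M; a \<in> carrier R\<rbrakk> \<Longrightarrow>
      right_unitor R M (tens R M (regular_module R) v a) = a \<odot>\<^bsub>M\<^esub> v"
proof -
  interpret S: two_modules R M "regular_module R" by (rule two_modules_regular_right)
  have b: "bilinear R M (regular_module R) M (\<lambda>v a. a \<odot>\<^bsub>M\<^esub> v)"
    by (intro bilinearI)
      (simp_all add: smult_l_distr smult_r_distr smult_assoc1[symmetric] R.m_comm)
  show "right_unitor R M \<in> Hom R (tensor R M (regular_module R)) M"
    unfolding right_unitor_def by (rule S.tensor_lift_Hom[OF module_axioms b])
  show "right_unitor R M (tens R M (regular_module R) v a) = a \<odot>\<^bsub>M\<^esub> v"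
    if "v \<in> carrier M" "a \<in> carrier R"
    unfolding right_unitor_def using that by (simp add: S.tensor_lift_tens[OF module_axioms b])
qed

text \<open>Everything after \<open>\<psi>\<close> is additive in the inserted element of V tensor
  V, and on a pure tensor the composite runs v (x y) -> (v x) y -> \<phi>(v x) tensor y -> \<phi>(v
  x) y, which is the contraction.\<close>

lemma snake_left_eq:
  assumes psi: "\<psi> \<in> Hom R (regular_module R) (tensor R M M)" and v: "v \<in> carrier M"
  shows "snake_left R M \<phi> \<psi> v = contract_left R M \<phi> v (\<psi> \<one>\<^bsub>R\<^esub>)"
proof -
  let ?T = "tensor R M M"
  interpret S: two_modules R M ?T by (rule two_modules_square_right)
  interpret S': two_modules R ?T M by (rule two_modules_square_left)
  note id = Hom_id_map[OF module_axioms]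
  note map_phi = tensor_map_Hom[OF two_modules_square_left two_modules_regular_left phi id]
    and map_phi_tens = tensor_map_tens[OF two_modules_square_left two_modules_regular_left phi id]
  note map_psi_tens = tensor_map_tens[OF two_modules_regular_right two_modules_square_right id psi]
  note closed = Hom_closed[OF assoc_left_Hom] Hom_closed[OF map_phi] S.tens_closed T.tens_closed
  \<comment> \<open>The value of \<open>\<psi>\<close> at 1 is generalised to an arbitrary z, since
    it need not be a pure tensor and an induction over sums is required.\<close>
  have "left_unitor R M (tensor_map R ?T M (regular_module R) M \<phi> (id_map M)
      (assoc_left R M (tens R M ?T v z))) = contract_left R M \<phi> v z" if "z \<in> carrier ?T" for z
    using that
  proof (induction z rule: T.tensor_induct)
    case (tens x y)
    then show ?case
      using v by (simp add: assoc_left_tens map_phi_tens T.tens_closed id_map_apply pairing_closed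
          left_unitor_tens contract_left_tens)
  next
    case (add z w)
    then show ?case
      using v by (simp add: S.tens_add_right Hom_add[OF assoc_left_Hom] Hom_add[OF map_phi]
          Hom_add[OF left_unitor_Hom] closed bilinearD(3)[OF contract_left_bilinear])
  qed
  then show ?thesis
    using v Hom_closed[OF psi]
    by (simp add: snake_left_def map_psi_tens id_map_apply)
qed

text \<open>Mirror image of \<open>snake_left_eq\<close>: (x y) v -> x (y v) -> x tensor \<phi>(y v)
  -> \<phi>(y v) x.\<close>

lemma snake_right_eq:
  assumes psi: "\<psi> \<in> Hom R (regular_module R) (tensor R M M)" and v: "v \<in> carrier M"
  shows "snake_right R M \<phi> \<psi> v = contract_right R M \<phi> v (\<psi> \<one>\<^bsub>R\<^esub>)"
proof -
  let ?T = "tensor R M M"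
  interpret S: two_modules R ?T M by (rule two_modules_square_left)
  note id = Hom_id_map[OF module_axioms]
  note map_phi = tensor_map_Hom[OF two_modules_square_right two_modules_regular_right id phi]
    and map_phi_tens = tensor_map_tens[OF two_modules_square_right two_modules_regular_right id phi]
  note map_psi_tens = tensor_map_tens[OF two_modules_regular_left two_modules_square_left psi id]
  note closed = Hom_closed[OF assoc_right_Hom] Hom_closed[OF map_phi] S.tens_closed T.tens_closed
  have "right_unitor R M (tensor_map R M ?T M (regular_module R) (id_map M) \<phi>
      (assoc_right R M (tens R ?T M z v))) = contract_right R M \<phi> v z" if "z \<in> carrier ?T" for z
    using that
  proof (induction z rule: T.tensor_induct)
    case (tens x y)
    then show ?case
      using v by (simp add: assoc_right_tens map_phi_tens T.tens_closed id_map_apply pairing_closed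
          right_unitor_tens contract_right_tens)
  next
    case (add z w)
    then show ?case
      using v by (simp add: S.tens_add_left Hom_add[OF assoc_right_Hom] Hom_add[OF map_phi]
          Hom_add[OF right_unitor_Hom] closed bilinearD(3)[OF contract_right_bilinear])
  qed
  then show ?thesis
    using v Hom_closed[OF psi]
    by (simp add: snake_right_def map_psi_tens id_map_apply)
qed

lemma snake_left_Hom:
  assumes psi: "\<psi> \<in> Hom R (regular_module R) (tensor R M M)"
  shows "snake_left R M \<phi> \<psi> \<in> Hom R M M"
proof (rule HomI)
  have "\<psi> \<one>\<^bsub>R\<^esub> \<in> carrier (tensor R M M)" using Hom_closed[OF psi] by simp
  note c = this bilinearD[OF contract_left_bilinear]
  fix x assume x: "x \<in> carrier M"
  then show "snake_left R M \<phi> \<psi> x \<in> carrier M" by (simp add: snake_left_eq[OF psi] c)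
  show "snake_left R M \<phi> \<psi> (x \<oplus>\<^bsub>M\<^esub> y) = snake_left R M \<phi> \<psi> x \<oplus>\<^bsub>M\<^esub> snake_left R M \<phi> \<psi> y"
    if "y \<in> carrier M" for y using x that by (simp add: snake_left_eq[OF psi] c)
  show "snake_left R M \<phi> \<psi> (a \<odot>\<^bsub>M\<^esub> x) = a \<odot>\<^bsub>M\<^esub> snake_left R M \<phi> \<psi> x"
    if "a \<in> carrier R" for a using x that by (simp add: snake_left_eq[OF psi] c)
qed (simp add: snake_left_def)

lemma snake_right_Hom:
  assumes psi: "\<psi> \<in> Hom R (regular_module R) (tensor R M M)"
  shows "snake_right R M \<phi> \<psi> \<in> Hom R M M"
proof (rule HomI)
  have "\<psi> \<one>\<^bsub>R\<^esub> \<in> carrier (tensor R M M)" using Hom_closed[OF psi] by simp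
  note c = this bilinearD[OF contract_right_bilinear]
  fix x assume x: "x \<in> carrier M"
  then show "snake_right R M \<phi> \<psi> x \<in> carrier M" by (simp add: snake_right_eq[OF psi] c)
  show "snake_right R M \<phi> \<psi> (x \<oplus>\<^bsub>M\<^esub> y) = snake_right R M \<phi> \<psi> x \<oplus>\<^bsub>M\<^esub> snake_right R M \<phi> \<psi> y"
    if "y \<in> carrier M" for y using x that by (simp add: snake_right_eq[OF psi] c)
  show "snake_right R M \<phi> \<psi> (a \<odot>\<^bsub>M\<^esub> x) = a \<odot>\<^bsub>M\<^esub> snake_right R M \<phi> \<psi> x"
    if "a \<in> carrier R" for a using x that by (simp add: snake_right_eq[OF psi] c)
qed (simp add: snake_right_def)

end

end


section \<open>Extension of scalars\<close>

text \<open>Evaluates the definite description. Uniqueness is asked for in the form that a linear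
  map is determined by its values along i, so k and f matter only for existence.\<close>

lemma linear_extension_eq:
  assumes "g \<in> Hom A X' Y'" "\<And>x. x \<in> X \<Longrightarrow> g (i x) = k (f x)"
    and "\<And>h. \<lbrakk>h \<in> Hom A X' Y'; \<And>x. x \<in> X \<Longrightarrow> h (i x) = g (i x)\<rbrakk> \<Longrightarrow> h = g"
  shows "linear_extension A X' Y' X i k f = g"
  unfolding linear_extension_def
proof (rule the_equality)
  show "g \<in> Hom A X' Y' \<and> (\<forall>x\<in>X. g (i x) = k (f x))"
    using assms(1,2) by simp
  fix h assume "h \<in> Hom A X' Y' \<and> (\<forall>x\<in>X. h (i x) = k (f x))"
  then show "h = g" by (intro assms(3)) (simp_all add: assms(2))
qed

lemma (in two_modules) Hom_tens_left:
  assumes "f \<in> Hom R (tensor R M N) P" "y \<in> carrier N"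
  shows "restrict (\<lambda>x. f (tens R M N x y)) (carrier M) \<in> Hom R M P"
  using assms(2)
  by (intro Hom_restrictI M.module_axioms)
    (simp_all add: tens_closed tens_add_left tens_smult_left Hom_closed[OF assms(1)]
      Hom_add[OF assms(1)] Hom_smult[OF assms(1)])

lemma (in two_modules) Hom_tens_right:
  assumes "f \<in> Hom R (tensor R M N) P" "x \<in> carrier M"
  shows "restrict (\<lambda>y. f (tens R M N x y)) (carrier N) \<in> Hom R N P"
  using assms(2)
  by (intro Hom_restrictI N.module_axioms)
    (simp_all add: tens_closed tens_add_right tens_smult_right Hom_closed[OF assms(1)]
      Hom_add[OF assms(1)] Hom_smult[OF assms(1)])

text \<open>
  Extending \<open>A\<close>-valued maps is all that is needed of the universal property of \<open>A \<otimes> V\<close>.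
\<close>

locale base_change = V: module K V + M: module A M
  for K :: "('k, 'r) ring_scheme" and V :: "('k, 'v, 'm) module_scheme"
    and A :: "('a, 's) ring_scheme" and M :: "('a, 'w, 'n) module_scheme" +
  fixes j :: "'k \<Rightarrow> 'a" and \<iota> :: "'v \<Rightarrow> 'w"
  assumes j: "j \<in> ring_hom K A"
    and \<iota>_closed: "v \<in> carrier V \<Longrightarrow> \<iota> v \<in> carrier M"
    and \<iota>_add: "\<lbrakk>v \<in> carrier V; w \<in> carrier V\<rbrakk> \<Longrightarrow> \<iota> (v \<oplus>\<^bsub>V\<^esub> w) = \<iota> v \<oplus>\<^bsub>M\<^esub> \<iota> w"
    and \<iota>_smult: "\<lbrakk>a \<in> carrier K; v \<in> carrier V\<rbrakk> \<Longrightarrow> \<iota> (a \<odot>\<^bsub>V\<^esub> v) = j a \<odot>\<^bsub>M\<^esub> \<iota> v"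
    and span: "\<lbrakk>submodule H A M; \<iota> ` carrier V \<subseteq> H\<rbrakk> \<Longrightarrow> carrier M \<subseteq> H"
    and extension: "f \<in> Hom K V (restrict_scalars j (regular_module A)) \<Longrightarrow>
      \<exists>g\<in>Hom A M (regular_module A). \<forall>v\<in>carrier V. g (\<iota> v) = f v"
begin

lemmas j_rules = ring_hom_closed[OF j] ring_hom_add[OF j] ring_hom_mult[OF j] ring_hom_one[OF j]

lemma module_regular_A: "module A (regular_module A)"
  by (rule module_regular_module[OF M.R.is_cring])

text \<open>The equalizer of the two maps is a submodule containing \<open>\<iota>\<close> V, which
  generates M.\<close>

lemma Hom_eq_on_V:
  assumes "module A N" "f \<in> Hom A M N" "g \<in> Hom A M N"
    and "\<And>v. v \<in> carrier V \<Longrightarrow> f (\<iota> v) = g (\<iota> v)"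
  shows "f = g"
proof -
  have "carrier M \<subseteq> {x \<in> carrier M. f x = g x}"
    by (rule span[OF submodule_equalizer[OF assms(2,3) M.module_axioms assms(1)]])
      (auto simp: assms \<iota>_closed)
  then show ?thesis by (intro Hom_eqI[OF assms(2,3)]) auto
qed

abbreviation VV where "VV \<equiv> tensor K V V"
abbreviation MM where "MM \<equiv> tensor A M M"

sublocale VV: two_modules K V V by (rule V.two_modules_self)
sublocale MM: two_modules A M M by (rule M.two_modules_self)

text \<open>Generation of M is used once in each tensor factor, with the other factor
  frozen.\<close>

lemma Hom_square_eq_on_VV:
  assumes N: "module A N" and f: "f \<in> Hom A MM N" and g: "g \<in> Hom A MM N"
    and eq: "\<And>v w. \<lbrakk>v \<in> carrier V; w \<in> carrier V\<rbrakk> \<Longrightarrow>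
      f (tens A M M (\<iota> v) (\<iota> w)) = g (tens A M M (\<iota> v) (\<iota> w))"
  shows "f = g"
proof (rule MM.tensor_hom_eqI[OF N f g])
  \<comment> \<open>The second factor is freed while the first still comes from V; then the first is
    freed too.\<close>
  have *: "f (tens A M M (\<iota> v) y) = g (tens A M M (\<iota> v) y)"
    if v: "v \<in> carrier V" and y: "y \<in> carrier M" for v y
    using fun_cong[OF Hom_eq_on_V[OF N MM.Hom_tens_right[OF f] MM.Hom_tens_right[OF g]], of "\<iota> v" "\<iota> v" y]
      v y by (simp add: \<iota>_closed eq)
  show "f (tens A M M x y) = g (tens A M M x y)" if "x \<in> carrier M" "y \<in> carrier M" for x y
    using fun_cong[OF Hom_eq_on_V[OF N MM.Hom_tens_left[OF f] MM.Hom_tens_left[OF g]], of y y x]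
      that by (simp add: \<iota>_closed *)
qed

abbreviation \<iota>2 where "\<iota>2 \<equiv> tensor_square_incl K V A j M \<iota>"

text \<open>Since \<open>\<iota>\<close> is linear along j, the assignment is bilinear over K once
  the A-module on the right is restricted to K; the universal property over K then applies.\<close>

lemma square_incl:
  shows square_incl_Hom: "\<iota>2 \<in> Hom K VV (restrict_scalars j MM)"
    and square_incl_tens:
      "\<lbrakk>v \<in> carrier V; w \<in> carrier V\<rbrakk> \<Longrightarrow> \<iota>2 (tens K V V v w) = tens A M M (\<iota> v) (\<iota> w)"
proof -
  have P: "module K (restrict_scalars j MM)"
    by (rule module_restrict_scalars[OF V.R.is_cring j MM.module_tensor])
  have b: "bilinear K V V (restrict_scalars j MM) (\<lambda>v w. tens A M M (\<iota> v) (\<iota> w))"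
    by (rule bilinearI)
      (simp_all add: \<iota>_closed \<iota>_add \<iota>_smult j_rules MM.tens_closed MM.tens_add_left
        MM.tens_add_right MM.tens_smult_left MM.tens_smult_right)
  show "\<iota>2 \<in> Hom K VV (restrict_scalars j MM)"
    and "\<lbrakk>v \<in> carrier V; w \<in> carrier V\<rbrakk> \<Longrightarrow> \<iota>2 (tens K V V v w) = tens A M M (\<iota> v) (\<iota> w)"
    unfolding tensor_square_incl_def by (rule VV.tensor_lift[OF P b]; assumption)+
qed

lemma square_incl_closed: "z \<in> carrier VV \<Longrightarrow> \<iota>2 z \<in> carrier MM"
  using Hom_closed[OF square_incl_Hom] by simp

text \<open>The pairing is extended one variable at a time, and each stage is an extension of an
  A-valued map on V. Linearity in the variable not being extended follows from uniqueness of
  extensions, as both sides agree on \<open>\<iota>\<close> V.\<close>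

lemma pairing_extension_ex:
  assumes phi: "\<phi> \<in> Hom K VV (regular_module K)"
  shows "\<exists>g\<in>Hom A MM (regular_module A).
    \<forall>v\<in>carrier V. \<forall>w\<in>carrier V. g (tens A M M (\<iota> v) (\<iota> w)) = j (\<phi> (tens K V V v w))"
proof -
  \<comment> \<open>E f is a chosen A-linear extension of f; it is unique by
    \<open>Hom_eq_on_V\<close>.\<close>
  define E where "E f = (SOME g. g \<in> Hom A M (regular_module A) \<and> (\<forall>v\<in>carrier V. g (\<iota> v) = f v))" for f
  have E: "E f \<in> Hom A M (regular_module A)" "\<And>v. v \<in> carrier V \<Longrightarrow> E f (\<iota> v) = f v"
    if "f \<in> Hom K V (restrict_scalars j (regular_module A))" for f
    using someI_ex[OF extension[OF that, unfolded Bex_def]] unfolding E_def by auto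
  note pairing_rules = Hom_closed[OF phi VV.tens_closed, simplified]
    Hom_add[OF phi VV.tens_closed VV.tens_closed, simplified] Hom_smult[OF phi _ VV.tens_closed, simplified]
  \<comment> \<open>With v in V fixed, the second slot is extended from V to M.\<close>
  define G where "G v = E (\<lambda>w\<in>carrier V. j (\<phi> (tens K V V v w)))" for v
  have f: "(\<lambda>w\<in>carrier V. j (\<phi> (tens K V V v w))) \<in> Hom K V (restrict_scalars j (regular_module A))"
    if "v \<in> carrier V" for v
    using that by (intro Hom_restrictI V.module_axioms)
      (simp_all add: j_rules pairing_rules VV.tens_add_right VV.tens_smult_right)
  have G: "G v \<in> Hom A M (regular_module A)" "\<And>w. w \<in> carrier V \<Longrightarrow> G v (\<iota> w) = j (\<phi> (tens K V V v w))"
    if "v \<in> carrier V" for v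
    using E[OF f[OF that]] unfolding G_def by auto
  note Gc = Hom_closed[OF G(1), simplified]
  \<comment> \<open>This and \<open>G_smult\<close> are what allow the first slot to be extended
    next: v |-> G v m must be K-linear for each m.\<close>
  have G_add: "G (v \<oplus>\<^bsub>V\<^esub> v') m = G v m \<oplus>\<^bsub>A\<^esub> G v' m"
    if v: "v \<in> carrier V" "v' \<in> carrier V" and m: "m \<in> carrier M" for v v' m
  proof -
    have "G (v \<oplus>\<^bsub>V\<^esub> v') = restrict (\<lambda>m. G v m \<oplus>\<^bsub>regular_module A\<^esub> G v' m) (carrier M)"
      using v
      by (intro Hom_eq_on_V[OF module_regular_A] Hom_sum M.module_axioms module_regular_A G)
        (simp_all add: \<iota>_closed G VV.tens_add_left j_rules pairing_rules)
    then show ?thesis using m by simp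
  qed
  have G_smult: "G (a \<odot>\<^bsub>V\<^esub> v) m = j a \<otimes>\<^bsub>A\<^esub> G v m"
    if v: "a \<in> carrier K" "v \<in> carrier V" and m: "m \<in> carrier M" for a v m
  proof -
    have "G (a \<odot>\<^bsub>V\<^esub> v) = restrict (\<lambda>m. j a \<odot>\<^bsub>regular_module A\<^esub> G v m) (carrier M)"
      using v
      by (intro Hom_eq_on_V[OF module_regular_A] Hom_scale M.module_axioms module_regular_A G)
        (simp_all add: \<iota>_closed G VV.tens_smult_left j_rules pairing_rules)
    then show ?thesis using m by simp
  qed
  \<comment> \<open>Now m in M is the second slot, and the first slot is extended from V to M. So H
    carries the slots in reversed order.\<close>
  define H where "H m = E (\<lambda>v\<in>carrier V. G v m)" for m
  have h: "(\<lambda>v\<in>carrier V. G v m) \<in> Hom K V (restrict_scalars j (regular_module A))"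
    if "m \<in> carrier M" for m
    using that by (intro Hom_restrictI V.module_axioms) (simp_all add: Gc G_add G_smult)
  have H: "H m \<in> Hom A M (regular_module A)" "\<And>v. v \<in> carrier V \<Longrightarrow> H m (\<iota> v) = G v m"
    if "m \<in> carrier M" for m
    using E[OF h[OF that]] unfolding H_def by auto
  note H_rules = Hom_closed[OF H(1), simplified] Hom_add[OF H(1), simplified]
    Hom_smult[OF H(1), simplified]
  have H_add: "H (m \<oplus>\<^bsub>M\<^esub> m') x = H m x \<oplus>\<^bsub>A\<^esub> H m' x"
    if m: "m \<in> carrier M" "m' \<in> carrier M" and x: "x \<in> carrier M" for m m' x
  proof -
    have "H (m \<oplus>\<^bsub>M\<^esub> m') = restrict (\<lambda>x. H m x \<oplus>\<^bsub>regular_module A\<^esub> H m' x) (carrier M)"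
      using m
      by (intro Hom_eq_on_V[OF module_regular_A] Hom_sum M.module_axioms module_regular_A H)
        (simp_all add: \<iota>_closed H Hom_add[OF G(1)])
    then show ?thesis using x by simp
  qed
  have H_smult: "H (a \<odot>\<^bsub>M\<^esub> m) x = a \<otimes>\<^bsub>A\<^esub> H m x"
    if m: "a \<in> carrier A" "m \<in> carrier M" and x: "x \<in> carrier M" for a m x
  proof -
    have "H (a \<odot>\<^bsub>M\<^esub> m) = restrict (\<lambda>x. a \<odot>\<^bsub>regular_module A\<^esub> H m x) (carrier M)"
      using m
      by (intro Hom_eq_on_V[OF module_regular_A] Hom_scale M.module_axioms module_regular_A H)
        (simp_all add: \<iota>_closed H Hom_smult[OF G(1)])
    then show ?thesis using x by simp
  qed
  have b: "bilinear A M M (regular_module A) (\<lambda>x m. H m x)"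
    by (rule bilinearI) (simp_all add: H_rules H_add H_smult)
  show ?thesis
    by (intro bexI[of _ "tensor_lift A M M (regular_module A) (\<lambda>x m. H m x)"])
      (simp_all add: MM.tensor_lift[OF module_regular_A b] \<iota>_closed H G)
qed

text \<open>The defining condition ranges over all of V tensor V, while the constructed extension is
  known on pure tensors only; additivity of both sides bridges the gap. For uniqueness the pure
  tensors already suffice.\<close>

lemma extend_pairing:
  assumes phi: "\<phi> \<in> Hom K VV (regular_module K)"
  shows extend_pairing_Hom: "extend_pairing K V A j M \<iota> \<phi> \<in> Hom A MM (regular_module A)"
    and extend_pairing_tens: "\<lbrakk>v \<in> carrier V; w \<in> carrier V\<rbrakk> \<Longrightarrow>
      extend_pairing K V A j M \<iota> \<phi> (tens A M M (\<iota> v) (\<iota> w)) = j (\<phi> (tens K V V v w))"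
proof -
  obtain g where g: "g \<in> Hom A MM (regular_module A)"
    and gv: "\<And>v w. \<lbrakk>v \<in> carrier V; w \<in> carrier V\<rbrakk> \<Longrightarrow> g (tens A M M (\<iota> v) (\<iota> w)) = j (\<phi> (tens K V V v w))"
    using pairing_extension_ex[OF phi] by blast
  have "extend_pairing K V A j M \<iota> \<phi> = g"
    unfolding extend_pairing_def
  proof (rule linear_extension_eq[OF g])
    fix z assume "z \<in> carrier VV"
    then show "g (\<iota>2 z) = j (\<phi> z)"
      by (induction z rule: VV.tensor_induct)
        (simp_all add: square_incl_tens gv Hom_add[OF square_incl_Hom] square_incl_closed
          Hom_add[OF g] Hom_add[OF phi] Hom_closed[OF phi, simplified] j_rules)
  next
    fix h assume h: "h \<in> Hom A MM (regular_module A)" "\<And>z. z \<in> carrier VV \<Longrightarrow> h (\<iota>2 z) = g (\<iota>2 z)"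
    show "h = g"
      by (rule Hom_square_eq_on_VV[OF module_regular_A h(1) g])
        (use h(2) in \<open>simp add: square_incl_tens[symmetric] VV.tens_closed\<close>)
  qed
  then show "extend_pairing K V A j M \<iota> \<phi> \<in> Hom A MM (regular_module A)"
    and "\<lbrakk>v \<in> carrier V; w \<in> carrier V\<rbrakk> \<Longrightarrow>
      extend_pairing K V A j M \<iota> \<phi> (tens A M M (\<iota> v) (\<iota> w)) = j (\<phi> (tens K V V v w))"
    using g gv by simp_all
qed

text \<open>An A-linear map out of A is determined by its value at 1, and 1 is the image of 1 under
  j; the prescribed value there is \<open>\<iota>2\<close> applied to \<psi>(1).\<close>

lemma extend_copairing_eq:
  assumes psi: "\<psi> \<in> Hom K (regular_module K) VV"
  shows "extend_copairing K V A j M \<iota> \<psi> = (\<lambda>a\<in>carrier A. a \<odot>\<^bsub>MM\<^esub> \<iota>2 (\<psi> \<one>\<^bsub>K\<^esub>))"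
proof -
  have one: "\<psi> \<one>\<^bsub>K\<^esub> \<in> carrier VV" using Hom_closed[OF psi] by simp
  show ?thesis
    unfolding extend_copairing_def
  proof (rule linear_extension_eq)
    show g: "(\<lambda>a\<in>carrier A. a \<odot>\<^bsub>MM\<^esub> \<iota>2 (\<psi> \<one>\<^bsub>K\<^esub>)) \<in> Hom A (regular_module A) MM"
      by (rule Hom_regular_moduleI[OF MM.module_tensor square_incl_closed[OF one]])
    show "(\<lambda>a\<in>carrier A. a \<odot>\<^bsub>MM\<^esub> \<iota>2 (\<psi> \<one>\<^bsub>K\<^esub>)) (j x) = \<iota>2 (\<psi> x)" if x: "x \<in> carrier K" for x
    proof -
      have "\<psi> x = x \<odot>\<^bsub>VV\<^esub> \<psi> \<one>\<^bsub>K\<^esub>" using Hom_smult[OF psi x, of "\<one>\<^bsub>K\<^esub>"] x by simp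
      then show ?thesis
        using x by (simp add: j_rules Hom_smult[OF square_incl_Hom x one])
    qed
    fix h assume h: "h \<in> Hom A (regular_module A) MM"
      "\<And>x. x \<in> carrier K \<Longrightarrow> h (j x) = (\<lambda>a\<in>carrier A. a \<odot>\<^bsub>MM\<^esub> \<iota>2 (\<psi> \<one>\<^bsub>K\<^esub>)) (j x)"
    show "h = (\<lambda>a\<in>carrier A. a \<odot>\<^bsub>MM\<^esub> \<iota>2 (\<psi> \<one>\<^bsub>K\<^esub>))"
    proof (rule Hom_eqI[OF h(1) g])
      fix a assume a: "a \<in> carrier (regular_module A)"
      have "h a = a \<odot>\<^bsub>MM\<^esub> h \<one>\<^bsub>A\<^esub>" using Hom_smult[OF h(1), of a "\<one>\<^bsub>A\<^esub>"] a by simp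
      moreover have "h \<one>\<^bsub>A\<^esub> = \<iota>2 (\<psi> \<one>\<^bsub>K\<^esub>)"
        using h(2)[of "\<one>\<^bsub>K\<^esub>"] module.smult_one[OF MM.module_tensor square_incl_closed[OF one]]
        by (simp add: j_rules)
      ultimately show "h a = (\<lambda>a\<in>carrier A. a \<odot>\<^bsub>MM\<^esub> \<iota>2 (\<psi> \<one>\<^bsub>K\<^esub>)) a" using a by simp
    qed
  qed
qed

end

text \<open>\<open>\<tau>\<close> is an arbitrary element of A, so one computation covers both t in
  K[[t]] and its class in K[t]/(t^2). The quadratic term is kept and dealt with only in each
  instance.\<close>

locale base_change_deformation = base_change +
  fixes \<tau> \<beta> \<beta>1 \<gamma> \<gamma>1
  assumes \<tau>: "\<tau> \<in> carrier A"
    and \<beta>: "\<beta> \<in> Hom K (tensor K V V) (regular_module K)"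
    and \<beta>1: "\<beta>1 \<in> Hom K (tensor K V V) (regular_module K)"
    and \<gamma>: "\<gamma> \<in> Hom K (regular_module K) (tensor K V V)"
    and \<gamma>1: "\<gamma>1 \<in> Hom K (regular_module K) (tensor K V V)"
begin

abbreviation \<beta>' where "\<beta>' \<equiv> deformed_pairing K V A j M \<iota> \<tau> \<beta> \<beta>1"
abbreviation \<gamma>' where "\<gamma>' \<equiv> deformed_copairing K V A j M \<iota> \<tau> \<gamma> \<gamma>1"

lemma deformed_pairing_Hom: "\<beta>' \<in> Hom A MM (regular_module A)"
  using Hom_sum[OF MM.module_tensor module_regular_A extend_pairing_Hom[OF \<beta>]
      Hom_scale[OF MM.module_tensor module_regular_A extend_pairing_Hom[OF \<beta>1] \<tau>]]
  by (simp add: deformed_pairing_def cong: restrict_cong)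

lemma deformed_pairing_tens:
  assumes "v \<in> carrier V" "w \<in> carrier V"
  shows "\<beta>' (tens A M M (\<iota> v) (\<iota> w)) = j (\<beta> (tens K V V v w)) \<oplus>\<^bsub>A\<^esub> \<tau> \<otimes>\<^bsub>A\<^esub> j (\<beta>1 (tens K V V v w))"
  using assms
  by (simp add: deformed_pairing_def MM.tens_closed \<iota>_closed extend_pairing_tens[OF \<beta>]
      extend_pairing_tens[OF \<beta>1])

lemma copairing_one_closed: "\<gamma> \<one>\<^bsub>K\<^esub> \<in> carrier VV" "\<gamma>1 \<one>\<^bsub>K\<^esub> \<in> carrier VV"
  using Hom_closed[OF \<gamma>] Hom_closed[OF \<gamma>1] by simp_all

lemma deformed_copairing_Hom: "\<gamma>' \<in> Hom A (regular_module A) MM"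
proof -
  note c = Hom_regular_moduleI[OF MM.module_tensor square_incl_closed]
  show ?thesis
    using Hom_sum[OF module_regular_A MM.module_tensor c[OF copairing_one_closed(1)]
        Hom_scale[OF module_regular_A MM.module_tensor c[OF copairing_one_closed(2)] \<tau>]]
    by (simp add: deformed_copairing_def extend_copairing_eq \<gamma> \<gamma>1 cong: restrict_cong)
qed

lemma deformed_copairing_one:
  "\<gamma>' \<one>\<^bsub>A\<^esub> = \<iota>2 (\<gamma> \<one>\<^bsub>K\<^esub>) \<oplus>\<^bsub>MM\<^esub> \<tau> \<odot>\<^bsub>MM\<^esub> \<iota>2 (\<gamma>1 \<one>\<^bsub>K\<^esub>)"
  using copairing_one_closed[THEN square_incl_closed] module.smult_one[OF MM.module_tensor]
  by (simp add: deformed_copairing_def extend_copairing_eq \<gamma> \<gamma>1)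

text \<open>On a pure tensor the pairing produces scalars j(\<beta>(v x)) and \<tau> j(\<beta>1(v
  x)); since \<open>\<iota>\<close> is linear along j, the factors from j move inside
  \<open>\<iota>\<close> and only \<tau> stays outside. Sums follow by additivity.\<close>

lemma contract_left_incl:
  assumes v: "v \<in> carrier V" and "z \<in> carrier VV"
  shows "contract_left A M \<beta>' (\<iota> v) (\<iota>2 z)
    = \<iota> (contract_left K V \<beta> v z) \<oplus>\<^bsub>M\<^esub> \<tau> \<odot>\<^bsub>M\<^esub> \<iota> (contract_left K V \<beta>1 v z)"
  using assms(2)
proof (induction z rule: VV.tensor_induct)
  case (tens x y)
  then show ?case
    using v \<tau> V.pairing_closed[OF \<beta>] V.pairing_closed[OF \<beta>1]
    by (simp add: square_incl_tens M.contract_left_tens[OF deformed_pairing_Hom] \<iota>_closed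
        V.contract_left_tens[OF \<beta>] V.contract_left_tens[OF \<beta>1] deformed_pairing_tens \<iota>_smult
        M.smult_l_distr M.smult_assoc1 j_rules)
next
  case (add z w)
  note c = bilinearD[OF V.contract_left_bilinear[OF \<beta>]] bilinearD[OF V.contract_left_bilinear[OF \<beta>1]]
    bilinearD(3)[OF M.contract_left_bilinear[OF deformed_pairing_Hom]]
  show ?case
    using add v \<tau>
    by (simp add: Hom_add[OF square_incl_Hom] square_incl_closed \<iota>_closed c \<iota>_add
        M.smult_r_distr M.M.add.m_ac)
qed

lemma contract_right_incl:
  assumes v: "v \<in> carrier V" and "z \<in> carrier VV"
  shows "contract_right A M \<beta>' (\<iota> v) (\<iota>2 z)
    = \<iota> (contract_right K V \<beta> v z) \<oplus>\<^bsub>M\<^esub> \<tau> \<odot>\<^bsub>M\<^esub> \<iota> (contract_right K V \<beta>1 v z)"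
  using assms(2)
proof (induction z rule: VV.tensor_induct)
  case (tens x y)
  then show ?case
    using v \<tau> V.pairing_closed[OF \<beta>] V.pairing_closed[OF \<beta>1]
    by (simp add: square_incl_tens M.contract_right_tens[OF deformed_pairing_Hom] \<iota>_closed
        V.contract_right_tens[OF \<beta>] V.contract_right_tens[OF \<beta>1] deformed_pairing_tens \<iota>_smult
        M.smult_l_distr M.smult_assoc1 j_rules)
next
  case (add z w)
  note c = bilinearD[OF V.contract_right_bilinear[OF \<beta>]] bilinearD[OF V.contract_right_bilinear[OF \<beta>1]]
    bilinearD(3)[OF M.contract_right_bilinear[OF deformed_pairing_Hom]]
  show ?case
    using add v \<tau>
    by (simp add: Hom_add[OF square_incl_Hom] square_incl_closed \<iota>_closed c \<iota>_add
        M.smult_r_distr M.M.add.m_ac)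
qed

lemma snake_left_deformed_Hom: "snake_left A M \<beta>' \<gamma>' \<in> Hom A M M"
  by (rule M.snake_left_Hom[OF deformed_pairing_Hom deformed_copairing_Hom])

lemma snake_right_deformed_Hom: "snake_right A M \<beta>' \<gamma>' \<in> Hom A M M"
  by (rule M.snake_right_Hom[OF deformed_pairing_Hom deformed_copairing_Hom])

text \<open>Inserting \<gamma>(1) + \<tau> \<gamma>1(1) into the contraction gives four terms. Those
  of \<beta> with \<gamma>1 and of \<beta>1 with \<gamma> carry one factor \<tau> and add up to the
  differential; the term of \<beta>1 with \<gamma>1 carries \<tau>^2.\<close>

lemma snake_left_deformed:
  assumes v: "v \<in> carrier V"
  shows "snake_left A M \<beta>' \<gamma>' (\<iota> v)
    = \<iota> (snake_left K V \<beta> \<gamma> v) \<oplus>\<^bsub>M\<^esub> \<tau> \<odot>\<^bsub>M\<^esub> \<iota> (d21 K V \<beta> \<gamma> \<beta>1 \<gamma>1 v)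
      \<oplus>\<^bsub>M\<^esub> (\<tau> \<otimes>\<^bsub>A\<^esub> \<tau>) \<odot>\<^bsub>M\<^esub> \<iota> (snake_left K V \<beta>1 \<gamma>1 v)"
proof -
  note b = bilinearD[OF M.contract_left_bilinear[OF deformed_pairing_Hom]]
  note c = bilinearD(1)[OF V.contract_left_bilinear[OF \<beta>] v] bilinearD(1)[OF V.contract_left_bilinear[OF \<beta>1] v]
  note closed = copairing_one_closed square_incl_closed \<iota>_closed
    module.smult_closed[OF MM.module_tensor]
  show ?thesis
    using v \<tau>
    by (simp add: M.snake_left_eq[OF deformed_pairing_Hom deformed_copairing_Hom] closed
        deformed_copairing_one b contract_left_incl c d21_def add_map_def \<iota>_add
        V.snake_left_eq \<beta> \<beta>1 \<gamma> \<gamma>1 M.smult_r_distr M.smult_assoc1 M.M.add.m_ac)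
qed

lemma snake_right_deformed:
  assumes v: "v \<in> carrier V"
  shows "snake_right A M \<beta>' \<gamma>' (\<iota> v)
    = \<iota> (snake_right K V \<beta> \<gamma> v) \<oplus>\<^bsub>M\<^esub> \<tau> \<odot>\<^bsub>M\<^esub> \<iota> (d22 K V \<beta> \<gamma> \<beta>1 \<gamma>1 v)
      \<oplus>\<^bsub>M\<^esub> (\<tau> \<otimes>\<^bsub>A\<^esub> \<tau>) \<odot>\<^bsub>M\<^esub> \<iota> (snake_right K V \<beta>1 \<gamma>1 v)"
proof -
  note b = bilinearD[OF M.contract_right_bilinear[OF deformed_pairing_Hom]]
  note c = bilinearD(1)[OF V.contract_right_bilinear[OF \<beta>] v] bilinearD(1)[OF V.contract_right_bilinear[OF \<beta>1] v]
  note closed = copairing_one_closed square_incl_closed \<iota>_closed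
    module.smult_closed[OF MM.module_tensor]
  show ?thesis
    using v \<tau>
    by (simp add: M.snake_right_eq[OF deformed_pairing_Hom deformed_copairing_Hom] closed
        deformed_copairing_one b contract_right_incl c d22_def add_map_def \<iota>_add
        V.snake_right_eq \<beta> \<beta>1 \<gamma> \<gamma>1 M.smult_r_distr M.smult_assoc1 M.M.add.m_ac)
qed

end


section \<open>The ring of power series\<close>

lemma power_series_sel [simp]:
  "carrier (power_series K) = {f. \<forall>n. f n \<in> carrier K}"
  "zero (power_series K) = (\<lambda>n. \<zero>\<^bsub>K\<^esub>)"
  "one (power_series K) = (\<lambda>n. if n = 0 then \<one>\<^bsub>K\<^esub> else \<zero>\<^bsub>K\<^esub>)"
  "add (power_series K) = (\<lambda>f g n. f n \<oplus>\<^bsub>K\<^esub> g n)"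
  "smult (power_series K) = (\<lambda>a f n. a \<otimes>\<^bsub>K\<^esub> f n)"
  by (simp_all add: power_series_def)

lemma power_series_mult:
  "(f \<otimes>\<^bsub>power_series K\<^esub> g) n = (\<Oplus>\<^bsub>K\<^esub>i\<in>{..n}. f i \<otimes>\<^bsub>K\<^esub> g (n - i))"
  by (simp add: power_series_def)

text \<open>Both products are the same convolution formula; the one of \<open>UP\<close> is
  restricted to polynomials, hence the hypotheses.\<close>

lemma UP_mult_eq:
  "\<lbrakk>p \<in> carrier (UP K); q \<in> carrier (UP K)\<rbrakk> \<Longrightarrow> p \<otimes>\<^bsub>UP K\<^esub> q = p \<otimes>\<^bsub>power_series K\<^esub> q"
  by (simp add: UP_def power_series_def)

lemma UP_add_eq:
  "\<lbrakk>p \<in> carrier (UP K); q \<in> carrier (UP K)\<rbrakk> \<Longrightarrow> p \<oplus>\<^bsub>UP K\<^esub> q = p \<oplus>\<^bsub>power_series K\<^esub> q"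
  by (simp add: UP_def)

lemma UP_one_eq: "\<one>\<^bsub>UP K\<^esub> = \<one>\<^bsub>power_series K\<^esub>"
  by (simp add: UP_def)

lemma UP_zero_eq: "\<zero>\<^bsub>UP K\<^esub> = \<zero>\<^bsub>power_series K\<^esub>"
  by (simp add: UP_def)

lemma UP_carrier_subset: "p \<in> carrier (UP K) \<Longrightarrow> p \<in> carrier (power_series K)"
  by (auto simp: UP_def)

context cring
begin

lemma UP_cring_R: "UP_cring R"
  by (simp add: UP_cring_def is_cring)

lemma power_series_mult_closed:
  "\<lbrakk>f \<in> carrier (power_series R); g \<in> carrier (power_series R)\<rbrakk> \<Longrightarrow>
    f \<otimes>\<^bsub>power_series R\<^esub> g \<in> carrier (power_series R)"
  by (simp add: power_series_mult Pi_def)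

text \<open>Coefficient n of a product involves only coefficients of index at most n.\<close>

lemma power_series_mult_cong:
  assumes "f' \<in> carrier (power_series R)" "g' \<in> carrier (power_series R)"
    and "\<And>i. i \<le> n \<Longrightarrow> f i = f' i" "\<And>i. i \<le> n \<Longrightarrow> g i = g' i"
  shows "(f \<otimes>\<^bsub>power_series R\<^esub> g) n = (f' \<otimes>\<^bsub>power_series R\<^esub> g') n"
  unfolding power_series_mult using assms by (intro finsum_cong') auto

text \<open>The cut-off is inclusive: \<open>truncate 1\<close> keeps degrees 0 and 1, giving the
  polynomial that represents a series modulo t^2.\<close>

definition truncate :: "nat \<Rightarrow> (nat \<Rightarrow> 'a) \<Rightarrow> nat \<Rightarrow> 'a" where
  "truncate n f = (\<lambda>i. if i \<le> n then f i else \<zero>)"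

lemma truncate_le: "i \<le> n \<Longrightarrow> truncate n f i = f i"
  by (simp add: truncate_def)

lemma truncate_closed: "f \<in> carrier (power_series R) \<Longrightarrow> truncate n f \<in> carrier (UP R)"
  by (auto simp: UP_def truncate_def intro!: mem_upI exI[of _ n])

lemma truncate_closed': "f \<in> carrier (power_series R) \<Longrightarrow> truncate n f \<in> carrier (power_series R)"
  by (rule UP_carrier_subset[OF truncate_closed])

lemma power_series_mult_truncate:
  assumes "f \<in> carrier (power_series R)" "g \<in> carrier (power_series R)" "i \<le> n"
  shows "(f \<otimes>\<^bsub>power_series R\<^esub> g) i = (truncate n f \<otimes>\<^bsub>UP R\<^esub> truncate n g) i"
  using assms
  by (subst UP_mult_eq[OF truncate_closed truncate_closed])
    (auto intro!: power_series_mult_cong truncate_closed'[simplified] simp: truncate_le)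

text \<open>
  Coefficients up to \<open>n\<close> only see truncations, so the ring laws are inherited from polynomials.
\<close>

lemma power_series_m_assoc:
  assumes f: "f \<in> carrier (power_series R)" and g: "g \<in> carrier (power_series R)"
    and h: "h \<in> carrier (power_series R)"
  shows "(f \<otimes>\<^bsub>power_series R\<^esub> g) \<otimes>\<^bsub>power_series R\<^esub> h
    = f \<otimes>\<^bsub>power_series R\<^esub> (g \<otimes>\<^bsub>power_series R\<^esub> h)"
proof
  fix n
  interpret P: UP_cring R "UP R" by (rule UP_cring_R)
  let ?T = "truncate n"
  note t = truncate_closed[OF f] truncate_closed[OF g] truncate_closed[OF h]
  note [intro] = UP_carrier_subset
  \<comment> \<open>The product of two truncations may have degree beyond n, but it agrees with the
    product of the series through degree n, which is all that coefficient n sees.\<close>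
  have "((f \<otimes>\<^bsub>power_series R\<^esub> g) \<otimes>\<^bsub>power_series R\<^esub> h) n
      = ((?T f \<otimes>\<^bsub>UP R\<^esub> ?T g) \<otimes>\<^bsub>power_series R\<^esub> ?T h) n"
    by (rule power_series_mult_cong[OF UP_carrier_subset UP_carrier_subset])
      (simp_all only: P.UP_mult_closed t power_series_mult_truncate[OF f g] truncate_le)
  also have "\<dots> = (?T f \<otimes>\<^bsub>power_series R\<^esub> (?T g \<otimes>\<^bsub>UP R\<^esub> ?T h)) n"
    using P.UP_m_assoc[OF t] by (simp only: UP_mult_eq[symmetric] P.UP_mult_closed t)
  also have "\<dots> = (f \<otimes>\<^bsub>power_series R\<^esub> (g \<otimes>\<^bsub>power_series R\<^esub> h)) n"
    by (rule power_series_mult_cong[symmetric, OF UP_carrier_subset UP_carrier_subset])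
      (simp_all only: P.UP_mult_closed t power_series_mult_truncate[OF g h] truncate_le)
  finally show "((f \<otimes>\<^bsub>power_series R\<^esub> g) \<otimes>\<^bsub>power_series R\<^esub> h) n
    = (f \<otimes>\<^bsub>power_series R\<^esub> (g \<otimes>\<^bsub>power_series R\<^esub> h)) n" .
qed

lemma power_series_m_comm:
  assumes f: "f \<in> carrier (power_series R)" and g: "g \<in> carrier (power_series R)"
  shows "f \<otimes>\<^bsub>power_series R\<^esub> g = g \<otimes>\<^bsub>power_series R\<^esub> f"
proof
  fix n
  interpret P: UP_cring R "UP R" by (rule UP_cring_R)
  show "(f \<otimes>\<^bsub>power_series R\<^esub> g) n = (g \<otimes>\<^bsub>power_series R\<^esub> f) n"
    unfolding power_series_mult_truncate[OF f g order_refl] power_series_mult_truncate[OF g f order_refl]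
    using P.UP_m_comm[OF truncate_closed[OF f] truncate_closed[OF g]] by simp
qed

lemma monom_mult:
  assumes "a \<in> carrier R" "f \<in> carrier (power_series R)"
  shows "((\<lambda>i. if i = m then a else \<zero>) \<otimes>\<^bsub>power_series R\<^esub> f) n
    = (if m \<le> n then a \<otimes> f (n - m) else \<zero>)"
proof -
  \<comment> \<open>At most one summand survives, at i = m, and it occurs only when m does not
    exceed n.\<close>
  have "((\<lambda>i. if i = m then a else \<zero>) \<otimes>\<^bsub>power_series R\<^esub> f) n
      = (\<Oplus>i\<in>{..n}. if m = i then a \<otimes> f (n - i) else \<zero>)"
    unfolding power_series_mult using assms by (intro finsum_cong') auto
  also have "\<dots> = (if m \<le> n then a \<otimes> f (n - m) else \<zero>)"
  proof (cases "m \<le> n")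
    case True
    then show ?thesis
      using assms by (subst finsum_singleton) auto
  next
    case False
    then have "(\<Oplus>i\<in>{..n}. if m = i then a \<otimes> f (n - i) else \<zero>) = (\<Oplus>i\<in>{..n}. \<zero>)"
      by (intro finsum_cong') auto
    then show ?thesis using False by simp
  qed
  finally show ?thesis .
qed

lemma abelian_group_power_series: "abelian_group (power_series R)"
proof (rule abelian_groupI)
  fix f assume "f \<in> carrier (power_series R)"
  then show "\<exists>g\<in>carrier (power_series R). g \<oplus>\<^bsub>power_series R\<^esub> f = \<zero>\<^bsub>power_series R\<^esub>"
    by (intro bexI[of _ "\<lambda>n. \<ominus> f n"]) (auto simp: l_neg)
qed (auto simp: a_ac)

lemma module_power_series: "module R (power_series R)"
  by (rule moduleI[OF is_cring abelian_group_power_series])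
    (auto simp: l_distr r_distr m_assoc)

lemma cring_power_series: "cring (power_series R)"
proof (rule cringI[OF abelian_group_power_series])
  show "Group.comm_monoid (power_series R)"
  proof (rule comm_monoidI)
    fix f assume f: "f \<in> carrier (power_series R)"
    then show "\<one>\<^bsub>power_series R\<^esub> \<otimes>\<^bsub>power_series R\<^esub> f = f"
      by (auto simp: monom_mult)
  qed (fact power_series_mult_closed power_series_m_assoc power_series_m_comm | simp)+
  show "(f \<oplus>\<^bsub>power_series R\<^esub> g) \<otimes>\<^bsub>power_series R\<^esub> h
      = f \<otimes>\<^bsub>power_series R\<^esub> h \<oplus>\<^bsub>power_series R\<^esub> g \<otimes>\<^bsub>power_series R\<^esub> h"
    if "f \<in> carrier (power_series R)" "g \<in> carrier (power_series R)" "h \<in> carrier (power_series R)"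
    for f g h
  proof
    fix n
    have "((f \<oplus>\<^bsub>power_series R\<^esub> g) \<otimes>\<^bsub>power_series R\<^esub> h) n
        = (\<Oplus>i\<in>{..n}. f i \<otimes> h (n - i) \<oplus> g i \<otimes> h (n - i))"
      unfolding power_series_mult using that by (intro finsum_cong') (auto simp: l_distr)
    also have "\<dots> = (f \<otimes>\<^bsub>power_series R\<^esub> h \<oplus>\<^bsub>power_series R\<^esub> g \<otimes>\<^bsub>power_series R\<^esub> h) n"
      using that by (simp add: power_series_mult Pi_def finsum_addf)
    finally show "((f \<oplus>\<^bsub>power_series R\<^esub> g) \<otimes>\<^bsub>power_series R\<^esub> h) n
      = (f \<otimes>\<^bsub>power_series R\<^esub> h \<oplus>\<^bsub>power_series R\<^esub> g \<otimes>\<^bsub>power_series R\<^esub> h) n" .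
  qed
qed

lemma const_poly_eq: "a \<in> carrier R \<Longrightarrow> const_poly R a = (\<lambda>i. if i = 0 then a else \<zero>)"
  by (simp add: const_poly_def UP_def)

lemma t_pow_eq: "t_pow R n = (\<lambda>i. if i = n then \<one> else \<zero>)"
  by (simp add: t_pow_def UP_def)

lemma t_pow_UP_closed: "t_pow R n \<in> carrier (UP R)"
proof -
  interpret P: UP_cring R "UP R" by (rule UP_cring_R)
  show ?thesis unfolding t_pow_def by simp
qed

lemma const_poly_UP_closed: "a \<in> carrier R \<Longrightarrow> const_poly R a \<in> carrier (UP R)"
proof -
  interpret P: UP_cring R "UP R" by (rule UP_cring_R)
  show "a \<in> carrier R \<Longrightarrow> ?thesis" unfolding const_poly_def by simp
qed

lemma t_pow_closed: "t_pow R n \<in> carrier (power_series R)"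
  by (rule UP_carrier_subset[OF t_pow_UP_closed])

lemma const_poly_closed: "a \<in> carrier R \<Longrightarrow> const_poly R a \<in> carrier (power_series R)"
  by (rule UP_carrier_subset[OF const_poly_UP_closed])

lemma t_pow_mult:
  "f \<in> carrier (power_series R) \<Longrightarrow>
    (t_pow R m \<otimes>\<^bsub>power_series R\<^esub> f) n = (if m \<le> n then f (n - m) else \<zero>)"
  by (auto simp: t_pow_eq monom_mult)

lemma const_poly_mult:
  "\<lbrakk>a \<in> carrier R; f \<in> carrier (power_series R)\<rbrakk> \<Longrightarrow>
    const_poly R a \<otimes>\<^bsub>power_series R\<^esub> f = a \<odot>\<^bsub>power_series R\<^esub> f"
  by (auto simp: const_poly_eq monom_mult)

lemma t_pow_mult_t_pow: "t_pow R m \<otimes>\<^bsub>power_series R\<^esub> t_pow R n = t_pow R (m + n)"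
  by (rule ext, subst t_pow_mult[OF t_pow_closed]) (auto simp: t_pow_eq)

text \<open>Divisibility by t^2 with an explicit quotient, the series shifted down by two
  places.\<close>

lemma t_pow_two_mult_shift:
  assumes "f \<in> carrier (power_series R)" "f 0 = \<zero>" "f 1 = \<zero>"
  shows "t_pow R 2 \<otimes>\<^bsub>power_series R\<^esub> (\<lambda>i. f (i + 2)) = f"
proof
  fix n :: nat
  consider "n = 0" | "n = 1" | k where "n = k + 2"
    by (metis One_nat_def add_2_eq_Suc' not0_implies_Suc)
  then show "(t_pow R 2 \<otimes>\<^bsub>power_series R\<^esub> (\<lambda>i. f (i + 2))) n = f n"
    by cases (use assms in \<open>simp_all add: t_pow_mult\<close>)
qed

lemma const_poly_ring_hom: "const_poly R \<in> ring_hom R (power_series R)"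
  by (rule ring_hom_memI) (auto simp: const_poly_closed[simplified] const_poly_mult, auto simp: const_poly_eq)

end


text \<open>From here on K[[t]] enters through its ring and module laws; coefficients are exposed
  only on demand.\<close>

declare power_series_sel [simp del]


section \<open>Extension of scalars to power series\<close>

lemma Vt_sel [simp]:
  "carrier (Vt K V) = carrier (tensor K V (power_series K))"
  "zero (Vt K V) = zero (tensor K V (power_series K))"
  "add (Vt K V) = add (tensor K V (power_series K))"
  "a_minus (Vt K V) = a_minus (tensor K V (power_series K))"
  by (simp_all add: Vt_def)

context module
begin

abbreviation PS where "PS \<equiv> power_series R"

lemma two_modules_PS: "two_modules R M PS"
  by (intro two_modules.intro module_axioms R.module_power_series)

interpretation T: two_modules R M PS by (rule two_modules_PS)
interpretation PS: cring PS by (rule R.cring_power_series)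

lemma PS_mult_Hom:
  assumes "p \<in> carrier PS"
  shows "(\<lambda>q\<in>carrier PS. p \<otimes>\<^bsub>PS\<^esub> q) \<in> Hom R PS PS"
proof (rule Hom_restrictI[OF R.module_power_series])
  fix a f assume a: "a \<in> carrier R" "f \<in> carrier PS"
  \<comment> \<open>The scalar a acts as multiplication by a constant series, so linearity over K is
    commutativity of K[[t]].\<close>
  have "p \<otimes>\<^bsub>PS\<^esub> (const_poly R a \<otimes>\<^bsub>PS\<^esub> f) = const_poly R a \<otimes>\<^bsub>PS\<^esub> (p \<otimes>\<^bsub>PS\<^esub> f)"
    using assms a R.const_poly_closed by (intro PS.m_lcomm)
  then show "p \<otimes>\<^bsub>PS\<^esub> (a \<odot>\<^bsub>PS\<^esub> f) = a \<odot>\<^bsub>PS\<^esub> (p \<otimes>\<^bsub>PS\<^esub> f)"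
    using a assms R.const_poly_mult PS.m_closed by simp
qed (use assms PS.r_distr PS.m_closed in simp_all)


lemma Vt_smult_Hom:
  "p \<in> carrier PS \<Longrightarrow> (\<lambda>x. p \<odot>\<^bsub>Vt R M\<^esub> x) \<in> Hom R (tensor R M PS) (tensor R M PS)"
  unfolding Vt_def
  using tensor_map_Hom[OF two_modules_PS two_modules_PS Hom_id_map[OF module_axioms] PS_mult_Hom]
  by simp

lemma Vt_smult_tens:
  "\<lbrakk>p \<in> carrier PS; v \<in> carrier M; q \<in> carrier PS\<rbrakk> \<Longrightarrow>
    p \<odot>\<^bsub>Vt R M\<^esub> tens R M PS v q = tens R M PS v (p \<otimes>\<^bsub>PS\<^esub> q)"
  unfolding Vt_def
  by (simp add: tensor_map_tens[OF two_modules_PS two_modules_PS Hom_id_map[OF module_axioms] PS_mult_Hom]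
      id_map_apply)

text \<open>Additivity in x holds because each p acts by a K-linear map. The laws relating different
  scalars hold on pure tensors by the ring laws of K[[t]] and extend to sums.\<close>

lemma module_Vt: "module PS (Vt R M)"
proof (rule moduleI[OF R.cring_power_series])
  interpret VT: module R "tensor R M PS" by (rule T.module_tensor)
  show "abelian_group (Vt R M)"
    using VT.abelian_group_axioms by (simp add: Vt_def)
  note hom = Hom_closed[OF Vt_smult_Hom] Hom_add[OF Vt_smult_Hom]
  show "p \<odot>\<^bsub>Vt R M\<^esub> x \<in> carrier (Vt R M)" if "p \<in> carrier PS" "x \<in> carrier (Vt R M)" for p x
    using that Hom_closed[OF Vt_smult_Hom] by simp
  show "p \<odot>\<^bsub>Vt R M\<^esub> (x \<oplus>\<^bsub>Vt R M\<^esub> y) = p \<odot>\<^bsub>Vt R M\<^esub> x \<oplus>\<^bsub>Vt R M\<^esub> p \<odot>\<^bsub>Vt R M\<^esub> y"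
    if "p \<in> carrier PS" "x \<in> carrier (Vt R M)" "y \<in> carrier (Vt R M)" for p x y
    using that Hom_add[OF Vt_smult_Hom] by simp
  note rules = Vt_smult_tens PS.l_distr PS.m_assoc PS.m_closed T.N.M.add.m_closed T.tens_add_right
    Hom_closed[OF Vt_smult_Hom] Hom_add[OF Vt_smult_Hom] VT.M.add.m_ac
  show "(p \<oplus>\<^bsub>PS\<^esub> q) \<odot>\<^bsub>Vt R M\<^esub> x = p \<odot>\<^bsub>Vt R M\<^esub> x \<oplus>\<^bsub>Vt R M\<^esub> q \<odot>\<^bsub>Vt R M\<^esub> x"
    if p: "p \<in> carrier PS" "q \<in> carrier PS" and x: "x \<in> carrier (Vt R M)" for p q x
    using x[unfolded Vt_sel]
    by (induction x rule: T.tensor_induct) (use p in \<open>simp_all add: rules\<close>)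
  show "(p \<otimes>\<^bsub>PS\<^esub> q) \<odot>\<^bsub>Vt R M\<^esub> x = p \<odot>\<^bsub>Vt R M\<^esub> (q \<odot>\<^bsub>Vt R M\<^esub> x)"
    if p: "p \<in> carrier PS" "q \<in> carrier PS" and x: "x \<in> carrier (Vt R M)" for p q x
    using x[unfolded Vt_sel]
    by (induction x rule: T.tensor_induct) (use p in \<open>simp_all add: rules\<close>)
  show "\<one>\<^bsub>PS\<^esub> \<odot>\<^bsub>Vt R M\<^esub> x = x" if x: "x \<in> carrier (Vt R M)" for x
    using x[unfolded Vt_sel]
    by (induction x rule: T.tensor_induct) (simp_all add: rules)
qed

abbreviation \<iota> where "\<iota> \<equiv> Vt_incl R M"

lemma Vt_incl_closed: "v \<in> carrier M \<Longrightarrow> \<iota> v \<in> carrier (Vt R M)"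
  by (simp add: Vt_incl_def T.tens_closed)

lemma Vt_incl_add:
  "\<lbrakk>v \<in> carrier M; w \<in> carrier M\<rbrakk> \<Longrightarrow> \<iota> (v \<oplus>\<^bsub>M\<^esub> w) = \<iota> v \<oplus>\<^bsub>Vt R M\<^esub> \<iota> w"
  by (simp add: Vt_incl_def T.tens_add_left)

text \<open>This is why \<open>\<iota>\<close> V generates V_t over K[[t]].\<close>

lemma tens_eq_smult_Vt_incl:
  "\<lbrakk>v \<in> carrier M; p \<in> carrier PS\<rbrakk> \<Longrightarrow> tens R M PS v p = p \<odot>\<^bsub>Vt R M\<^esub> \<iota> v"
  by (simp add: Vt_incl_def Vt_smult_tens)

lemma Vt_incl_smult:
  assumes "a \<in> carrier R" "v \<in> carrier M"
  shows "\<iota> (a \<odot>\<^bsub>M\<^esub> v) = const_poly R a \<odot>\<^bsub>Vt R M\<^esub> \<iota> v"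
proof -
  have "\<iota> (a \<odot>\<^bsub>M\<^esub> v) = tens R M PS v (a \<odot>\<^bsub>PS\<^esub> \<one>\<^bsub>PS\<^esub>)"
    unfolding Vt_incl_def using assms PS.one_closed
    by (simp only: T.tens_smult_left T.tens_smult_right)
  also have "a \<odot>\<^bsub>PS\<^esub> \<one>\<^bsub>PS\<^esub> = const_poly R a"
    using assms by (auto simp: R.const_poly_eq power_series_sel)
  finally show ?thesis
    using assms tens_eq_smult_Vt_incl R.const_poly_closed by simp
qed

lemma Vt_span:
  assumes H: "submodule H PS (Vt R M)" and "\<iota> ` carrier M \<subseteq> H"
  shows "carrier (Vt R M) \<subseteq> H"
proof
  interpret VT: module PS "Vt R M" by (rule module_Vt)
  fix x assume "x \<in> carrier (Vt R M)"
  then have "x \<in> carrier (tensor R M PS)" by simp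
  then show "x \<in> H"
  proof (induction x rule: T.tensor_induct)
    case (tens v p)
    then show ?case
      using assms(2) VT.submoduleE(4)[OF H] by (auto simp: tens_eq_smult_Vt_incl)
  next
    case (add x y)
    then show ?case using VT.submoduleE(5)[OF H] by simp
  qed
qed

text \<open>The extension is v tensor p |-> p f(v). The tensor product over K yields only a K-linear
  map; linearity over K[[t]] is checked on pure tensors. N is arbitrary because besides K[[t]]
  itself the targets V_t and K[t]/(t^2) occur.\<close>

lemma Vt_extension:
  assumes N: "module PS N" and f: "f \<in> Hom R M (restrict_scalars (const_poly R) N)"
  shows "\<exists>g\<in>Hom PS (Vt R M) N. \<forall>v\<in>carrier M. g (\<iota> v) = f v"
proof -
  interpret N: module PS N by (rule N)
  interpret VT: module PS "Vt R M" by (rule module_Vt)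
  let ?N = "restrict_scalars (const_poly R) N"
  note N' = module_restrict_scalars[OF R.is_cring R.const_poly_ring_hom N]
  note f_rules = Hom_closed[OF f, simplified] Hom_add[OF f, simplified] Hom_smult[OF f, simplified]
  have smult: "p \<odot>\<^bsub>N\<^esub> (const_poly R a \<odot>\<^bsub>N\<^esub> n) = const_poly R a \<odot>\<^bsub>N\<^esub> (p \<odot>\<^bsub>N\<^esub> n)"
    if "p \<in> carrier PS" "a \<in> carrier R" "n \<in> carrier N" for p a n
    using that R.const_poly_closed by (simp add: N.smult_assoc1[symmetric] PS.m_comm)
  have b: "bilinear R M PS ?N (\<lambda>v p. p \<odot>\<^bsub>N\<^esub> f v)"
    by (rule bilinearI)
      (simp_all add: f_rules N.smult_l_distr N.smult_r_distr smult R.const_poly_mult[symmetric]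
        N.smult_assoc1 R.const_poly_closed)
  let ?g = "tensor_lift R M PS ?N (\<lambda>v p. p \<odot>\<^bsub>N\<^esub> f v)"
  note g = T.tensor_lift_Hom[OF N' b] and gt = T.tensor_lift_tens[OF N' b]
  note g_rules = Hom_closed[OF g, simplified] Hom_add[OF g, simplified]
  have "?g \<in> Hom PS (Vt R M) N"
  proof (rule HomI)
    fix p x assume p: "p \<in> carrier PS" and "x \<in> carrier (Vt R M)"
    then have "x \<in> carrier (tensor R M PS)" by simp
    then show "?g (p \<odot>\<^bsub>Vt R M\<^esub> x) = p \<odot>\<^bsub>N\<^esub> ?g x"
    proof (induction x rule: T.tensor_induct)
      case (tens v q)
      then show ?case using p by (simp add: Vt_smult_tens gt PS.m_closed N.smult_assoc1 f_rules)
    next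
      case (add x y)
      then show ?case
        using p VT.smult_closed VT.smult_r_distr[of p x y] by (simp add: g_rules N.smult_r_distr)
    qed
  next
    show "?g \<in> extensional (carrier (Vt R M))" using Hom_extensional[OF g] by simp
  qed (simp_all add: g_rules)
  moreover have "?g (\<iota> v) = f v" if "v \<in> carrier M" for v
    using that by (simp add: Vt_incl_def gt f_rules)
  ultimately show ?thesis by blast
qed

lemma base_change_Vt: "base_change R M PS (Vt R M) (const_poly R) \<iota>"
  by (intro base_change.intro base_change_axioms.intro module_axioms module_Vt R.const_poly_ring_hom
      Vt_incl_closed Vt_incl_add Vt_incl_smult Vt_span Vt_extension module_regular_module
      R.cring_power_series)

text \<open>Existence is \<open>Vt_extension\<close> applied to v |-> \<open>\<iota>\<close> (\<xi>
  v); uniqueness comes from generation by \<open>\<iota>\<close> V.\<close>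

lemma extend_endo:
  assumes \<xi>: "\<xi> \<in> Hom R M M"
  shows extend_endo_Hom: "extend_endo R M \<xi> \<in> Hom PS (Vt R M) (Vt R M)"
    and extend_endo_incl: "v \<in> carrier M \<Longrightarrow> extend_endo R M \<xi> (\<iota> v) = \<iota> (\<xi> v)"
proof -
  interpret B: base_change R M PS "Vt R M" "const_poly R" \<iota> by (rule base_change_Vt)
  have "(\<lambda>v\<in>carrier M. \<iota> (\<xi> v)) \<in> Hom R M (restrict_scalars (const_poly R) (Vt R M))"
    by (rule Hom_restrictI[OF module_axioms])
      (simp_all add: Hom_closed[OF \<xi>] Hom_add[OF \<xi>] Hom_smult[OF \<xi>] Vt_incl_add Vt_incl_smult
        Vt_incl_closed[simplified])
  from Vt_extension[OF module_Vt this]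
  obtain g where g: "g \<in> Hom PS (Vt R M) (Vt R M)" "\<And>v. v \<in> carrier M \<Longrightarrow> g (\<iota> v) = \<iota> (\<xi> v)"
    by auto
  have "extend_endo R M \<xi> = g"
    unfolding extend_endo_def
  proof (rule linear_extension_eq)
    show "h = g" if "h \<in> Hom PS (Vt R M) (Vt R M)" "\<And>v. v \<in> carrier M \<Longrightarrow> h (\<iota> v) = g (\<iota> v)" for h
      using that by (rule B.Hom_eq_on_V[OF module_Vt _ g(1)])
  qed (fact g)+
  then show "extend_endo R M \<xi> \<in> Hom PS (Vt R M) (Vt R M)"
    and "v \<in> carrier M \<Longrightarrow> extend_endo R M \<xi> (\<iota> v) = \<iota> (\<xi> v)"
    using g by simp_all
qed


section \<open>Congruence modulo \<open>t\<^sup>2\<close>\<close>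

lemma submodule_t2Vt: "submodule (t2Vt R M) PS (Vt R M)"
proof -
  interpret VT: module PS "Vt R M" by (rule module_Vt)
  note t = R.t_pow_closed[of 2]
  note [simp del] = Vt_sel
  show ?thesis
    unfolding t2Vt_def
  proof (rule VT.submoduleI)
    show "\<zero>\<^bsub>Vt R M\<^esub> \<in> (\<odot>\<^bsub>Vt R M\<^esub>) (t_pow R 2) ` carrier (Vt R M)"
      using VT.smult_r_null[OF t] VT.M.zero_closed by (metis imageI)
    fix x y assume "x \<in> (\<odot>\<^bsub>Vt R M\<^esub>) (t_pow R 2) ` carrier (Vt R M)"
    then obtain x' where x: "x' \<in> carrier (Vt R M)" "x = t_pow R 2 \<odot>\<^bsub>Vt R M\<^esub> x'" by blast
    show "\<ominus>\<^bsub>Vt R M\<^esub> x \<in> (\<odot>\<^bsub>Vt R M\<^esub>) (t_pow R 2) ` carrier (Vt R M)"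
      using x VT.smult_r_minus[OF t x(1)] VT.M.a_inv_closed[OF x(1)] by (metis imageI)
    show "p \<odot>\<^bsub>Vt R M\<^esub> x \<in> (\<odot>\<^bsub>Vt R M\<^esub>) (t_pow R 2) ` carrier (Vt R M)" if p: "p \<in> carrier PS" for p
    proof -
      have "p \<odot>\<^bsub>Vt R M\<^esub> x = t_pow R 2 \<odot>\<^bsub>Vt R M\<^esub> (p \<odot>\<^bsub>Vt R M\<^esub> x')"
        using p x t by (simp add: VT.smult_assoc1[symmetric] PS.m_comm)
      then show ?thesis using p x by simp
    qed
    assume "y \<in> (\<odot>\<^bsub>Vt R M\<^esub>) (t_pow R 2) ` carrier (Vt R M)"
    then obtain y' where y: "y' \<in> carrier (Vt R M)" "y = t_pow R 2 \<odot>\<^bsub>Vt R M\<^esub> y'" by blast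
    show "x \<oplus>\<^bsub>Vt R M\<^esub> y \<in> (\<odot>\<^bsub>Vt R M\<^esub>) (t_pow R 2) ` carrier (Vt R M)"
      using x y VT.smult_r_distr[OF t x(1) y(1)] VT.M.a_closed[OF x(1) y(1)] by (metis imageI)
  qed (use t in auto)
qed

text \<open>The coefficient of \<open>t\<close>, as a map \<open>V\<^sub>t \<rightarrow> V\<close>, detects the linear term.\<close>

lemma linear_term_mem_t2Vt_iff:
  assumes a: "a \<in> carrier M" and b: "b \<in> carrier M"
  shows "t_pow R 1 \<odot>\<^bsub>Vt R M\<^esub> \<iota> a \<oplus>\<^bsub>Vt R M\<^esub> t_pow R 2 \<odot>\<^bsub>Vt R M\<^esub> \<iota> b \<in> t2Vt R M \<longleftrightarrow> a = \<zero>\<^bsub>M\<^esub>"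
proof -
  interpret VT: module PS "Vt R M" by (rule module_Vt)
  note t = R.t_pow_closed
  \<comment> \<open>Reading off the coefficient of t is bilinear over K in v and p, so it descends
    to V tensor K[[t]] without any choice of basis.\<close>
  have bil: "bilinear R M PS M (\<lambda>v p. p (Suc 0) \<odot>\<^bsub>M\<^esub> v)"
    by (rule bilinearI)
      (simp_all add: power_series_sel smult_l_distr smult_r_distr smult_assoc1[symmetric] R.m_comm)
  let ?c = "tensor_lift R M PS M (\<lambda>v p. p (Suc 0) \<odot>\<^bsub>M\<^esub> v)"
  note c = T.tensor_lift_Hom[OF module_axioms bil] and ct = T.tensor_lift_tens[OF module_axioms bil]
  \<comment> \<open>Multiplication by t^2 leaves no term of degree 1, so the coefficient map
    vanishes on t^2 V_t.\<close>
  have c2: "?c (t_pow R 2 \<odot>\<^bsub>Vt R M\<^esub> x) = \<zero>\<^bsub>M\<^esub>" if "x \<in> carrier (Vt R M)" for x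
    using that[unfolded Vt_sel]
  proof (induction x rule: T.tensor_induct)
    case (tens v p)
    then show ?case using t by (simp add: Vt_smult_tens ct PS.m_closed R.t_pow_mult)
  next
    case (add x y)
    then show ?case
      using Hom_add[OF Vt_smult_Hom[OF t]] Hom_closed[OF Vt_smult_Hom[OF t]] Hom_add[OF c] by simp
  qed
  have c1: "?c (t_pow R 1 \<odot>\<^bsub>Vt R M\<^esub> \<iota> a) = a"
    using a t by (simp add: Vt_incl_def Vt_smult_tens ct PS.m_closed R.t_pow_mult)
      (simp add: R.t_pow_eq)
  have closed: "t_pow R n \<odot>\<^bsub>Vt R M\<^esub> \<iota> v \<in> carrier (tensor R M PS)" if "v \<in> carrier M" for n v
    using VT.smult_closed[OF t Vt_incl_closed[OF that]] by simp
  show ?thesis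
  proof
    assume "t_pow R 1 \<odot>\<^bsub>Vt R M\<^esub> \<iota> a \<oplus>\<^bsub>Vt R M\<^esub> t_pow R 2 \<odot>\<^bsub>Vt R M\<^esub> \<iota> b \<in> t2Vt R M"
    then have "?c (t_pow R 1 \<odot>\<^bsub>Vt R M\<^esub> \<iota> a \<oplus>\<^bsub>Vt R M\<^esub> t_pow R 2 \<odot>\<^bsub>Vt R M\<^esub> \<iota> b) = \<zero>\<^bsub>M\<^esub>"
      using c2 unfolding t2Vt_def by auto
    then show "a = \<zero>\<^bsub>M\<^esub>"
      using Hom_add[OF c closed[OF a] closed[OF b]] c1 c2[OF Vt_incl_closed[OF b]] a by simp
  next
    assume "a = \<zero>\<^bsub>M\<^esub>"
    moreover have "\<iota> \<zero>\<^bsub>M\<^esub> = \<zero>\<^bsub>Vt R M\<^esub>"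
      using Vt_incl_add[of "\<zero>\<^bsub>M\<^esub>" "\<zero>\<^bsub>M\<^esub>"] Vt_incl_closed[of "\<zero>\<^bsub>M\<^esub>"]
      by (metis M.zero_closed M.l_zero VT.M.add.r_cancel_one')
    ultimately have "t_pow R 1 \<odot>\<^bsub>Vt R M\<^esub> \<iota> a = \<zero>\<^bsub>Vt R M\<^esub>"
      using VT.smult_r_null[OF t] by simp
    then show "t_pow R 1 \<odot>\<^bsub>Vt R M\<^esub> \<iota> a \<oplus>\<^bsub>Vt R M\<^esub> t_pow R 2 \<odot>\<^bsub>Vt R M\<^esub> \<iota> b \<in> t2Vt R M"
      unfolding t2Vt_def
      using VT.M.l_zero[OF VT.smult_closed[OF t Vt_incl_closed[OF b]]] Vt_incl_closed[OF b] by auto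
  qed
qed

end


context module
begin

text \<open>The points where f and g are congruent form the preimage of t^2 V_t under f - g, a
  submodule; containing \<open>\<iota>\<close> V makes it everything.\<close>

lemma cong_mod_t2_iff:
  assumes f: "f \<in> Hom PS (Vt R M) (Vt R M)" and g: "g \<in> Hom PS (Vt R M) (Vt R M)"
  shows "cong_mod_t2 R M f g \<longleftrightarrow> (\<forall>v\<in>carrier M. f (\<iota> v) \<ominus>\<^bsub>Vt R M\<^esub> g (\<iota> v) \<in> t2Vt R M)"
proof
  assume "cong_mod_t2 R M f g"
  then show "\<forall>v\<in>carrier M. f (\<iota> v) \<ominus>\<^bsub>Vt R M\<^esub> g (\<iota> v) \<in> t2Vt R M"
    unfolding cong_mod_t2_def using Vt_incl_closed by blast
next
  assume *: "\<forall>v\<in>carrier M. f (\<iota> v) \<ominus>\<^bsub>Vt R M\<^esub> g (\<iota> v) \<in> t2Vt R M"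
  have "carrier (Vt R M) \<subseteq> {x \<in> carrier (Vt R M).
      restrict (\<lambda>x. f x \<ominus>\<^bsub>Vt R M\<^esub> g x) (carrier (Vt R M)) x \<in> t2Vt R M}"
    by (rule Vt_span[OF submodule_vimage[OF Hom_diff[OF module_Vt module_Vt f g] module_Vt module_Vt
          submodule_t2Vt]]) (use * Vt_incl_closed in auto)
  then show "cong_mod_t2 R M f g"
    unfolding cong_mod_t2_def by auto
qed

text \<open>The functions in \<open>primary_obstruction\<close> are plain lambda terms and need not
  be extensional; restricting them brings them into \<open>Hom\<close>, where
  \<open>cong_mod_t2_iff\<close> applies.\<close>

lemma cong_mod_t2_restrict:
  "cong_mod_t2 R M f g \<longleftrightarrow>
    cong_mod_t2 R M (restrict f (carrier (Vt R M))) (restrict g (carrier (Vt R M)))"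
  unfolding cong_mod_t2_def by auto

text \<open>Stated for an abstract S, so that both snake maps are instances. On
  \<open>\<iota>\<close> V the congruence says that t (d v - \<xi> v) + t^2 s v lies in t^2 V_t,
  which \<open>linear_term_mem_t2Vt_iff\<close> turns into d v = \<xi> v; comparison with the
  identity is the case without \<xi>.\<close>

lemma
  assumes S: "S \<in> Hom PS (Vt R M) (Vt R M)"
    and d: "d \<in> Hom R M M" and s: "\<And>v. v \<in> carrier M \<Longrightarrow> s v \<in> carrier M"
    and S_incl: "\<And>v. v \<in> carrier M \<Longrightarrow> S (\<iota> v) = \<iota> v \<oplus>\<^bsub>Vt R M\<^esub> t_pow R 1 \<odot>\<^bsub>Vt R M\<^esub> \<iota> (d v)
      \<oplus>\<^bsub>Vt R M\<^esub> t_pow R 2 \<odot>\<^bsub>Vt R M\<^esub> \<iota> (s v)"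
  shows cong_linear_term_iff: "\<xi> \<in> Hom R M M \<Longrightarrow>
      cong_mod_t2 R M (\<lambda>x. S x \<ominus>\<^bsub>Vt R M\<^esub> x) (\<lambda>x. t_pow R 1 \<odot>\<^bsub>Vt R M\<^esub> extend_endo R M \<xi> x)
        \<longleftrightarrow> \<xi> = d"
    and cong_id_iff: "cong_mod_t2 R M S (id_map (Vt R M)) \<longleftrightarrow> d = zero_map M M"
proof -
  interpret VT: module PS "Vt R M" by (rule module_Vt)
  note [simp del] = Vt_sel
  note t = R.t_pow_closed
  note [simp] = Vt_incl_closed VT.smult_closed[OF t] s Hom_closed[OF d]
  have id: "id_map (Vt R M) \<in> Hom PS (Vt R M) (Vt R M)"
    by (rule Hom_id_map[OF module_Vt])
  have \<iota>_minus: "\<iota> (v \<ominus>\<^bsub>M\<^esub> w) = \<iota> v \<ominus>\<^bsub>Vt R M\<^esub> \<iota> w" if "v \<in> carrier M" "w \<in> carrier M" for v w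
  proof -
    have "\<iota> (v \<ominus>\<^bsub>M\<^esub> w) \<oplus>\<^bsub>Vt R M\<^esub> \<iota> w = \<iota> v"
      using that by (simp add: Vt_incl_add[symmetric] a_minus_def M.a_assoc M.l_neg)
    then show ?thesis
      using that by (metis M.minus_closed VT.M.add.inv_solve_right Vt_incl_closed a_minus_def)
  qed
  have *: "(\<iota> v \<oplus>\<^bsub>Vt R M\<^esub> x \<oplus>\<^bsub>Vt R M\<^esub> y) \<ominus>\<^bsub>Vt R M\<^esub> \<iota> v = x \<oplus>\<^bsub>Vt R M\<^esub> y"
    if "v \<in> carrier M" "x \<in> carrier (Vt R M)" "y \<in> carrier (Vt R M)" for v x y
    using that by (simp add: a_minus_def VT.M.add.m_ac VT.M.r_neg VT.M.r_neg1 VT.M.r_neg2)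
  show "cong_mod_t2 R M S (id_map (Vt R M)) \<longleftrightarrow> d = zero_map M M"
  proof -
    have "cong_mod_t2 R M S (id_map (Vt R M)) \<longleftrightarrow> (\<forall>v\<in>carrier M. d v = \<zero>\<^bsub>M\<^esub>)"
      by (simp add: cong_mod_t2_iff[OF S id] S_incl id_map_apply * linear_term_mem_t2Vt_iff
          del: One_nat_def)
    also have "\<dots> \<longleftrightarrow> d = zero_map M M"
      using Hom_eqI[OF d Hom_zero_map[OF module_axioms module_axioms]] by (auto simp: zero_map_def)
    finally show ?thesis .
  qed
  assume \<xi>: "\<xi> \<in> Hom R M M"
  note [simp] = Hom_closed[OF \<xi>]
  note E = extend_endo_Hom[OF \<xi>]
  have **: "(\<iota> v \<oplus>\<^bsub>Vt R M\<^esub> t_pow R 1 \<odot>\<^bsub>Vt R M\<^esub> \<iota> (d v) \<oplus>\<^bsub>Vt R M\<^esub> y) \<ominus>\<^bsub>Vt R M\<^esub> \<iota> v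
      \<ominus>\<^bsub>Vt R M\<^esub> t_pow R 1 \<odot>\<^bsub>Vt R M\<^esub> \<iota> (\<xi> v)
      = t_pow R 1 \<odot>\<^bsub>Vt R M\<^esub> \<iota> (d v \<ominus>\<^bsub>M\<^esub> \<xi> v) \<oplus>\<^bsub>Vt R M\<^esub> y"
    if "v \<in> carrier M" "y \<in> carrier (Vt R M)" for v y
    using that t
    by (simp add: * \<iota>_minus) (simp add: a_minus_def VT.smult_r_distr VT.smult_r_minus VT.M.add.m_ac)
  have "cong_mod_t2 R M (\<lambda>x. S x \<ominus>\<^bsub>Vt R M\<^esub> x) (\<lambda>x. t_pow R 1 \<odot>\<^bsub>Vt R M\<^esub> extend_endo R M \<xi> x)
      \<longleftrightarrow> cong_mod_t2 R M (restrict (\<lambda>x. S x \<ominus>\<^bsub>Vt R M\<^esub> id_map (Vt R M) x) (carrier (Vt R M)))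
        (restrict (\<lambda>x. t_pow R 1 \<odot>\<^bsub>Vt R M\<^esub> extend_endo R M \<xi> x) (carrier (Vt R M)))"
    by (subst cong_mod_t2_restrict) (simp add: id_map_apply cong: restrict_cong)
  also have "\<dots> \<longleftrightarrow> (\<forall>v\<in>carrier M. d v \<ominus>\<^bsub>M\<^esub> \<xi> v = \<zero>\<^bsub>M\<^esub>)"
    by (subst cong_mod_t2_iff[OF Hom_diff[OF module_Vt module_Vt S id] Hom_scale[OF module_Vt module_Vt E t]])
      (simp add: S_incl id_map_apply extend_endo_incl[OF \<xi>] ** linear_term_mem_t2Vt_iff
        M.minus_closed del: One_nat_def)
  also have "\<dots> \<longleftrightarrow> (\<forall>v\<in>carrier M. d v = \<xi> v)"
    by (simp add: M.a_minus_eq_zero_iff)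
  also have "\<dots> \<longleftrightarrow> \<xi> = d"
    using Hom_eqI[OF \<xi> d] by metis
  finally show "cong_mod_t2 R M (\<lambda>x. S x \<ominus>\<^bsub>Vt R M\<^esub> x)
      (\<lambda>x. t_pow R 1 \<odot>\<^bsub>Vt R M\<^esub> extend_endo R M \<xi> x) \<longleftrightarrow> \<xi> = d" .
qed

end


section \<open>Truncation modulo \<open>t\<^sup>2\<close>\<close>

context cring
begin

text \<open>Turns membership in the principal ideal into two coefficient conditions; conversely the
  shift by two places is the cofactor.\<close>

lemma t2_ideal_eq: "t2_ideal R = {p \<in> carrier (UP R). p 0 = \<zero> \<and> p 1 = \<zero>}"
proof (intro equalityI subsetI)
  interpret P: UP_cring R "UP R" by (rule UP_cring_R)
  fix p assume "p \<in> t2_ideal R"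
  then obtain q where q: "q \<in> carrier (UP R)" "p = q \<otimes>\<^bsub>UP R\<^esub> t_pow R 2"
    unfolding t2_ideal_def cgenideal_def by auto
  then have "p = t_pow R 2 \<otimes>\<^bsub>UP R\<^esub> q"
    using P.UP_m_comm t_pow_UP_closed by simp
  then have "p = t_pow R 2 \<otimes>\<^bsub>power_series R\<^esub> q"
    using q t_pow_UP_closed by (simp add: UP_mult_eq)
  moreover have "p \<in> carrier (UP R)" using q t_pow_UP_closed by simp
  ultimately show "p \<in> {p \<in> carrier (UP R). p 0 = \<zero> \<and> p 1 = \<zero>}"
    using UP_carrier_subset[OF q(1)] by (simp add: t_pow_mult)
next
  interpret P: UP_cring R "UP R" by (rule UP_cring_R)
  fix p assume p: "p \<in> {p \<in> carrier (UP R). p 0 = \<zero> \<and> p 1 = \<zero>}"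
  let ?q = "\<lambda>i. p (i + 2)"
  have up: "p \<in> up R" using p by (simp add: UP_def)
  then obtain n where "bound \<zero> n p" by blast
  \<comment> \<open>The old degree bound still serves after the shift, so the cofactor is again a
    polynomial.\<close>
  then have "bound \<zero> n ?q" by (auto simp: bound_def)
  then have q: "?q \<in> carrier (UP R)"
    using up by (auto simp: UP_def)
  have "p = t_pow R 2 \<otimes>\<^bsub>UP R\<^esub> ?q"
    using t_pow_two_mult_shift[OF UP_carrier_subset, of p] p UP_mult_eq[OF t_pow_UP_closed q] by simp
  then have "p = ?q \<otimes>\<^bsub>UP R\<^esub> t_pow R 2"
    using P.UP_m_comm[OF q t_pow_UP_closed] by simp
  then show "p \<in> t2_ideal R"
    unfolding t2_ideal_def cgenideal_def using q by blast
qed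

lemma ideal_t2_ideal: "ideal (t2_ideal R) (UP R)"
proof -
  interpret P: UP_cring R "UP R" by (rule UP_cring_R)
  show ?thesis
    unfolding t2_ideal_def by (rule cring.cgenideal_ideal[OF P.UP_cring t_pow_UP_closed])
qed

lemma cring_trunc_poly: "cring (trunc_poly R)"
proof -
  interpret P: UP_cring R "UP R" by (rule UP_cring_R)
  show ?thesis
    unfolding trunc_poly_def by (rule ideal.quotient_is_cring[OF ideal_t2_ideal P.UP_cring])
qed

lemma trunc_class_ring_hom: "trunc_class R \<in> ring_hom (UP R) (trunc_poly R)"
  using ideal.rcos_ring_hom[OF ideal_t2_ideal]
  by (simp add: trunc_class_def[abs_def] trunc_poly_def)

lemma trunc_poly_carrier: "carrier (trunc_poly R) = trunc_class R ` carrier (UP R)"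
  by (auto simp: trunc_poly_def trunc_class_def[abs_def] FactRing_def A_RCOSETS_def RCOSETS_def a_r_coset_def)

lemma trunc_class_mem_iff:
  assumes p: "p \<in> carrier (UP R)"
  shows "q \<in> trunc_class R p \<longleftrightarrow> q \<in> carrier (UP R) \<and> q 0 = p 0 \<and> q 1 = p 1"
proof -
  interpret P: UP_cring R "UP R" by (rule UP_cring_R)
  interpret I: ideal "t2_ideal R" "UP R" by (rule ideal_t2_ideal)
  have sub: "abelian_subgroup (t2_ideal R) (UP R)"
    by (intro abelian_subgroupI3 I.is_additive_subgroup P.UP_ring[THEN ring.is_abelian_group])
  show ?thesis
  proof (cases "q \<in> carrier (UP R)")
    case True
    have c: "p n \<in> carrier R" "q n \<in> carrier R" for n
      using UP_carrier_subset[OF True] UP_carrier_subset[OF p] by (simp_all add: power_series_sel)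
    have 1: "(q \<oplus>\<^bsub>UP R\<^esub> \<ominus>\<^bsub>UP R\<^esub> p) n = q n \<oplus> \<ominus> p n" for n
      using P.coeff_add[OF True P.UP_a_inv_closed[OF p], of n] P.coeff_a_inv[OF p, of n]
        True p P.UP_a_inv_closed[OF p] P.UP_a_closed[OF True P.UP_a_inv_closed[OF p]]
      by (simp add: UP_def)
    have 2: "q n \<oplus> \<ominus> p n = \<zero> \<longleftrightarrow> q n = p n" for n
      using a_minus_eq_zero_iff[of "q n" "p n"] c by (simp add: a_minus_def)
    have "q \<in> trunc_class R p \<longleftrightarrow> q \<oplus>\<^bsub>UP R\<^esub> \<ominus>\<^bsub>UP R\<^esub> p \<in> t2_ideal R"
      unfolding trunc_class_def by (rule abelian_subgroup.a_rcos_module[OF sub p True])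
    moreover have "q \<oplus>\<^bsub>UP R\<^esub> \<ominus>\<^bsub>UP R\<^esub> p \<in> carrier (UP R)"
      by (rule P.UP_a_closed[OF True P.UP_a_inv_closed[OF p]])
    ultimately show ?thesis
      using True by (simp only: t2_ideal_eq mem_Collect_eq 1 2 simp_thms)
  next
    case False
    then show ?thesis
      using abelian_subgroup.a_elemrcos_carrier[OF sub p] by (auto simp: trunc_class_def)
  qed
qed

lemma trunc_class_eq_iff:
  assumes "p \<in> carrier (UP R)" "q \<in> carrier (UP R)"
  shows "trunc_class R p = trunc_class R q \<longleftrightarrow> p 0 = q 0 \<and> p 1 = q 1"
proof
  assume "trunc_class R p = trunc_class R q"
  then have "p \<in> trunc_class R q" using trunc_class_mem_iff[OF assms(1), of p] assms by simp
  then show "p 0 = q 0 \<and> p 1 = q 1" using trunc_class_mem_iff[OF assms(2)] by simp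
next
  assume "p 0 = q 0 \<and> p 1 = q 1"
  then show "trunc_class R p = trunc_class R q"
    by (intro Set.set_eqI) (simp add: trunc_class_mem_iff assms)
qed

text \<open>The canonical map K[[t]] -> K[t]/(t^2). Classes are cosets of polynomials, so a series
  is cut after degree 1 first. It turns modules over K[t]/(t^2) into modules over K[[t]].\<close>

definition trunc_series :: "(nat \<Rightarrow> 'a) \<Rightarrow> (nat \<Rightarrow> 'a) set" where
  "trunc_series f = trunc_class R (truncate 1 f)"

lemma trunc_series_UP: "p \<in> carrier (UP R) \<Longrightarrow> trunc_series p = trunc_class R p"
  by (simp add: trunc_series_def trunc_class_eq_iff truncate_closed UP_carrier_subset truncate_le)

text \<open>A class is determined by its coefficients 0 and 1, and those of a sum or product depend
  only on the same coefficients of the operands.\<close>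

lemma trunc_series_ring_hom: "trunc_series \<in> ring_hom (power_series R) (trunc_poly R)"
proof -
  interpret P: UP_cring R "UP R" by (rule UP_cring_R)
  note h = ring_hom_closed[OF trunc_class_ring_hom] ring_hom_add[OF trunc_class_ring_hom]
    ring_hom_mult[OF trunc_class_ring_hom] ring_hom_one[OF trunc_class_ring_hom]
  interpret PS: cring "power_series R" by (rule cring_power_series)
  show ?thesis
  proof (rule ring_hom_memI)
    fix f g assume f: "f \<in> carrier (power_series R)" and g: "g \<in> carrier (power_series R)"
    note t = truncate_closed[OF f] truncate_closed[OF g]
    show "trunc_series f \<in> carrier (trunc_poly R)"
      unfolding trunc_series_def by (rule h(1)[OF t(1)])
    have "trunc_class R (truncate 1 (f \<otimes>\<^bsub>power_series R\<^esub> g))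
        = trunc_class R (truncate 1 f \<otimes>\<^bsub>UP R\<^esub> truncate 1 g)"
      using power_series_mult_truncate[OF f g, of 0 1] power_series_mult_truncate[OF f g, of 1 1]
      by (subst trunc_class_eq_iff)
        (simp_all add: truncate_closed t truncate_le PS.m_closed f g)
    then show "trunc_series (f \<otimes>\<^bsub>power_series R\<^esub> g) = trunc_series f \<otimes>\<^bsub>trunc_poly R\<^esub> trunc_series g"
      unfolding trunc_series_def using h(3)[OF t] by simp
    have "trunc_class R (truncate 1 (f \<oplus>\<^bsub>power_series R\<^esub> g))
        = trunc_class R (truncate 1 f \<oplus>\<^bsub>UP R\<^esub> truncate 1 g)"
      by (subst trunc_class_eq_iff)
        (simp_all add: truncate_closed t PS.add.m_closed f g, simp_all add: UP_add_eq t power_series_sel truncate_le)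
    then show "trunc_series (f \<oplus>\<^bsub>power_series R\<^esub> g) = trunc_series f \<oplus>\<^bsub>trunc_poly R\<^esub> trunc_series g"
      unfolding trunc_series_def using h(2)[OF t] by simp
  next
    show "trunc_series \<one>\<^bsub>power_series R\<^esub> = \<one>\<^bsub>trunc_poly R\<^esub>"
      using trunc_series_UP[OF P.UP_one_closed] h(4) by (simp add: UP_one_eq)
  qed
qed

lemma trunc_class_t_pow_two: "trunc_class R (t_pow R 2) = \<zero>\<^bsub>trunc_poly R\<^esub>"
proof -
  interpret P: UP_cring R "UP R" by (rule UP_cring_R)
  interpret I: ideal "t2_ideal R" "UP R" by (rule ideal_t2_ideal)
  have "trunc_class R (t_pow R 2) = trunc_class R \<zero>\<^bsub>UP R\<^esub>"
    by (subst trunc_class_eq_iff) (auto simp: t_pow_UP_closed t_pow_eq UP_zero_eq power_series_sel UP_def up_def)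
  also have "\<dots> = \<zero>\<^bsub>trunc_poly R\<^esub>"
    using I.rcos_ring_hom_ring[THEN ring_hom_ring.homh] trunc_class_ring_hom
      ring_hom_zero[OF trunc_class_ring_hom P.UP_ring] cring_trunc_poly by (simp add: cring_def)
  finally show ?thesis .
qed

end


section \<open>The truncated module as an extension of scalars to K[t]/(t^2)\<close>

context module
begin

abbreviation Q where "Q \<equiv> quotient_module (Vt R M) (t2Vt R M)"

lemma module_Q: "module PS Q"
  by (rule module.module_quotient_module[OF module_Vt submodule_t2Vt])

lemma t_pow_two_smult_Q:
  assumes "X \<in> carrier Q"
  shows "t_pow R 2 \<odot>\<^bsub>Q\<^esub> X = \<zero>\<^bsub>Q\<^esub>"
proof -
  interpret VT: module PS "Vt R M" by (rule module_Vt)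
  interpret Q: module PS Q by (rule module_Q)
  note [simp del] = Vt_sel quotient_module_sel
  obtain x where x: "x \<in> carrier (Vt R M)" "X = t2Vt R M +>\<^bsub>Vt R M\<^esub> x"
    using assms unfolding VT.quotient_carrier by blast
  have "t_pow R 2 \<odot>\<^bsub>Vt R M\<^esub> x \<in> t2Vt R M"
    using x unfolding t2Vt_def by simp
  then show ?thesis
    unfolding x VT.quotient_smult[OF submodule_t2Vt R.t_pow_closed x(1)] quotient_module_sel(2)
    by (rule abelian_subgroup.a_rcos_const[OF VT.submodule_abelian_subgroup[OF submodule_t2Vt]])
qed

text \<open>The difference f - g is divisible by t^2, which annihilates the quotient.\<close>

lemma smult_Q_cong:
  assumes f: "f \<in> carrier PS" and g: "g \<in> carrier PS" and eq: "f 0 = g 0" "f 1 = g 1"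
    and X: "X \<in> carrier Q"
  shows "f \<odot>\<^bsub>Q\<^esub> X = g \<odot>\<^bsub>Q\<^esub> X"
proof -
  interpret Q: module PS Q by (rule module_Q)
  have fg: "f \<ominus>\<^bsub>PS\<^esub> g \<in> carrier PS"
    using f g by (rule Q.R.minus_closed)
  \<comment> \<open>Subtraction in K[[t]] is defined through the abstract additive inverse; its
    coefficients are recovered from this sum.\<close>
  have "f = (f \<ominus>\<^bsub>PS\<^esub> g) \<oplus>\<^bsub>PS\<^esub> g"
    using f g by (simp add: a_minus_def Q.R.a_assoc Q.R.l_neg)
  then have "f n = (f \<ominus>\<^bsub>PS\<^esub> g) n \<oplus> g n" for n
    by (metis power_series_sel(4))
  moreover have c: "f n \<in> carrier R" "g n \<in> carrier R" "(f \<ominus>\<^bsub>PS\<^esub> g) n \<in> carrier R" for n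
    using f g fg by (simp_all add: power_series_sel)
  ultimately have "(f \<ominus>\<^bsub>PS\<^esub> g) n = \<zero>" if "f n = g n" for n
    using that by (metis R.add.r_cancel_one')
  then have "t_pow R 2 \<otimes>\<^bsub>PS\<^esub> (\<lambda>i. (f \<ominus>\<^bsub>PS\<^esub> g) (i + 2)) = f \<ominus>\<^bsub>PS\<^esub> g"
    using eq by (intro R.t_pow_two_mult_shift fg) simp_all
  then show ?thesis
    using f g X c(3) R.t_pow_closed t_pow_two_smult_Q
    by (intro Q.smult_eq_mod_annihilator[of f g "t_pow R 2" "\<lambda>i. (f \<ominus>\<^bsub>PS\<^esub> g) (i + 2)"])
      (simp_all add: power_series_sel)
qed

abbreviation TP where "TP \<equiv> trunc_poly R"
abbreviation TV where "TV \<equiv> trunc_Vt R M"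

lemma trunc_Vt_sel:
  "carrier TV = carrier Q" "zero TV = zero Q" "add TV = add Q"
  by (simp_all add: trunc_Vt_def)

text \<open>The outer union in \<open>trunc_Vt\<close> runs over all polynomials in a class; by
  \<open>smult_Q_cong\<close> they act alike on the quotient, so any representative computes the
  action.\<close>

lemma trunc_Vt_smult_class:
  assumes p: "p \<in> carrier (UP R)" and X: "X \<in> carrier Q"
  shows "trunc_class R p \<odot>\<^bsub>TV\<^esub> X = p \<odot>\<^bsub>Q\<^esub> X"
proof -
  have "q \<odot>\<^bsub>Q\<^esub> X = p \<odot>\<^bsub>Q\<^esub> X" if "q \<in> trunc_class R p" for q
    using that X p by (intro smult_Q_cong) (simp_all add: R.trunc_class_mem_iff UP_carrier_subset)
  moreover have "trunc_class R p \<noteq> {}"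
    using R.trunc_class_mem_iff[OF p, of p] p by blast
  ultimately have "(\<Union>q\<in>trunc_class R p. q \<odot>\<^bsub>Q\<^esub> X) = p \<odot>\<^bsub>Q\<^esub> X"
    by (intro SUP_eq_const)
  then show ?thesis
    by (simp add: trunc_Vt_def)
qed

lemma trunc_Vt_smult_series:
  assumes f: "f \<in> carrier PS" and X: "X \<in> carrier Q"
  shows "R.trunc_series f \<odot>\<^bsub>TV\<^esub> X = f \<odot>\<^bsub>Q\<^esub> X"
  unfolding R.trunc_series_def trunc_Vt_smult_class[OF R.truncate_closed[OF f] X]
  using f X R.truncate_closed'[OF f] by (intro smult_Q_cong) (simp_all add: R.truncate_le)

lemma trunc_poly_cases:
  assumes "a \<in> carrier TP"
  obtains f where "f \<in> carrier PS" "a = R.trunc_series f"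
proof -
  obtain p where p: "p \<in> carrier (UP R)" "a = trunc_class R p"
    using assms unfolding R.trunc_poly_carrier by (elim imageE)
  then show thesis
    by (intro that[OF UP_carrier_subset[OF p(1)]]) (simp add: R.trunc_series_UP)
qed

lemmas trunc_series_rules = ring_hom_closed[OF R.trunc_series_ring_hom]
  ring_hom_add[OF R.trunc_series_ring_hom] ring_hom_mult[OF R.trunc_series_ring_hom]
  ring_hom_one[OF R.trunc_series_ring_hom]

text \<open>Every scalar is the image of a series under \<open>trunc_series\<close>, and the series
  acts in the same way on the quotient; the axioms are those of the quotient as a
  K[[t]]-module.\<close>

lemma module_trunc_Vt: "module TP TV"
proof -
  interpret Q: module PS Q by (rule module_Q)
  note [simp del] = quotient_module_sel
  have smult: "a \<odot>\<^bsub>TV\<^esub> X \<in> carrier Q" if "a \<in> carrier TP" "X \<in> carrier Q" for a X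
    using that by (elim trunc_poly_cases) (simp add: trunc_Vt_smult_series)
  show ?thesis
  proof (rule moduleI[OF R.cring_trunc_poly]; (unfold trunc_Vt_sel)?)
    show "abelian_group TV"
      using Q.abelian_group_axioms by (rule abelian_group_cong) (simp_all add: trunc_Vt_sel)
    show "a \<odot>\<^bsub>TV\<^esub> X \<in> carrier Q" if "a \<in> carrier TP" "X \<in> carrier Q" for a X
      using that by (rule smult)
    show "a \<odot>\<^bsub>TV\<^esub> (X \<oplus>\<^bsub>Q\<^esub> Y) = a \<odot>\<^bsub>TV\<^esub> X \<oplus>\<^bsub>Q\<^esub> a \<odot>\<^bsub>TV\<^esub> Y"
      if "a \<in> carrier TP" "X \<in> carrier Q" "Y \<in> carrier Q" for a X Y
      using that by (elim trunc_poly_cases) (simp add: trunc_Vt_smult_series Q.smult_r_distr)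
    show "\<one>\<^bsub>TP\<^esub> \<odot>\<^bsub>TV\<^esub> X = X" if "X \<in> carrier Q" for X
      using that trunc_Vt_smult_series[of "\<one>\<^bsub>PS\<^esub>" X] by (simp add: trunc_series_rules)
    fix a b X assume ab: "a \<in> carrier TP" "b \<in> carrier TP" and X: "X \<in> carrier Q"
    obtain f g where f: "f \<in> carrier PS" "a = R.trunc_series f"
      and g: "g \<in> carrier PS" "b = R.trunc_series g"
      using ab by (elim trunc_poly_cases)
    show "(a \<oplus>\<^bsub>TP\<^esub> b) \<odot>\<^bsub>TV\<^esub> X = a \<odot>\<^bsub>TV\<^esub> X \<oplus>\<^bsub>Q\<^esub> b \<odot>\<^bsub>TV\<^esub> X"
      using X f g
      by (simp add: trunc_series_rules(2)[symmetric] trunc_Vt_smult_series Q.smult_l_distr)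
    show "(a \<otimes>\<^bsub>TP\<^esub> b) \<odot>\<^bsub>TV\<^esub> X = a \<odot>\<^bsub>TV\<^esub> (b \<odot>\<^bsub>TV\<^esub> X)"
      using X f g
      by (simp add: trunc_series_rules(3)[symmetric] trunc_Vt_smult_series Q.smult_assoc1)
  qed
qed

abbreviation j' where "j' \<equiv> \<lambda>a. trunc_class R (const_poly R a)"
abbreviation \<iota>' where "\<iota>' \<equiv> trunc_incl R M"

lemma trunc_const_eq: "a \<in> carrier R \<Longrightarrow> j' a = R.trunc_series (const_poly R a)"
  by (simp add: R.trunc_series_UP R.const_poly_UP_closed)

lemma trunc_const_ring_hom: "j' \<in> ring_hom R TP"
proof (rule ring_hom_memI)
  note c = ring_hom_closed[OF R.const_poly_ring_hom] ring_hom_add[OF R.const_poly_ring_hom]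
    ring_hom_mult[OF R.const_poly_ring_hom] ring_hom_one[OF R.const_poly_ring_hom]
  show "j' \<one> = \<one>\<^bsub>TP\<^esub>" by (simp only: trunc_const_eq R.one_closed) (simp only: c trunc_series_rules)
  fix a b assume ab: "a \<in> carrier R" "b \<in> carrier R"
  show "j' a \<in> carrier TP" using ab by (simp only: trunc_const_eq) (simp only: c trunc_series_rules)
  show "j' (a \<otimes> b) = j' a \<otimes>\<^bsub>TP\<^esub> j' b"
    using ab by (simp only: trunc_const_eq R.m_closed) (simp only: c trunc_series_rules)
  show "j' (a \<oplus> b) = j' a \<oplus>\<^bsub>TP\<^esub> j' b"
    using ab by (simp only: trunc_const_eq R.add.m_closed) (simp only: c trunc_series_rules)
qed

text \<open>With K[t]/(t^2) viewed as a K[[t]]-module, f first extends to V_t. The extension kills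
  t^2 V_t and so descends; the descended map is linear over K[t]/(t^2) because every scalar comes
  from a series.\<close>

lemma trunc_extension:
  assumes f: "f \<in> Hom R M (restrict_scalars j' (regular_module TP))"
  shows "\<exists>g\<in>Hom TP TV (regular_module TP). \<forall>v\<in>carrier M. g (\<iota>' v) = f v"
proof -
  interpret VT: module PS "Vt R M" by (rule module_Vt)
  interpret Q: module PS Q by (rule module_Q)
  interpret TP: cring TP by (rule R.cring_trunc_poly)
  note [simp del] = quotient_module_sel Vt_sel
  let ?N = "restrict_scalars R.trunc_series (regular_module TP)"
  have N: "module PS ?N"
    by (rule module_restrict_scalars[OF R.cring_power_series R.trunc_series_ring_hom
          module_regular_module[OF R.cring_trunc_poly]])
  \<comment> \<open>On constants \<open>trunc_series\<close> after \<open>const_poly\<close> is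
    \<open>j'\<close>, so restricting in two stages gives the same K-module.\<close>
  have "f \<in> Hom R M (restrict_scalars (const_poly R) ?N)"
    using f by (simp add: Hom_def trunc_const_eq)
  from Vt_extension[OF N this]
  obtain g where g: "g \<in> Hom PS (Vt R M) ?N" "\<And>v. v \<in> carrier M \<Longrightarrow> g (\<iota> v) = f v"
    by (elim bexE) simp
  have g0: "g h = \<zero>\<^bsub>?N\<^esub>" if "h \<in> t2Vt R M" for h
    using that Hom_smult[OF g(1) R.t_pow_closed] Hom_closed[OF g(1)]
    by (auto simp: t2Vt_def R.trunc_series_UP R.t_pow_UP_closed R.trunc_class_t_pow_two)
  obtain h where h: "h \<in> Hom PS Q ?N"
    "\<And>x. x \<in> carrier (Vt R M) \<Longrightarrow> h (t2Vt R M +>\<^bsub>Vt R M\<^esub> x) = g x"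
    using VT.quotient_lift[OF submodule_t2Vt g(1) N g0] by metis
  have "h \<in> Hom TP TV (regular_module TP)"
  proof (rule HomI; (unfold trunc_Vt_sel)?)
    fix a X assume "a \<in> carrier TP" and X: "X \<in> carrier Q"
    then obtain p where "p \<in> carrier PS" "a = R.trunc_series p" by (elim trunc_poly_cases)
    then show "h (a \<odot>\<^bsub>TV\<^esub> X) = a \<odot>\<^bsub>regular_module TP\<^esub> h X"
      using X Hom_smult[OF h(1)] by (simp add: trunc_Vt_smult_series)
  qed (use Hom_closed[OF h(1)] Hom_add[OF h(1)] Hom_extensional[OF h(1)] in simp_all)
  moreover have "h (\<iota>' v) = f v" if "v \<in> carrier M" for v
    using that by (simp add: trunc_incl_def h(2) g(2) Vt_incl_closed)
  ultimately show ?thesis by blast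
qed

lemma base_change_trunc: "base_change R M TP TV j' \<iota>'"
proof (intro base_change.intro base_change_axioms.intro module_axioms module_trunc_Vt
    trunc_const_ring_hom trunc_extension; (unfold trunc_Vt_sel)?)
  interpret VT: module PS "Vt R M" by (rule module_Vt)
  note [simp del] = quotient_module_sel Vt_sel
  note H = submodule_t2Vt
  show "\<iota>' v \<in> carrier Q" if "v \<in> carrier M" for v
    using that Vt_incl_closed unfolding VT.quotient_carrier trunc_incl_def by blast
  show "\<iota>' (v \<oplus>\<^bsub>M\<^esub> w) = \<iota>' v \<oplus>\<^bsub>Q\<^esub> \<iota>' w" if "v \<in> carrier M" "w \<in> carrier M" for v w
    using that by (simp add: trunc_incl_def Vt_incl_add VT.quotient_add[OF H] Vt_incl_closed)
  show "\<iota>' (a \<odot>\<^bsub>M\<^esub> v) = j' a \<odot>\<^bsub>TV\<^esub> \<iota>' v" if "a \<in> carrier R" "v \<in> carrier M" for a v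
  proof -
    have "\<iota>' v \<in> carrier Q"
      using that Vt_incl_closed unfolding VT.quotient_carrier trunc_incl_def by blast
    then show ?thesis
      using that by (simp add: trunc_const_eq trunc_Vt_smult_series R.const_poly_closed)
        (simp add: trunc_incl_def Vt_incl_smult VT.quotient_smult[OF H] Vt_incl_closed R.const_poly_closed)
  qed
  fix S assume S: "submodule S TP TV" and sub: "\<iota>' ` carrier M \<subseteq> S"
  interpret TV: module TP TV by (rule module_trunc_Vt)
  \<comment> \<open>Generation is inherited from V_t: the preimage of S is a K[[t]]-submodule
    containing \<open>\<iota>\<close> V.\<close>
  let ?S = "{x \<in> carrier (Vt R M). t2Vt R M +>\<^bsub>Vt R M\<^esub> x \<in> S}"
  have "submodule ?S PS (Vt R M)"
  proof (rule VT.submoduleI)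
    interpret Q: module PS Q by (rule module_Q)
    have "\<zero>\<^bsub>TV\<^esub> \<in> S"
      using subgroup.one_closed[OF submodule.axioms(1)[OF S]] by simp
    then show "\<zero>\<^bsub>Vt R M\<^esub> \<in> ?S"
      by (simp add: trunc_Vt_sel VT.quotient_zero[OF H, symmetric])
    fix x y assume x: "x \<in> ?S"
    show smult: "p \<odot>\<^bsub>Vt R M\<^esub> x \<in> ?S" if p: "p \<in> carrier PS" for p
    proof -
      have "t2Vt R M +>\<^bsub>Vt R M\<^esub> x \<in> carrier Q" using x unfolding VT.quotient_carrier by blast
      then have "R.trunc_series p \<odot>\<^bsub>TV\<^esub> (t2Vt R M +>\<^bsub>Vt R M\<^esub> x) = t2Vt R M +>\<^bsub>Vt R M\<^esub> (p \<odot>\<^bsub>Vt R M\<^esub> x)"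
        using p x by (simp add: trunc_Vt_smult_series VT.quotient_smult[OF H])
      then show ?thesis
        using p x TV.submoduleE(4)[OF S trunc_series_rules(1)[OF p], of "t2Vt R M +>\<^bsub>Vt R M\<^esub> x"]
        by simp
    qed
    then have "(\<ominus>\<^bsub>PS\<^esub> \<one>\<^bsub>PS\<^esub>) \<odot>\<^bsub>Vt R M\<^esub> x \<in> ?S" by simp
    then show "\<ominus>\<^bsub>Vt R M\<^esub> x \<in> ?S"
      using x by (simp add: VT.smult_l_minus)
    assume y: "y \<in> ?S"
    then show "x \<oplus>\<^bsub>Vt R M\<^esub> y \<in> ?S"
      using x TV.submoduleE(5)[OF S, of "t2Vt R M +>\<^bsub>Vt R M\<^esub> x" "t2Vt R M +>\<^bsub>Vt R M\<^esub> y"]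
      by (simp add: trunc_Vt_sel VT.quotient_add[OF H])
  qed auto
  then have "carrier (Vt R M) \<subseteq> ?S"
    by (rule Vt_span) (use sub Vt_incl_closed in \<open>auto simp: trunc_incl_def\<close>)
  then show "carrier Q \<subseteq> S" unfolding VT.quotient_carrier by auto
qed

end


section \<open>The primary obstruction\<close>

context module
begin

context
  fixes \<beta> \<gamma> \<beta>1 \<gamma>1
  assumes sb: "switchback_pair R M \<beta> \<gamma>"
    and \<beta>1: "\<beta>1 \<in> Hom R (tensor R M M) (regular_module R)"
    and \<gamma>1: "\<gamma>1 \<in> Hom R (regular_module R) (tensor R M M)"
begin

lemma pairing_Hom: "\<beta> \<in> Hom R (tensor R M M) (regular_module R)"
  and copairing_Hom: "\<gamma> \<in> Hom R (regular_module R) (tensor R M M)"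
  and snake_id: "snake_left R M \<beta> \<gamma> = id_map M" "snake_right R M \<beta> \<gamma> = id_map M"
  using sb by (simp_all add: switchback_pair_def)

lemma d21_Hom: "d21 R M \<beta> \<gamma> \<beta>1 \<gamma>1 \<in> Hom R M M"
  unfolding d21_def
  by (intro Hom_add_map module_axioms snake_left_Hom pairing_Hom copairing_Hom \<beta>1 \<gamma>1)

lemma d22_Hom: "d22 R M \<beta> \<gamma> \<beta>1 \<gamma>1 \<in> Hom R M M"
  unfolding d22_def
  by (intro Hom_add_map module_axioms snake_right_Hom pairing_Hom copairing_Hom \<beta>1 \<gamma>1)

lemma deformation_Vt:
  "base_change_deformation R M PS (Vt R M) (const_poly R) \<iota> (t_pow R 1) \<beta> \<beta>1 \<gamma> \<gamma>1"
  by (intro base_change_deformation.intro base_change_Vt base_change_deformation_axioms.intro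
      R.t_pow_closed pairing_Hom \<beta>1 copairing_Hom \<gamma>1)

lemma deformation_trunc:
  "base_change_deformation R M TP TV j' \<iota>' (trunc_class R (t_pow R 1)) \<beta> \<beta>1 \<gamma> \<gamma>1"
  by (intro base_change_deformation.intro base_change_trunc base_change_deformation_axioms.intro
      ring_hom_closed[OF R.trunc_class_ring_hom R.t_pow_UP_closed] pairing_Hom \<beta>1 copairing_Hom \<gamma>1)

abbreviation "S1 \<equiv> snake_left PS (Vt R M) (beta_t R M \<beta> \<beta>1) (gamma_t R M \<gamma> \<gamma>1)"
abbreviation "S2 \<equiv> snake_right PS (Vt R M) (beta_t R M \<beta> \<beta>1) (gamma_t R M \<gamma> \<gamma>1)"

text \<open>The switchback condition on the undeformed pair turns the constant term into
  \<open>\<iota>\<close> v.\<close>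

lemma snake_t_incl:
  assumes v: "v \<in> carrier M"
  shows "S1 (\<iota> v) = \<iota> v \<oplus>\<^bsub>Vt R M\<^esub> t_pow R 1 \<odot>\<^bsub>Vt R M\<^esub> \<iota> (d21 R M \<beta> \<gamma> \<beta>1 \<gamma>1 v)
      \<oplus>\<^bsub>Vt R M\<^esub> t_pow R 2 \<odot>\<^bsub>Vt R M\<^esub> \<iota> (snake_left R M \<beta>1 \<gamma>1 v)"
    and "S2 (\<iota> v) = \<iota> v \<oplus>\<^bsub>Vt R M\<^esub> t_pow R 1 \<odot>\<^bsub>Vt R M\<^esub> \<iota> (d22 R M \<beta> \<gamma> \<beta>1 \<gamma>1 v)
      \<oplus>\<^bsub>Vt R M\<^esub> t_pow R 2 \<odot>\<^bsub>Vt R M\<^esub> \<iota> (snake_right R M \<beta>1 \<gamma>1 v)"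
proof -
  have two: "t_pow R 1 \<otimes>\<^bsub>PS\<^esub> t_pow R 1 = t_pow R 2"
    by (simp only: R.t_pow_mult_t_pow one_add_one)
  show "S1 (\<iota> v) = \<iota> v \<oplus>\<^bsub>Vt R M\<^esub> t_pow R 1 \<odot>\<^bsub>Vt R M\<^esub> \<iota> (d21 R M \<beta> \<gamma> \<beta>1 \<gamma>1 v)
      \<oplus>\<^bsub>Vt R M\<^esub> t_pow R 2 \<odot>\<^bsub>Vt R M\<^esub> \<iota> (snake_left R M \<beta>1 \<gamma>1 v)"
    unfolding beta_t_def gamma_t_def
    using base_change_deformation.snake_left_deformed[OF deformation_Vt v]
    by (simp only: two snake_id id_map_apply v)
  show "S2 (\<iota> v) = \<iota> v \<oplus>\<^bsub>Vt R M\<^esub> t_pow R 1 \<odot>\<^bsub>Vt R M\<^esub> \<iota> (d22 R M \<beta> \<gamma> \<beta>1 \<gamma>1 v)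
      \<oplus>\<^bsub>Vt R M\<^esub> t_pow R 2 \<odot>\<^bsub>Vt R M\<^esub> \<iota> (snake_right R M \<beta>1 \<gamma>1 v)"
    unfolding beta_t_def gamma_t_def
    using base_change_deformation.snake_right_deformed[OF deformation_Vt v]
    by (simp only: two snake_id id_map_apply v)
qed

lemma snake_t_Hom: "S1 \<in> Hom PS (Vt R M) (Vt R M)" "S2 \<in> Hom PS (Vt R M) (Vt R M)"
  unfolding beta_t_def gamma_t_def
  by (rule base_change_deformation.snake_left_deformed_Hom[OF deformation_Vt]
      base_change_deformation.snake_right_deformed_Hom[OF deformation_Vt])+

lemma snake_1_closed:
  "v \<in> carrier M \<Longrightarrow> snake_left R M \<beta>1 \<gamma>1 v \<in> carrier M"
  "v \<in> carrier M \<Longrightarrow> snake_right R M \<beta>1 \<gamma>1 v \<in> carrier M"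
  using Hom_closed[OF snake_left_Hom[OF \<beta>1 \<gamma>1]] Hom_closed[OF snake_right_Hom[OF \<beta>1 \<gamma>1]]
  by simp_all

lemma primary_obstruction_iff:
  "primary_obstruction R M \<beta> \<gamma> \<beta>1 \<gamma>1 \<xi>1 \<xi>2 \<longleftrightarrow>
    \<xi>1 = d21 R M \<beta> \<gamma> \<beta>1 \<gamma>1 \<and> \<xi>2 = d22 R M \<beta> \<gamma> \<beta>1 \<gamma>1"
  unfolding primary_obstruction_def
  using cong_linear_term_iff[OF snake_t_Hom(1) d21_Hom snake_1_closed(1) snake_t_incl(1), of \<xi>1]
    cong_linear_term_iff[OF snake_t_Hom(2) d22_Hom snake_1_closed(2) snake_t_incl(2), of \<xi>2]
    d21_Hom d22_Hom
  by blast

lemma defines_deformation_iff: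
  "defines_deformation R M \<beta> \<gamma> \<beta>1 \<gamma>1 \<longleftrightarrow> two_cocycle R M \<beta> \<gamma> \<beta>1 \<gamma>1"
  unfolding defines_deformation_def two_cocycle_def
  using cong_id_iff[OF snake_t_Hom(1) d21_Hom snake_1_closed(1) snake_t_incl(1)]
    cong_id_iff[OF snake_t_Hom(2) d22_Hom snake_1_closed(2) snake_t_incl(2)]
  by blast

text \<open>The cocycle condition removes the term linear in \<tau>, and \<tau>^2 = 0 removes the
  quadratic one. Both snake maps then agree with the identity on \<open>\<iota>'\<close> V, hence
  everywhere because it generates.\<close>

lemma switchback_pair_trunc:
  assumes coc: "two_cocycle R M \<beta> \<gamma> \<beta>1 \<gamma>1"
  shows "switchback_pair TP TV (beta_tilde R M \<beta> \<beta>1) (gamma_tilde R M \<gamma> \<gamma>1)"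
proof -
  interpret B: base_change_deformation R M TP TV j' \<iota>' "trunc_class R (t_pow R 1)" \<beta> \<beta>1 \<gamma> \<gamma>1
    by (rule deformation_trunc)
  note t = R.t_pow_UP_closed
  have "trunc_class R (t_pow R 1) \<otimes>\<^bsub>TP\<^esub> trunc_class R (t_pow R 1) = trunc_class R (t_pow R 2)"
    using ring_hom_mult[OF R.trunc_class_ring_hom t t, of 1 1] UP_mult_eq[OF t t, of 1 1]
    by (simp only: R.t_pow_mult_t_pow one_add_one)
  then have sq: "trunc_class R (t_pow R 1) \<otimes>\<^bsub>TP\<^esub> trunc_class R (t_pow R 1) = \<zero>\<^bsub>TP\<^esub>"
    by (simp add: R.trunc_class_t_pow_two)
  have z: "\<iota>' \<zero>\<^bsub>M\<^esub> = \<zero>\<^bsub>TV\<^esub>"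
    using B.\<iota>_add[of "\<zero>\<^bsub>M\<^esub>" "\<zero>\<^bsub>M\<^esub>"] B.\<iota>_closed[of "\<zero>\<^bsub>M\<^esub>"]
    by (metis M.zero_closed M.l_zero B.M.M.add.r_cancel_one')
  have d: "d21 R M \<beta> \<gamma> \<beta>1 \<gamma>1 v = \<zero>\<^bsub>M\<^esub>" "d22 R M \<beta> \<gamma> \<beta>1 \<gamma>1 v = \<zero>\<^bsub>M\<^esub>"
    if "v \<in> carrier M" for v
    using coc that by (simp_all add: two_cocycle_def zero_map_def)
  note id = Hom_id_map[OF module_trunc_Vt]
  have "snake_left TP TV B.\<beta>' B.\<gamma>' = id_map TV"
    by (rule B.Hom_eq_on_V[OF module_trunc_Vt B.snake_left_deformed_Hom id])
      (simp only: B.snake_left_deformed sq z d snake_id id_map_apply B.\<iota>_closed snake_1_closed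
        B.M.smult_l_null B.M.smult_r_null B.\<tau> B.M.M.r_zero)
  moreover have "snake_right TP TV B.\<beta>' B.\<gamma>' = id_map TV"
    by (rule B.Hom_eq_on_V[OF module_trunc_Vt B.snake_right_deformed_Hom id])
      (simp only: B.snake_right_deformed sq z d snake_id id_map_apply B.\<iota>_closed snake_1_closed
        B.M.smult_l_null B.M.smult_r_null B.\<tau> B.M.M.r_zero)
  ultimately show ?thesis
    unfolding switchback_pair_def beta_tilde_def gamma_tilde_def
    using module_trunc_Vt B.deformed_pairing_Hom B.deformed_copairing_Hom by simp
qed

end

end

theorem proposition3p3:
  fixes K :: "('a, 'k) ring_scheme" and V :: "('a, 'v, 'm) module_scheme"
    and \<beta> \<beta>1 :: "('v \<times> 'v \<Rightarrow> 'a) set \<Rightarrow> 'a"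
    and \<gamma> \<gamma>1 :: "'a \<Rightarrow> ('v \<times> 'v \<Rightarrow> 'a) set"
  assumes "cring K" and "module K V"
    and "switchback_pair K V \<beta> \<gamma>"
    and "\<beta>1 \<in> Hom K (tensor K V V) (regular_module K)"
    and "\<gamma>1 \<in> Hom K (regular_module K) (tensor K V V)"
  shows "((\<forall>\<xi>1 \<xi>2. primary_obstruction K V \<beta> \<gamma> \<beta>1 \<gamma>1 \<xi>1 \<xi>2 \<longleftrightarrow>
             \<xi>1 = d21 K V \<beta> \<gamma> \<beta>1 \<gamma>1 \<and> \<xi>2 = d22 K V \<beta> \<gamma> \<beta>1 \<gamma>1) \<and>
          (defines_deformation K V \<beta> \<gamma> \<beta>1 \<gamma>1 \<longleftrightarrow> two_cocycle K V \<beta> \<gamma> \<beta>1 \<gamma>1)) \<and>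
         ((primary_obstruction K V \<beta> \<gamma> \<beta>1 \<gamma>1 (zero_map V V) (zero_map V V) \<longleftrightarrow>
             two_cocycle K V \<beta> \<gamma> \<beta>1 \<gamma>1) \<and>
          (primary_obstruction K V \<beta> \<gamma> \<beta>1 \<gamma>1 (zero_map V V) (zero_map V V) \<longrightarrow>
             switchback_pair (trunc_poly K) (trunc_Vt K V)
               (beta_tilde K V \<beta> \<beta>1) (gamma_tilde K V \<gamma> \<gamma>1)))"
proof -
  interpret V: module K V by fact
  note obstruction = V.primary_obstruction_iff[OF assms(3-5)]
  \<comment> \<open>With the obstruction identified as the pair of differentials, its vanishing is
    the cocycle condition by definition.\<close>
  have vanishing: "primary_obstruction K V \<beta> \<gamma> \<beta>1 \<gamma>1 (zero_map V V) (zero_map V V)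
      \<longleftrightarrow> two_cocycle K V \<beta> \<gamma> \<beta>1 \<gamma>1"
    unfolding obstruction two_cocycle_def by auto
  show ?thesis
    using obstruction vanishing V.defines_deformation_iff[OF assms(3-5)]
      V.switchback_pair_trunc[OF assms(3-5)] by blast
qed

end
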